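(* Let $\alpha$ and $d$ be positive constants with $\alpha\le 1$ and $d<\pi/2$, and let $\mathscr{D}=\psi(\mathscr{D}_d)$, where $\psi$ is the double-exponential transformation. Let $g$ be continuous on $[a,b]$ and $k$ continuous on $[a,b]\times[a,b]$. Assume that $g$, $k(z,\cdot)$ and $k(\cdot,w)$ belong to $\mathbf{H}^\infty(\mathscr{D})$ for all $z,w\in\mathscr{D}$, and that $g$, $k(t,\cdot)$ and $k(\cdot,s)$ belong to $C([a,b])$ for all $t,s\in[a,b]$. Furthermore, assume that $g\in\mathbf{M}_\alpha(\mathscr{D})$ and that $k(\cdot,w)$ belongs to $\mathbf{M}_\alpha(\mathscr{D})$ uniformly with respect to $w\in\mathscr{D}$. For each positive integer $N$ let $h=\dfrac{\log(2dN/\alpha)}{N}$ and $n=2N+1$. Let $u$ be the solution of $$u(t)-\int_a^t k(t,s)u(s)\,ds=g(t),\qquad a\le t\le b.$$ Then there exists a positive integer $N_0$ such that for all $N\ge N_0$ the matrix $I_n-V_n^{DE}$ is invertible. Furthermore, there exists a constant $C$ independent of $N$ such that for all $N\ge N_0$, $$\|u-v_N^{DE}\|_{C([a,b])}\le C\,e^{-\pi dN/\log(2dN/\alpha)},$$ where $v_N^{DE}$ is the approximate solution of the DE-Sinc-collocation method (defined in the context).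
   Context: $a<b$ are real; $\|\cdot\|_{C([a,b])}$ is the uniform norm. Transformation: $\psi(x)=\frac{b-a}{2}\tanh\left(\frac{\pi}{2}\sinh x\right)+\frac{b+a}{2}$ maps $\mathbb{R}$ onto $(a,b)$; $\phi=\psi^{-1}:(a,b)\to\mathbb{R}$; $t_j=\psi(jh)$. Strip: $\mathscr{D}_d=\{\zeta\in\mathbb{C}:|\mathrm{Im}\,\zeta|<d\}$. $\psi(\mathscr{D}_d)=\{\psi(\zeta):\zeta\in\mathscr{D}_d\}$ is regarded as a Riemann surface (spread over $\mathbb{C}$, parametrized by $\zeta\in\mathscr{D}_d$); thus a function $f$ on it is identified with $\zeta\mapsto f(\psi(\zeta))$ on $\mathscr{D}_d$, it is analytic iff the latter is analytic on $\mathscr{D}_d$, and in expressions such as $|z-a|$ the point $z$ stands for the complex value $\psi(\zeta)$. The interval $(a,b)$ corresponds to $\zeta\in\mathbb{R}$. Function spaces: $\mathbf{H}^\infty(\mathscr{D})$ is the family of analytic functions $f$ on $\mathscr{D}$ with $\sup_{z\in\mathscr{D}}|f(z)|<\infty$. $\mathbf{M}_\alpha(\mathscr{D})$ is the family of $f\in\mathbf{H}^\infty(\mathscr{D})$ for which there is a constant $L$ with $|f(z)-f(a)|\le L|z-a|^\alpha$ and $|f(b)-f(z)|\le L|b-z|^\alpha$ for all $z\in\mathscr{D}$ ($f(a),f(b)$ being the values of $f$ at the endpoints). For a two-variable function $k$, "$k(\cdot,w)$ belongs to $\mathbf{M}_\alpha(\mathscr{D})$ uniformly with respect to $w\in\mathscr{D}$"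 means there is a constant $L_k$ independent of $w$ with $|k(z,w)-k(a,w)|\le L_k|z-a|^\alpha$ and $|k(b,w)-k(z,w)|\le L_k|b-z|^\alpha$ for all $z,w\in\mathscr{D}$. Method: $S(j,h)(x)=\frac{\sin(\pi(x-jh)/h)}{\pi(x-jh)/h}$ for $x\neq jh$, $S(j,h)(jh)=1$ (with $S(j,h)(\phi(t))$ extended to $t=a,b$ by limits); $\omega_a(t)=\frac{b-t}{b-a}$, $\omega_b(t)=\frac{t-a}{b-a}$; $\mathrm{Si}(x)=\int_0^x\frac{\sin t}{t}dt$; $\delta_m^{(-1)}=\frac12+\frac1\pi\mathrm{Si}(\pi m)$. $I_n$ is the identity matrix and $V_n^{DE}$ is the $n\times n$ matrix with entries $(V_n^{DE})_{ij}=k(t_i,t_j)\psi'(jh)\,h\,\delta^{(-1)}_{i-j}$, $i,j=-N,\dots,N$. Let $(u_{-N},\dots,u_N)^{\mathrm T}$ be the solution of $(I_n-V_n^{DE})\mathbf{u}_n=(g(t_{-N}),\dots,g(t_N))^{\mathrm T}$. Then $$v_N^{DE}(t)=u_{-N}\omega_a(t)+u_N\omega_b(t)+\sum_{j=-N}^N\{u_j-u_{-N}\omega_a(t_j)-u_N\omega_b(t_j)\}S(j,h)(\phi(t)).$$ *)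

theory Defs
  imports
    "HOL-Complex_Analysis.Complex_Analysis"
    "HOL-Probability.Sinc_Integral"
    "Jordan_Normal_Form.Matrix"
begin

definition de_psi :: "real \<Rightarrow> real \<Rightarrow> 'a \<Rightarrow> 'a :: {banach, real_normed_field}" where
  "de_psi a b x = of_real ((b - a) / 2) * tanh (of_real (pi / 2) * sinh x) + of_real ((b + a) / 2)"

definition de_phi :: "real \<Rightarrow> real \<Rightarrow> real \<Rightarrow> real" where
  "de_phi a b = inv_into UNIV (de_psi a b)"

definition strip :: "real \<Rightarrow> complex set" where
  "strip d = {\<zeta>. \<bar>Im \<zeta>\<bar> < d}"

(* The map de_psi a b is in general not injective on strip d, so its image is a Riemann surface
   spread over the complex plane. Its points are represented by the parameter in strip d
   (constructor Inner); the two endpoints a and b of the interval are adjoined, because functions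
   on the surface are also evaluated there. A function on the interval [a,b] and its extension to
   the surface are thus a single function on this type. *)
datatype surface_point = Inner complex | Left_End | Right_End

definition de_surface :: "real \<Rightarrow> surface_point set" where
  "de_surface d = Inner ` strip d"

(* The complex value denoted by z in expressions such as |z - a|. *)
fun surface_value :: "real \<Rightarrow> real \<Rightarrow> surface_point \<Rightarrow> complex" where
  "surface_value a b (Inner \<zeta>) = de_psi a b \<zeta>"
| "surface_value a b Left_End = of_real a"
| "surface_value a b Right_End = of_real b"

(* Embedding of [a,b]: the open interval corresponds to the real parameters. *)
definition interval_point :: "real \<Rightarrow> real \<Rightarrow> real \<Rightarrow> surface_point" where
  "interval_point a b t =
     (if t = a then Left_End else if t = b then Right_End else Inner (of_real (de_phi a b t)))"

definition cont_interval :: "real \<Rightarrow> real \<Rightarrow> (surface_point \<Rightarrow> complex) \<Rightarrow> bool" where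
  "cont_interval a b f \<longleftrightarrow> continuous_on {a..b} (\<lambda>t. f (interval_point a b t))"

definition H_infty :: "real \<Rightarrow> (surface_point \<Rightarrow> complex) \<Rightarrow> bool" where
  "H_infty d f \<longleftrightarrow> (\<lambda>\<zeta>. f (Inner \<zeta>)) analytic_on strip d \<and> bounded (f ` de_surface d)"

definition M_space :: "real \<Rightarrow> real \<Rightarrow> real \<Rightarrow> real \<Rightarrow> (surface_point \<Rightarrow> complex) \<Rightarrow> bool" where
  "M_space a b \<alpha> d f \<longleftrightarrow> H_infty d f \<and>
     (\<exists>L. \<forall>z\<in>de_surface d.
        norm (f z - f Left_End) \<le> L * norm (surface_value a b z - of_real a) powr \<alpha> \<and>
        norm (f Right_End - f z) \<le> L * norm (of_real b - surface_value a b z) powr \<alpha>)"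

definition M_space_uniform ::
  "real \<Rightarrow> real \<Rightarrow> real \<Rightarrow> real \<Rightarrow> (surface_point \<Rightarrow> surface_point \<Rightarrow> complex) \<Rightarrow> bool" where
  "M_space_uniform a b \<alpha> d k \<longleftrightarrow>
     (\<exists>L. \<forall>z\<in>de_surface d. \<forall>w\<in>de_surface d.
        norm (k z w - k Left_End w) \<le> L * norm (surface_value a b z - of_real a) powr \<alpha> \<and>
        norm (k Right_End w - k z w) \<le> L * norm (of_real b - surface_value a b z) powr \<alpha>)"

definition uniform_norm :: "real \<Rightarrow> real \<Rightarrow> (real \<Rightarrow> complex) \<Rightarrow> real" where
  "uniform_norm a b f = (SUP t\<in>{a..b}. norm (f t))"

(* The library function sinc is the unnormalised sin x / x, with value 1 at 0. *)
definition sinc_basis :: "int \<Rightarrow> real \<Rightarrow> real \<Rightarrow> real" where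
  "sinc_basis j h x = sinc (pi * (x - of_int j * h) / h)"

definition sinc_basis_phi :: "real \<Rightarrow> real \<Rightarrow> int \<Rightarrow> real \<Rightarrow> real \<Rightarrow> real" where
  "sinc_basis_phi a b j h t =
     (if t \<in> {a<..<b} then sinc_basis j h (de_phi a b t)
      else Lim (at t within {a<..<b}) (\<lambda>s. sinc_basis j h (de_phi a b s)))"

definition omega_a :: "real \<Rightarrow> real \<Rightarrow> real \<Rightarrow> real" where
  "omega_a a b t = (b - t) / (b - a)"

definition omega_b :: "real \<Rightarrow> real \<Rightarrow> real \<Rightarrow> real" where
  "omega_b a b t = (t - a) / (b - a)"

definition delta_minus1 :: "int \<Rightarrow> real" where
  "delta_minus1 m = 1 / 2 + Si (pi * of_int m) / pi"

definition mesh :: "real \<Rightarrow> real \<Rightarrow> nat \<Rightarrow> real" where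
  "mesh \<alpha> d N = ln (2 * d * real N / \<alpha>) / real N"

definition node :: "real \<Rightarrow> real \<Rightarrow> real \<Rightarrow> int \<Rightarrow> real" where
  "node a b h j = de_psi a b (of_int j * h)"

(* Matrices and vectors are indexed from 0, so the mathematical index j in {-N..N} is stored at
   position j + N. *)
definition V_DE ::
  "real \<Rightarrow> real \<Rightarrow> (surface_point \<Rightarrow> surface_point \<Rightarrow> complex) \<Rightarrow> real \<Rightarrow> nat \<Rightarrow> complex mat" where
  "V_DE a b k h N = Matrix.mat (2 * N + 1) (2 * N + 1) (\<lambda>(p, q).
     let i = int p - int N; j = int q - int N in
       k (interval_point a b (node a b h i)) (interval_point a b (node a b h j))
         * of_real (deriv (de_psi a b) (of_int j * h) * h * delta_minus1 (i - j)))"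

definition collocation_rhs ::
  "real \<Rightarrow> real \<Rightarrow> (surface_point \<Rightarrow> complex) \<Rightarrow> real \<Rightarrow> nat \<Rightarrow> complex Matrix.vec" where
  "collocation_rhs a b g h N = Matrix.vec (2 * N + 1) (\<lambda>p.
     g (interval_point a b (node a b h (int p - int N))))"

definition collocation_solution ::
  "real \<Rightarrow> real \<Rightarrow> (surface_point \<Rightarrow> complex) \<Rightarrow> (surface_point \<Rightarrow> surface_point \<Rightarrow> complex)
     \<Rightarrow> real \<Rightarrow> nat \<Rightarrow> complex Matrix.vec" where
  "collocation_solution a b g k h N = (THE c. c \<in> carrier_vec (2 * N + 1) \<and>
     (1\<^sub>m (2 * N + 1) - V_DE a b k h N) *\<^sub>v c = collocation_rhs a b g h N)"

definition v_DE ::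
  "real \<Rightarrow> real \<Rightarrow> (surface_point \<Rightarrow> complex) \<Rightarrow> (surface_point \<Rightarrow> surface_point \<Rightarrow> complex)
     \<Rightarrow> real \<Rightarrow> nat \<Rightarrow> real \<Rightarrow> complex" where
  "v_DE a b g k h N t =
     (let c = (\<lambda>j::int. vec_index (collocation_solution a b g k h N) (nat (j + int N)));
          p = c (- int N); q = c (int N)
      in p * of_real (omega_a a b t) + q * of_real (omega_b a b t)
         + (\<Sum>j = - int N..int N.
              (c j - p * of_real (omega_a a b (node a b h j)) - q * of_real (omega_b a b (node a b h j)))
                * of_real (sinc_basis_phi a b j h t)))"

end

(* In the variable zeta = phi(t) all functions live on the strip |Im zeta| < d, on which psi'(zeta) and the
   deviation of u from its end values decay like exp(-mu cosh(Re zeta)). The solution u extends holomorphically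
   to the strip: Picard iteration for the complex Volterra equation is a contraction in a norm weighted by
   exp(2 c arctan(Re zeta)).

   The errors of Sinc interpolation and of Sinc indefinite integration are computed by residues on the rectangle
   with corners +-(M+1/2)h +- ic, where M tends to infinity and c to d. Both carry the factor 1/sinh(pi d/h);
   the oscillation of sin(pi y/h) yields an additional factor h for the integral.

   The matrix V is strictly lower triangular up to a perturbation of norm O(sqrt h), so that a discrete Gronwall
   argument bounds the inverse of I - V uniformly. Hence the error at the nodes is O(h exp(-pi d/h)), and the
   factor h absorbs the O(sqrt N) bound for the norm of Sinc interpolation. Truncation errors are of size
   exp(-const N) up to powers of N, because exp(N h) = 2 d N/alpha. *)

theory Submission
  imports Defs "HOL-Real_Asymp.Real_Asymp" "Jordan_Normal_Form.Determinant"
begin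

section \<open>Elementary estimates\<close>

text \<open>The exponent in the claim is exactly -pi d / h, so none of the width of the strip may be
  lost. Bounds on the transformation have to hold uniformly up to |Im zeta| = d; this rests on the
  strict inequality d < pi / 2, since cosh(pi/2 sinh zeta), the denominator of psi, has a zero at i
  pi / 2. By contrast any positive decay rate \<mu> suffices: truncation is exponentially small in
  N, whereas the target is only exp(-const N / log N). So no sharp constant is sought in the decay
  of u towards its end values, which comes from the Hoelder conditions on g and k.

  In the extended equation z enters both the kernel K(z, w) and the end point of the integral, while
  k is holomorphic in each variable separately. Holomorphy of the iterates is thus a statement about
  a diagonal, and a bound for k in both variables at once has to be extracted from the uniform
  Hoelder condition. That the solution on the strip continues u follows from the same contraction,
  applied to the difference on the real line.\<close>

lemma sum_arctan_nat:
  fixes h :: real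
  assumes "0 < h"
  shows "(\<Sum>j = 1..n. h / (1 + (real j * h)\<^sup>2)) \<le> arctan (real n * h)"
proof (induction n)
  case (Suc n)
  \<comment> \<open>The new term is h times the value of the derivative of arctan at the right end
    of the cell, its smallest value there.\<close>
  have "\<exists>z. real n * h < z \<and> z < real (Suc n) * h \<and>
      arctan (real (Suc n) * h) - arctan (real n * h) = (real (Suc n) * h - real n * h) * inverse (1 + z\<^sup>2)"
    by (rule MVT2) (use assms in \<open>auto intro!: derivative_eq_intros simp: inverse_eq_divide\<close>)
  then obtain z where z: "real n * h < z" "z < real (Suc n) * h"
    "arctan (real (Suc n) * h) - arctan (real n * h) = h * inverse (1 + z\<^sup>2)"
    by (auto simp: algebra_simps)
  have "0 \<le> z" using z(1) assms by (smt (verit) mult_nonneg_nonneg of_nat_0_le_iff)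
  then have "z\<^sup>2 \<le> (real (Suc n) * h)\<^sup>2" using z(2) by (intro power_mono) auto
  then have "h / (1 + (real (Suc n) * h)\<^sup>2) \<le> h * inverse (1 + z\<^sup>2)"
    using assms by (auto simp: divide_inverse intro!: mult_left_mono le_imp_inverse_le add_pos_nonneg)
  then show ?case using Suc z(3) by simp
qed simp

text \<open>A Riemann sum for the integral of 1 / (1 + t^2) over the line: the node 0 contributes h,
  each half-line at most pi / 2. Admitting any finite index set covers truncation tails and, with h
  = 1, sums over shifted integers.\<close>

lemma sum_inverse_square_le:
  fixes h :: real and F :: "int set"
  assumes "0 < h" "finite F"
  shows "(\<Sum>j\<in>F. h / (1 + (of_int j * h)\<^sup>2)) \<le> h + pi"
proof -
  let ?f = "\<lambda>j::int. h / (1 + (of_int j * h)\<^sup>2)"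
  have nn: "0 \<le> ?f j" for j using assms by (simp add: add_nonneg_nonneg)
  define n where "n = Max ((nat \<circ> abs) ` F \<union> {0})"
  have "F \<subseteq> {- int n..int n}"
  proof
    fix j assume "j \<in> F"
    then have "nat \<bar>j\<bar> \<le> n" unfolding n_def using assms by (intro Max_ge) auto
    then show "j \<in> {- int n..int n}" by auto
  qed
  then have "sum ?f F \<le> sum ?f {- int n..int n}" by (intro sum_mono2) (auto simp: nn)
  also have "{- int n..int n} = {0} \<union> (int ` {1..n} \<union> (\<lambda>j. - int j) ` {1..n})"
  proof -
    have "j \<in> {0} \<union> (int ` {1..n} \<union> (\<lambda>j. - int j) ` {1..n})" if "j \<in> {- int n..int n}" for j
    proof (cases "j = 0 \<or> j > 0")
      case True
      then show ?thesis using that by (auto intro!: image_eqI[of _ _ "nat j"])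
    next
      case False
      then have "j \<in> (\<lambda>j. - int j) ` {1..n}" using that by (auto intro!: image_eqI[of _ _ "nat (- j)"])
      then show ?thesis by auto
    qed
    then have "{- int n..int n} \<subseteq> {0} \<union> (int ` {1..n} \<union> (\<lambda>j. - int j) ` {1..n})" by (rule subsetI)
    moreover have "{0} \<union> (int ` {1..n} \<union> (\<lambda>j. - int j) ` {1..n}) \<subseteq> {- int n..int n}" by auto
    ultimately show ?thesis by (rule equalityI)
  qed
  also have "sum ?f \<dots> = ?f 0 + (sum ?f (int ` {1..n}) + sum ?f ((\<lambda>j. - int j) ` {1..n}))"
    by (subst sum.union_disjoint, auto, subst sum.union_disjoint, auto)
  also have "sum ?f (int ` {1..n}) = (\<Sum>j = 1..n. h / (1 + (real j * h)\<^sup>2))"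
    by (subst sum.reindex) (auto simp: inj_on_def)
  also have "sum ?f ((\<lambda>j. - int j) ` {1..n}) = (\<Sum>j = 1..n. h / (1 + (real j * h)\<^sup>2))"
    by (subst sum.reindex) (auto simp: inj_on_def)
  also have "?f 0 + ((\<Sum>j = 1..n. h / (1 + (real j * h)\<^sup>2)) + (\<Sum>j = 1..n. h / (1 + (real j * h)\<^sup>2)))
     \<le> h + (pi / 2 + pi / 2)"
    using sum_arctan_nat[OF assms(1), of n] arctan_ubound[of "real n * h"] by simp
  finally show ?thesis by simp
qed

text \<open>The majorant r times the product of the factors 1 + \<open>p l\<close> satisfies the
  recursion with equality, so strong induction compares \<open>x\<close> with it; the product is
  then bounded through 1 + p \<le> exp p.\<close>

lemma discrete_gronwall:
  fixes x p :: "nat \<Rightarrow> real"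
  assumes "\<And>j. 0 \<le> p j" "0 \<le> r" "\<And>i. i \<le> n \<Longrightarrow> x i \<le> r + (\<Sum>j<i. p j * x j)" "i \<le> n"
  shows "x i \<le> r * exp (\<Sum>j<i. p j)"
proof -
  have *: "r + (\<Sum>j<i. p j * (r * (\<Prod>l<j. 1 + p l))) = r * (\<Prod>l<i. 1 + p l)" for i
    by (induction i) (auto simp: algebra_simps)
  have "x i \<le> r * (\<Prod>l<i. 1 + p l)" using assms(4)
  proof (induction i rule: less_induct)
    case (less i)
    have "x i \<le> r + (\<Sum>j<i. p j * x j)" using assms(3) less by auto
    also have "\<dots> \<le> r + (\<Sum>j<i. p j * (r * (\<Prod>l<j. 1 + p l)))"
      by (intro add_left_mono sum_mono mult_left_mono less) (use assms less in auto)
    finally show ?case using * by simp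
  qed
  also have "\<dots> \<le> r * (\<Prod>l<i. exp (p l))"
    by (intro mult_left_mono prod_mono conjI) (use assms in \<open>auto simp: add_nonneg_nonneg\<close>)
  finally show ?thesis by (simp add: exp_sum)
qed

section \<open>The sinc function and the sine integral\<close>

lemma sinc_le_1: "\<bar>sinc x\<bar> \<le> (1::real)"
  by (cases "x = 0") (auto simp: field_simps abs_mult abs_sin_x_le_abs_x)

text \<open>One integration by parts: \<open>Si t + cos t / t\<close> has derivative -cos t / t^2,
  whose integral over [x, infinity) is at most 1 / x; removing the added term cos x / x costs
  another 1 / x.\<close>

lemma Si_minus_half_pi_bound:
  assumes "0 < x"
  shows "\<bar>Si x - pi / 2\<bar> \<le> 2 / x"
proof -
  let ?f = "\<lambda>t. Si t + cos t / t"
  have der: "(?f has_real_derivative - cos t / t\<^sup>2) (at t)" if "0 < t" for t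
    using that by (auto intro!: derivative_eq_intros DERIV_Si simp: field_simps power2_eq_square)
  have *: "\<bar>?f y - ?f x\<bar> \<le> 1 / x - 1 / y" if "x < y" for y
  proof -
    have "norm (?f y - ?f x) \<le> (- 1 / y) - (- 1 / x)"
    proof (rule differentiable_bound_general[where f' = "\<lambda>t. - cos t / t\<^sup>2" and \<phi>' = "\<lambda>t. 1 / t\<^sup>2"])
      show "continuous_on {x..y} ?f" 
      proof (rule DERIV_continuous_on)
        fix t assume "t \<in> {x..y}"
        then show "(?f has_real_derivative - cos t / t\<^sup>2) (at t within {x..y})"
          using has_field_derivative_at_within[OF der[of t]] assms by simp
      qed
      show "continuous_on {x..y} (\<lambda>x. - 1 / x)" using assms by (auto intro!: continuous_intros)
      fix t assume t: "x < t" "t < y"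
      then show "(?f has_vector_derivative - cos t / t\<^sup>2) (at t)"
        using der[of t] assms by (simp add: has_real_derivative_iff_has_vector_derivative)
      show "((\<lambda>x. - 1 / x) has_vector_derivative 1 / t\<^sup>2) (at t)"
        unfolding has_real_derivative_iff_has_vector_derivative[symmetric]
        using t assms by (auto intro!: derivative_eq_intros simp: field_simps power2_eq_square)
      show "norm (- cos t / t\<^sup>2) \<le> 1 / t\<^sup>2" by (auto simp: abs_divide intro!: divide_right_mono)
    qed (use that in auto)
    then show ?thesis by simp
  qed
  have "((\<lambda>t::real. cos t / t) \<longlongrightarrow> 0) at_top"
  proof (rule Lim_null_comparison)
    show "\<forall>\<^sub>F t in at_top. norm (cos t / t) \<le> 1 / t"
      using eventually_gt_at_top[of "0::real"] by eventually_elim (auto simp: divide_right_mono)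
    show "((\<lambda>t::real. 1 / t) \<longlongrightarrow> 0) at_top" by real_asymp
  qed
  then have lim: "((\<lambda>y. \<bar>?f y - ?f x\<bar>) \<longlongrightarrow> \<bar>(pi / 2 + 0) - ?f x\<bar>) at_top"
    by (intro tendsto_intros Si_at_top)
  have lim2: "((\<lambda>y. 1 / x - 1 / y) \<longlongrightarrow> 1 / x) at_top" by real_asymp
  have "\<bar>(pi / 2 + 0) - ?f x\<bar> \<le> 1 / x"
    by (rule tendsto_le[OF _ lim2 lim]) (auto intro!: eventually_mono[OF eventually_gt_at_top[of x]] *)
  moreover have "\<bar>cos x / x\<bar> \<le> 1 / x" using assms by (auto simp: field_simps)
  ultimately have "\<bar>pi / 2 - Si x\<bar> \<le> 1 / x + 1 / x" by linarith
  then show ?thesis by (simp add: abs_minus_commute)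
qed

text \<open>The weights approach the Heaviside function at rate 1 / |m|. At m = 0, where the weight
  is 1/2, the comparison value is chosen to be 0, which makes the comparison matrix strictly lower
  triangular.\<close>

lemma delta_minus1_bound:
  "\<bar>delta_minus1 m - (if 0 < m then 1 else 0)\<bar> \<le> 2 / (1 + \<bar>of_int m\<bar>)"
proof (cases "m = 0")
  case True
  then show ?thesis by (simp add: delta_minus1_def Si_neg[of 0, simplified])
next
  case False
  define x where "x = pi * \<bar>of_int m\<bar>"
  have x: "0 < x" using False by (simp add: x_def)
  have eq: "\<bar>delta_minus1 m - (if 0 < m then 1 else 0)\<bar> = \<bar>Si x - pi / 2\<bar> / pi"
  proof (cases "0 < m")
    case True
    then show ?thesis by (simp add: delta_minus1_def x_def field_simps abs_if)
  next
    case F: False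
    then have "Si (pi * of_int m) = - Si x" using False x Si_neg[of x]
      by (simp add: x_def)
    then show ?thesis using F by (simp add: delta_minus1_def field_simps abs_if)
  qed
  have "\<bar>Si x - pi / 2\<bar> / pi \<le> 2 / x / pi"
    using Si_minus_half_pi_bound[OF x] by (intro divide_right_mono) auto
  also have "\<dots> \<le> 2 / (1 + \<bar>of_int m\<bar>)"
  proof -
    have "1 \<le> \<bar>real_of_int m\<bar>" using False by linarith
    moreover have "3 < pi" by (rule pi_gt3)
    then have "2 \<le> pi * pi" by (smt (verit) mult_le_cancel_left1 mult_less_cancel_left1)
    then have "2 * \<bar>real_of_int m\<bar> \<le> pi * pi * \<bar>real_of_int m\<bar>" by (intro mult_right_mono) auto
    ultimately have "1 + \<bar>real_of_int m\<bar> \<le> x * pi" unfolding x_def by (simp add: algebra_simps)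
    then show ?thesis using x by (auto simp: field_simps)
  qed
  finally show ?thesis using eq by simp
qed

text \<open>With m the integer nearest to x / h, node j is at least |j - m| / 2 mesh widths away
  from x, so the decay of sinc becomes a weight in the integer j - m whose sum over j is bounded
  independently of x.\<close>

lemma sinc_basis_square_le:
  assumes "0 < h"
  shows "(sinc_basis j h x)\<^sup>2 \<le> 1 / (1 + (of_int (j - round (x / h)))\<^sup>2)"
proof -
  define m where "m = round (x / h)"
  define y where "y = x / h"
  have y: "\<bar>y - of_int m\<bar> \<le> 1 / 2" unfolding m_def y_def using of_int_round_abs_le[of "x / h"] by linarith
  have s: "sinc_basis j h x = sinc (pi * (y - of_int j))"
    unfolding sinc_basis_def y_def using assms by (simp add: field_simps)
  show ?thesis
  proof (cases "j = m")
    case True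
    then show ?thesis using sinc_le_1[of "pi * (y - of_int j)"] s 
      by (simp add: m_def power_le_one_iff abs_square_le_1)
  next
    case False
    define r where "r = \<bar>real_of_int (j - m)\<bar>"
    let ?r = r
    have r: "1 \<le> ?r" using False unfolding r_def by linarith
    have d: "?r / 2 \<le> \<bar>y - of_int j\<bar>" proof -
      have "r = \<bar>(y - of_int m) - (y - of_int j)\<bar>" by (simp add: r_def)
      also have "\<dots> \<le> \<bar>y - of_int m\<bar> + \<bar>y - of_int j\<bar>" by (rule abs_triangle_ineq4)
      finally show ?thesis using y r by argo
    qed
    then have ne: "y - of_int j \<noteq> 0" using r by auto
    have "\<bar>sinc (pi * (y - of_int j))\<bar> \<le> 1 / (pi * \<bar>y - of_int j\<bar>)"
      using ne by (auto simp: abs_mult divide_right_mono)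
    also have "\<dots> \<le> 1 / (pi * (?r / 2))" using d r by (intro divide_left_mono mult_left_mono mult_pos_pos) auto
    finally have "\<bar>sinc_basis j h x\<bar>\<^sup>2 \<le> (1 / (pi * (?r / 2)))\<^sup>2" unfolding s by (rule power_mono) simp
    also have "\<dots> = 4 / (pi\<^sup>2 * ?r\<^sup>2)" by (simp add: power_divide power_mult_distrib)
    also have "\<dots> \<le> 1 / (1 + ?r\<^sup>2)"
    proof -
      have "9 \<le> pi\<^sup>2" using power_mono[of 3 pi 2] pi_gt3 by simp
      then have "9 * ?r\<^sup>2 \<le> pi\<^sup>2 * ?r\<^sup>2" by (intro mult_right_mono) auto
      moreover have "1 \<le> ?r\<^sup>2" using power_mono[OF r, of 2] by simp
      ultimately have "4 * (1 + ?r\<^sup>2) \<le> pi\<^sup>2 * ?r\<^sup>2" by argo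
      moreover have "0 < pi\<^sup>2 * ?r\<^sup>2" using r by auto
      moreover have "0 < 1 + ?r\<^sup>2" by (simp add: add_pos_nonneg)
      ultimately have "4 / (pi\<^sup>2 * ?r\<^sup>2) \<le> 4 / (4 * (1 + ?r\<^sup>2))" by (intro divide_left_mono) auto
      also have "\<dots> = 1 / (1 + ?r\<^sup>2)" using nonzero_mult_divide_mult_cancel_left[of 4 1 "1 + r\<^sup>2"] by (simp only: mult_1_right)
      finally show ?thesis .
    qed
    finally show ?thesis by (simp add: m_def r_def)
  qed
qed

text \<open>The sum grows only logarithmically in \<open>N\<close>; the square root suffices because the nodal error carries an
  additional factor \<open>h\<close>, and \<open>h * sqrt N\<close> tends to zero.\<close>

lemma sum_abs_sinc_basis_le:
  assumes "0 < h"
  shows "(\<Sum>j = - int N..int N. \<bar>sinc_basis j h x\<bar>) \<le> sqrt ((2 * real N + 1) * (1 + pi))"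
proof -
  let ?J = "{- int N..int N}"
  \<comment> \<open>Cauchy-Schwarz against the constant 1: the number of nodes times the sum of
    squares, the latter bounded uniformly in x and h.\<close>
  have "(\<Sum>j\<in>?J. 1 * \<bar>sinc_basis j h x\<bar>)\<^sup>2 \<le> (\<Sum>j\<in>?J. 1\<^sup>2) * (\<Sum>j\<in>?J. \<bar>sinc_basis j h x\<bar>\<^sup>2)"
    by (rule Cauchy_Schwarz_ineq_sum)
  also have "(\<Sum>j\<in>?J. \<bar>sinc_basis j h x\<bar>\<^sup>2) \<le> (\<Sum>j\<in>?J. 1 / (1 + (of_int (j - round (x / h)))\<^sup>2))"
    by (intro sum_mono) (simp add: sinc_basis_square_le[OF assms] del: of_int_diff)
  also have "\<dots> = (\<Sum>j\<in>(\<lambda>j. j - round (x / h)) ` ?J. 1 / (1 + (of_int j * 1)\<^sup>2))"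
    by (subst sum.reindex) (auto simp: inj_on_def)
  also have "\<dots> \<le> 1 + pi" by (rule sum_inverse_square_le) auto
  finally have "(\<Sum>j\<in>?J. \<bar>sinc_basis j h x\<bar>)\<^sup>2 \<le> (2 * real N + 1) * (1 + pi)"
    by (auto simp: mult_left_mono add.commute)
  then show ?thesis by (rule real_le_rsqrt)
qed

section \<open>Decay of exp(-\<mu> cosh x)\<close>

lemma abs_le_abs_sinh:
  fixes x :: real
  shows "\<bar>x\<bar> \<le> \<bar>sinh x\<bar>"
proof -
  have ge: "y \<le> sinh y" if "0 \<le> y" for y :: real
  proof -
    have "sinh 0 - 0 \<le> sinh y - y"
    proof (rule DERIV_nonneg_imp_nondecreasing[OF that])
      fix t :: real
      have "((\<lambda>y. sinh y - y) has_real_derivative cosh t - 1) (at t)" by (auto intro!: derivative_eq_intros)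
      then show "\<exists>D. ((\<lambda>y. sinh y - y) has_real_derivative D) (at t) \<and> 0 \<le> D" using cosh_real_ge_1[of t] by auto
    qed
    then show ?thesis by simp
  qed
  show ?thesis using ge[of "\<bar>x\<bar>"] by (cases "0 \<le> x") auto
qed

lemma two_plus_square_le_cosh:
  fixes x :: real
  shows "2 + x\<^sup>2 \<le> 2 * cosh x"
proof -
  have "cosh x = (cosh (x / 2))\<^sup>2 + (sinh (x / 2))\<^sup>2" using cosh_double[of "x / 2"] by simp
  then have "2 * cosh x = 2 + 4 * (sinh (x / 2))\<^sup>2" by (simp add: cosh_square_eq)
  moreover have "\<bar>x / 2\<bar>\<^sup>2 \<le> \<bar>sinh (x / 2)\<bar>\<^sup>2" by (intro power_mono abs_le_abs_sinh) simp
  then have "(x / 2)\<^sup>2 \<le> (sinh (x / 2))\<^sup>2" by (simp only: power2_abs)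
  then have "x\<^sup>2 \<le> 4 * (sinh (x / 2))\<^sup>2" by (simp add: power_divide)
  ultimately show ?thesis by linarith
qed

text \<open>Trades double exponential decay for the weight 1 / (1 + x^2), whose integrals and
  Riemann sums are controlled by arctan.\<close>

lemma exp_cosh_le:
  fixes \<mu> x :: real
  assumes "0 < \<mu>"
  shows "exp (- \<mu> * cosh x) \<le> (2 / \<mu>) / (1 + x\<^sup>2)"
proof -
  have c: "1 + x\<^sup>2 \<le> 2 * cosh x" using two_plus_square_le_cosh[of x] by simp
  have "1 + \<mu> * cosh x \<le> exp (\<mu> * cosh x)" by (rule exp_ge_add_one_self)
  then have "\<mu> * ((1 + x\<^sup>2) / 2) \<le> exp (\<mu> * cosh x)"
  proof -
    have "\<mu> * ((1 + x\<^sup>2) / 2) \<le> \<mu> * cosh x" using assms c by (intro mult_left_mono) simp_all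
    also have "\<dots> \<le> exp (\<mu> * cosh x)" using exp_ge_add_one_self[of "\<mu> * cosh x"] by linarith
    finally show ?thesis .
  qed
  moreover have "0 < \<mu> * ((1 + x\<^sup>2) / 2)" using assms by (simp add: add_pos_nonneg)
  ultimately have "inverse (exp (\<mu> * cosh x)) \<le> inverse (\<mu> * ((1 + x\<^sup>2) / 2))"
    by (intro le_imp_inverse_le) auto
  moreover have "exp (- \<mu> * cosh x) = inverse (exp (\<mu> * cosh x))" by (simp add: exp_minus)
  moreover have "inverse (\<mu> * ((1 + x\<^sup>2) / 2)) = (2 / \<mu>) / (1 + x\<^sup>2)" by simp
  ultimately show ?thesis by (simp only:)
qed

lemma exp_cosh_mono:
  fixes \<mu> x y :: real
  assumes "0 \<le> \<mu>" "\<bar>x\<bar> \<le> \<bar>y\<bar>"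
  shows "exp (- \<mu> * cosh y) \<le> exp (- \<mu> * cosh x)"
proof -
  have "cosh \<bar>x\<bar> \<le> cosh \<bar>y\<bar>" using assms(2) cosh_real_nonneg_le_iff[of "\<bar>x\<bar>" "\<bar>y\<bar>"] by simp
  then have "cosh x \<le> cosh y" by (cases "0 \<le> x"; cases "0 \<le> y") simp_all
  then show ?thesis using assms(1) by (simp add: mult_left_mono)
qed

text \<open>Half of the exponent is spent on smallness beyond the index N, the other half on
  summability through the weight 1 / (1 + t^2).\<close>

lemma sum_exp_cosh_tail_le:
  fixes \<mu> h :: real
  assumes "0 < \<mu>" "0 < h" "finite F" "\<And>j. j \<in> F \<Longrightarrow> int N \<le> \<bar>j\<bar>"
  shows "h * (\<Sum>j\<in>F. exp (- \<mu> * cosh (of_int j * h))) \<le> (4 / \<mu>) * exp (- (\<mu> / 2) * cosh (real N * h)) * (h + pi)"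
proof -
  have "h * exp (- \<mu> * cosh (of_int j * h)) 
      \<le> (4 / \<mu>) * exp (- (\<mu> / 2) * cosh (real N * h)) * (h / (1 + (of_int j * h)\<^sup>2))" if "j \<in> F" for j
  proof -
    have "exp (- \<mu> * cosh (of_int j * h)) = exp (- (\<mu> / 2) * cosh (of_int j * h)) * exp (- (\<mu> / 2) * cosh (of_int j * h))"
      by (simp flip: exp_add)
    also have "\<dots> \<le> exp (- (\<mu> / 2) * cosh (real N * h)) * ((2 / (\<mu> / 2)) / (1 + (of_int j * h)\<^sup>2))"
    proof (intro mult_mono exp_cosh_mono exp_cosh_le)
      have "real N \<le> \<bar>of_int j\<bar>" using assms(4)[OF that] by linarith
      then show "\<bar>real N * h\<bar> \<le> \<bar>of_int j * h\<bar>" using assms(2) by (auto simp: abs_mult intro!: mult_right_mono)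
    qed (use assms in auto)
    finally have "h * exp (- \<mu> * cosh (of_int j * h)) \<le> h *
        (exp (- (\<mu> / 2) * cosh (real N * h)) * ((2 / (\<mu> / 2)) / (1 + (of_int j * h)\<^sup>2)))"
      using assms(2) by (intro mult_left_mono) auto
    then show ?thesis by (simp add: mult_ac)
  qed
  then have "h * (\<Sum>j\<in>F. exp (- \<mu> * cosh (of_int j * h))) 
     \<le> (\<Sum>j\<in>F. (4 / \<mu>) * exp (- (\<mu> / 2) * cosh (real N * h)) * (h / (1 + (of_int j * h)\<^sup>2)))"
    unfolding sum_distrib_left by (rule sum_mono)
  also have "\<dots> = (4 / \<mu>) * exp (- (\<mu> / 2) * cosh (real N * h)) * (\<Sum>j\<in>F. h / (1 + (of_int j * h)\<^sup>2))"
    by (simp add: sum_distrib_left)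
  also have "\<dots> \<le> (4 / \<mu>) * exp (- (\<mu> / 2) * cosh (real N * h)) * (h + pi)"
    by (intro mult_left_mono sum_inverse_square_le) (use assms in auto)
  finally show ?thesis .
qed

section \<open>Sinc interpolation by residues\<close>

lemma contour_integral_linepath_horizontal:
  assumes "a < b"
  shows "contour_integral (linepath (Complex a c) (Complex b c)) f = integral {a..b} (\<lambda>x. f (Complex x c))"
proof -
  have lin: "linepath (Complex a c) (Complex b c) x = Complex (a + (b - a) * x) c" for x
    by (simp add: linepath_def complex_eq_iff algebra_simps)
  have "contour_integral (linepath (Complex a c) (Complex b c)) f =
      of_real (b - a) * integral {0..1} (\<lambda>x. f (Complex (a + (b - a) * x) c))"
    by (simp add: contour_integral_integral lin complex_diff complex_of_real_def)
  also have "{0..1} = (\<lambda>x. x / (b - a)) ` {0..b - a}"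
    using \<open>a < b\<close> by simp
  also have "integral \<dots> (\<lambda>x. f (Complex (a + (b - a) * x) c)) =
      integral {a - a..b - a} (\<lambda>x. f (Complex (x + a) c)) / of_real (b - a)"
    using \<open>a < b\<close> by (subst integral_stretch_real) (auto simp: scaleR_conv_of_real add_ac)
  also have "\<dots> = integral {a..b} (\<lambda>x. f (Complex x c)) / of_real (b - a)"
    by (subst integral_shift_real_ivl) (rule refl)
  finally show ?thesis using \<open>a < b\<close> by simp
qed

text \<open>The first bound comes from |sin(x + iy)|^2 = sin^2 x + sinh^2 y; for the second the real
  part alone, of modulus cosh y, suffices. They serve the horizontal sides of the rectangle and its
  vertical sides through half-integer multiples of h.\<close>

lemma cmod_sin_ge:
  shows "sinh \<bar>Im z\<bar> \<le> cmod (sin z)" and "\<bar>sin (Re z)\<bar> = 1 \<Longrightarrow> 1 \<le> cmod (sin z)"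
proof -
  have c: "(exp t + exp (- t)) / 2 = cosh t" "(exp t - exp (- t)) / 2 = sinh t" for t :: real
    by (simp_all add: cosh_def sinh_def)
  have R: "Re (sin z) = sin (Re z) * cosh (Im z)" unfolding Re_sin c(1)[symmetric] by simp
  have I: "Im (sin z) = cos (Re z) * sinh (Im z)" unfolding Im_sin c(2)[symmetric] by simp
  have "(cmod (sin z))\<^sup>2 = (sin (Re z))\<^sup>2 * ((sinh (Im z))\<^sup>2 + 1) + (cos (Re z))\<^sup>2 * (sinh (Im z))\<^sup>2"
    unfolding cmod_power2 R I power_mult_distrib cosh_square_eq by simp
  also have "\<dots> = (sin (Re z))\<^sup>2 + (sinh (Im z))\<^sup>2 * ((sin (Re z))\<^sup>2 + (cos (Re z))\<^sup>2)"
    by (simp only: ring_distribs mult_1_right) (simp only: ac_simps)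
  finally have "(cmod (sin z))\<^sup>2 = (sin (Re z))\<^sup>2 + (sinh (Im z))\<^sup>2"
    by (simp only: sin_cos_squared_add mult_1_right)
  then have "(sinh \<bar>Im z\<bar>)\<^sup>2 \<le> (cmod (sin z))\<^sup>2" by simp
  then show "sinh \<bar>Im z\<bar> \<le> cmod (sin z)" by (rule power2_le_imp_le) simp
  assume "\<bar>sin (Re z)\<bar> = 1"
  then have "cosh (Im z) = \<bar>Re (sin z)\<bar>" by (simp add: R abs_mult)
  then show "1 \<le> cmod (sin z)" using cosh_real_ge_1[of "Im z"] abs_Re_le_cmod[of "sin z"] by linarith
qed

lemma sin_scaled_eq_0_iff:
  fixes h :: real
  assumes "0 < h"
  shows "sin (of_real (pi / h) * w :: complex) = 0 \<longleftrightarrow> (\<exists>j::int. w = of_real (of_int j * h))"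
proof -
  have "sin (of_real (pi / h) * w) = 0 \<longleftrightarrow> (\<exists>j::int. of_real (pi / h) * w = of_real (of_int j * pi))"
    unfolding sin_eq_0 by (auto simp: mult_ac)
  also have "\<dots> \<longleftrightarrow> (\<exists>j::int. w = of_real (of_int j * h))"
    using assms by (auto simp: field_simps)
  finally show ?thesis .
qed

lemma open_strip: "open (strip d)" and convex_strip: "convex (strip d)"
proof -
  have eq: "strip d = {z. Im z < d} \<inter> {z. Im z > - d}" by (auto simp: strip_def abs_less_iff)
  show "open (strip d)" "convex (strip d)" unfolding eq
    by (intro open_Int open_halfspace_Im_lt open_halfspace_Im_gt convex_Int convex_halfspace_Im_lt convex_halfspace_Im_gt)+
qed

text \<open>The factor \<open>cos (pi * of_int j)\<close> is the sign (-1)^j. It also occurs in the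
  derivative of sin(pi w / h) at the node, so this is the form in which residues produce the basis
  functions.\<close>

lemma sinc_basis_residue_form:
  fixes h y :: real
  assumes "0 < h" "y \<noteq> of_int j * h"
  shows "sinc_basis j h y = sin (pi / h * y) * cos (pi * of_int j) * h / (pi * (y - of_int j * h))"
proof -
  have "pi * (y - of_int j * h) / h = pi / h * y - pi * of_int j" using assms by (simp add: field_simps)
  then have "sin (pi * (y - of_int j * h) / h) = sin (pi / h * y) * cos (pi * of_int j)"
    by (simp add: sin_diff sin_integer_2pi mult.commute)
  moreover have "pi * (y - of_int j * h) / h \<noteq> 0" using assms by auto
  ultimately show ?thesis unfolding sinc_basis_def using assms by (simp add: field_simps)
qed

lemma sinc_basis_at_node:
  assumes "0 < h"
  shows "sinc_basis j h (of_int m * h) = (if j = m then 1 else 0)"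
proof -
  have h0: "sin (of_int k * pi) = 0" for k :: int by (simp add: sin_zero_iff_int2)
  have "pi * (of_int m * h - of_int j * h) / h = of_int (m - j) * pi" using assms by (simp add: field_simps)
  then show ?thesis unfolding sinc_basis_def
    using h0[of "m - j"] by (auto simp del: of_int_diff)
qed

text \<open>Algebra of the residue at a node, with \<open>C\<close> standing for the sign (-1)^j,
  which is its own inverse.\<close>

lemma residue_algebra:
  fixes C h a y m s :: real and x :: complex
  shows "C * C = 1 \<Longrightarrow> x / (of_real m - of_real y) / of_real (a / h * C) = - (x * of_real (C * h / (a * (y - m))))"
    and "s \<noteq> 0 \<Longrightarrow> C * h / (a * (y - m)) = s * C * h / (a * (y - m)) / s"
proof -
  show "C * h / (a * (y - m)) = s * C * h / (a * (y - m)) / s" if "s \<noteq> 0" using that by simp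
  assume "C * C = 1"
  then have ic: "inverse C = C" by (rule inverse_unique)
  have "inverse (of_real m - of_real y) * inverse (of_real (a / h * C)) = (of_real (inverse (m - y) * inverse (a / h * C)) :: complex)"
    by (simp only: of_real_inverse of_real_mult of_real_diff)
  also have "inverse (a / h * C) = inverse a * h * C"
    by (simp only: divide_inverse inverse_mult_distrib inverse_inverse_eq ic)
  also have "inverse (m - y) = - inverse (y - m)"
    by (metis inverse_minus_eq minus_diff_eq)
  also have "- inverse (y - m) * (inverse a * h * C) = - (C * h / (a * (y - m)))"
    by (simp only: divide_inverse inverse_mult_distrib mult_minus_left) (simp only: ac_simps)
  finally show "x / (of_real m - of_real y) / of_real (a / h * C) = - (x * of_real (C * h / (a * (y - m))))"
    by (simp only: divide_inverse[of x] divide_inverse[of "x * inverse (of_real m - of_real y)"] mult.assoc of_real_minus mult_minus_right)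
qed

text \<open>The integrand has simple poles at y and at the nodes inside the rectangle. Multiplied by
  sin(pi y / h), the residue at y is H(y) and the residue at jh is minus the j-th interpolation
  term. The half-integer in \<open>R\<close> keeps the vertical sides midway between nodes.\<close>

lemma sinc_interpolation_contour:
  fixes H :: "complex \<Rightarrow> complex" and h c d y :: real
  assumes hol: "H holomorphic_on strip d" and h: "0 < h" and c: "0 < c" "c < d"
    and y: "\<bar>y\<bar> < (real M + 1 / 2) * h"
  defines "R \<equiv> (real M + 1 / 2) * h"
  shows "H (of_real y) - (\<Sum>j = - int M..int M. H (of_real (of_int j * h)) * of_real (sinc_basis j h y)) =
     of_real (sin (pi / h * y)) / (2 * of_real pi * \<i>) *
       contour_integral (rectpath (Complex (- R) (- c)) (Complex R c))
         (\<lambda>w. H w / ((w - of_real y) * sin (of_real (pi / h) * w)))"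
\<comment> \<open>If y is a node, two poles merge; but then the sine factor vanishes and
  interpolation is exact, so both sides are zero.\<close>
proof (cases "\<exists>m::int. y = of_int m * h")
  case True
  then obtain m :: int where m: "y = of_int m * h" by auto
  have "\<bar>of_int m\<bar> * h < (real M + 1 / 2) * h" using y h unfolding m by (simp add: abs_mult)
  then have "\<bar>of_int m\<bar> < real M + 1 / 2" using h by simp
  then have mM: "m \<in> {- int M..int M}" by (auto simp: abs_if split: if_splits)
  have "sin (pi / h * y) = 0" using h by (simp add: m sin_integer_2pi mult.commute)
  moreover have "(\<Sum>j = - int M..int M. H (of_real (of_int j * h)) * of_real (sinc_basis j h y)) =
      (\<Sum>j = - int M..int M. if j = m then H (of_real (of_int j * h)) else 0)"
    by (intro sum.cong refl) (simp add: m sinc_basis_at_node[OF h])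
  ultimately show ?thesis using mM by (simp add: m)
next
  case False
  define f where "f = (\<lambda>w. H w / ((w - of_real y) * sin (of_real (pi / h) * w)))"
  \<comment> \<open>The half-width (M + 3/4) h lies strictly between that of the rectangle and the
    next pair of nodes, so the only zeros of the sine in \<open>S\<close> are the nodes in
    \<open>J\<close>.\<close>
  define S where "S = {z. Re z < (real M + 3 / 4) * h} \<inter> {z. Re z > - ((real M + 3 / 4) * h)} \<inter> strip d"
  define J where "J = (\<lambda>j::int. complex_of_real (of_int j * h)) ` {- int M..int M}"
  have sy: "sin (pi / h * y) \<noteq> 0"
    using False sin_scaled_eq_0_iff[OF h, of "of_real y"]
    by (metis of_real_eq_0_iff of_real_eq_iff of_real_mult sin_of_real)
  have S: "open S" "connected S"
    unfolding S_def by (intro open_Int open_halfspace_Re_lt open_halfspace_Re_gt open_strip convex_connected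
        convex_Int convex_halfspace_Re_lt convex_halfspace_Re_gt convex_strip)+
  have HS: "H holomorphic_on S" using hol by (rule holomorphic_on_subset) (auto simp: S_def)
  have J: "w \<in> J" if wS: "w \<in> S" and sw: "sin (of_real (pi / h) * w) = 0" for w
  proof -
    obtain j :: int where j: "w = of_real (of_int j * h)" using sw sin_scaled_eq_0_iff[OF h, of w] by blast
    have "of_int j * h < (real M + 3 / 4) * h" "(- (real M + 3 / 4)) * h < of_int j * h"
      using wS by (auto simp: S_def j simp del: minus_add_distrib)
    then have "of_int j < real M + 3 / 4" "- (real M + 3 / 4) < of_int j" using h by (simp_all only: mult_less_cancel_right_pos)
    then have "- int M \<le> j" "j \<le> int M" by linarith+
    then show ?thesis using j by (auto simp: J_def)
  qed
  have jR: "\<bar>of_int j * h\<bar> < R" if "j \<in> {- int M..int M}" for j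
  proof -
    have "\<bar>of_int j\<bar> < real M + 1 / 2" using that by auto
    then show ?thesis using h by (simp add: abs_mult R_def)
  qed
  have yR: "\<bar>y\<bar> < R" using y by (simp add: R_def)
  have yS: "of_real y \<in> S" using yR c h by (auto simp: S_def R_def strip_def abs_less_iff algebra_simps)
  have JS: "J \<subseteq> S" 
  proof
    fix w assume "w \<in> J"
    then obtain j where j: "j \<in> {- int M..int M}" "w = of_real (of_int j * h)" by (auto simp: J_def)
    show "w \<in> S" using jR[OF j(1)] c h unfolding j(2)
      by (auto simp: S_def R_def strip_def abs_less_iff algebra_simps)
  qed
  have yJ: "of_real y \<notin> J" using False unfolding J_def by (auto simp only: image_iff of_real_eq_iff)
  have fin: "finite (insert (of_real y) J)" by (simp add: J_def)
  have holf: "f holomorphic_on S - insert (of_real y) J"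
    unfolding f_def using J by (intro holomorphic_intros holomorphic_on_subset[OF HS]) auto
  have box: "cbox (Complex (- R) (- c)) (Complex R c) \<subseteq> S"
    using c h by (auto simp: S_def R_def in_cbox_complex_iff strip_def algebra_simps)
  have R: "0 < R" using h by (simp add: R_def)
  have inbox: "insert (of_real y) J \<subseteq> box (Complex (- R) (- c)) (Complex R c)"
  proof
    fix w assume "w \<in> insert (of_real y) J"
    then have "w = of_real y \<or> (\<exists>j\<in>{- int M..int M}. w = of_real (of_int j * h))" unfolding J_def by blast
    then have "\<exists>x. w = of_real x \<and> \<bar>x\<bar> < R"
    proof (elim disjE bexE)
      fix j assume "j \<in> {- int M..int M}" "w = of_real (of_int j * h)"
      then show ?thesis using jR by (intro exI[of _ "of_int j * h"] conjI)
    qed (use yR in blast)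
    then show "w \<in> box (Complex (- R) (- c)) (Complex R c)"
      using c by (auto simp: in_box_complex_iff abs_less_iff)
  qed
  have "contour_integral (rectpath (Complex (- R) (- c)) (Complex R c)) f =
     complex_of_real (2 * pi) * \<i> *
     (\<Sum>p\<in>insert (of_real y) J. winding_number (rectpath (Complex (- R) (- c)) (Complex R c)) p * residue f p)"
  proof (rule Residue_theorem[OF S fin holf])
    show "path_image (rectpath (Complex (- R) (- c)) (Complex R c)) \<subseteq> S - insert (of_real y) J"
      using box inbox path_image_rectpath_cbox_minus_box[of "Complex (- R) (- c)" "Complex R c"] R c by auto
    show "\<forall>z. z \<notin> S \<longrightarrow> winding_number (rectpath (Complex (- R) (- c)) (Complex R c)) z = 0"
      using box R c by (auto intro!: winding_number_rectpath_outside)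
  qed auto
  also have "(\<Sum>p\<in>insert (of_real y) J. winding_number (rectpath (Complex (- R) (- c)) (Complex R c)) p * residue f p)
      = (\<Sum>p\<in>insert (of_real y) J. residue f p)"
    using inbox by (intro sum.cong refl) (auto simp: winding_number_rectpath)
  also have "\<dots> = residue f (of_real y) + (\<Sum>p\<in>J. residue f p)"
    using fin yJ by (subst sum.insert) auto
  also have "residue f (of_real y) = H (of_real y) / of_real (sin (pi / h * y))"
  proof -
    have "open (S - J)" using S fin by (intro open_Diff finite_imp_closed) auto
    moreover have "(\<lambda>w. H w / sin (of_real (pi / h) * w)) holomorphic_on S - J"
      using J by (intro holomorphic_intros holomorphic_on_subset[OF HS]) auto
    ultimately have "residue (\<lambda>w. (H w / sin (of_real (pi / h) * w)) / (w - of_real y)) (of_real y)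
        = H (of_real y) / sin (of_real (pi / h) * of_real y)"
      using residue_simple[of "S - J" "of_real y" "\<lambda>w. H w / sin (of_real (pi / h) * w)"] yS yJ by simp
    moreover have "f = (\<lambda>w. (H w / sin (of_real (pi / h) * w)) / (w - of_real y))"
      by (auto simp: f_def fun_eq_iff mult.commute)
    moreover have "sin (of_real (pi / h) * of_real y) = (of_real (sin (pi / h * y)) :: complex)"
      by (simp only: of_real_mult[symmetric] sin_of_real)
    ultimately show ?thesis by (simp only:)
  qed
  also have "(\<Sum>p\<in>J. residue f p) = (\<Sum>j = - int M..int M. residue f (of_real (of_int j * h)))"
    unfolding J_def
  proof (subst sum.reindex)
    show "inj_on (\<lambda>j::int. complex_of_real (of_int j * h)) {- int M..int M}"
      using h by (intro inj_onI) auto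
  qed (simp only: o_def)
  also have "\<dots> = (\<Sum>j = - int M..int M. - (H (of_real (of_int j * h)) * of_real (sinc_basis j h y) / of_real (sin (pi / h * y))))"
  proof (intro sum.cong refl)
    fix j assume j: "j \<in> {- int M..int M}"
    define p where "p = complex_of_real (of_int j * h)"
    have yj: "y \<noteq> of_int j * h" using False by blast
    have pJ: "p \<in> J" using j by (auto simp: p_def J_def)
    have py: "p \<noteq> of_real y" using yJ pJ by auto
    have pS: "p \<in> S" using JS pJ by auto
    have cj: "cos (pi * real_of_int j) * cos (pi * real_of_int j) = 1"
      using sin_cos_squared_add[of "pi * real_of_int j"] by (simp add: sin_integer_2pi mult.commute power2_eq_square)
    have "h \<noteq> 0" using h by (rule less_imp_neq[symmetric])
    then have "pi / h * (of_int j * h) = pi * of_int j" by simp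
    then have ps: "of_real (pi / h) * p = of_real (pi * of_int j)" unfolding p_def of_real_mult[symmetric] by (simp only:)
    have sp: "sin (of_real (pi / h) * p) = 0"
      unfolding sin_scaled_eq_0_iff[OF h] p_def by blast
    \<comment> \<open>The sine has a simple zero at p, so the residue is the limit of f(w) (w - p),
      in which sin(pi w / h) / (w - p) tends to the derivative of the sine.\<close>
    have "((\<lambda>w. sin (of_real (pi / h) * w)) has_field_derivative of_real (pi / h) * cos (of_real (pi / h) * p)) (at p)"
      using h by (auto intro!: derivative_eq_intros)
    then have "((\<lambda>w. sin (of_real (pi / h) * w) / (w - p)) \<longlongrightarrow> of_real (pi / h) * cos (of_real (pi / h) * p)) (at p)"
      unfolding has_field_derivative_iff sp by simp
    then have l1: "((\<lambda>w. sin (of_real (pi / h) * w) / (w - p)) \<longlongrightarrow> of_real (pi / h * cos (pi * of_int j))) (at p)"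
      unfolding ps unfolding cos_of_real unfolding of_real_mult .
    have nz: "pi / h * cos (pi * of_int j) \<noteq> 0"
    proof -
      have "cos (pi * of_int j) \<noteq> 0" using cj by (metis mult_zero_left zero_neq_one)
      moreover have "h \<noteq> 0" using h by (metis less_irrefl)
      ultimately show ?thesis by (simp only: mult_eq_0_iff divide_eq_0_iff pi_neq_zero simp_thms not_False_eq_True)
    qed
    have "isCont H p" using HS pS S(1) holomorphic_on_imp_continuous_on continuous_on_eq_continuous_at by blast
    then have l2: "(H \<longlongrightarrow> H p) (at p)" by (simp add: isCont_def)
    have "((\<lambda>w. H w / (w - of_real y) / (sin (of_real (pi / h) * w) / (w - p))) \<longlongrightarrow>
        H p / (p - of_real y) / of_real (pi / h * cos (pi * of_int j))) (at p)"
    proof (rule tendsto_divide[OF tendsto_divide[OF l2 tendsto_diff[OF tendsto_ident_at tendsto_const]] l1])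
      show "p - of_real y \<noteq> 0" using py by simp
      show "complex_of_real (pi / h * cos (pi * of_int j)) \<noteq> 0" using nz by (simp only: of_real_eq_0_iff not_False_eq_True)
    qed
    moreover have "x / u / (s / v) = x / (u * s) * v" for x u s v :: complex by simp
    ultimately have "((\<lambda>w. f w * (w - p)) \<longlongrightarrow> H p / (p - of_real y) / of_real (pi / h * cos (pi * of_int j))) (at p)"
      unfolding f_def by (simp only:)
    moreover have "open (S - (insert (of_real y) J - {p}))" using S fin by (intro open_Diff finite_imp_closed) auto
    moreover have "S - (insert (of_real y) J - {p}) - {p} = S - insert (of_real y) J" using pJ by auto
    ultimately have "residue f p = H p / (p - of_real y) / of_real (pi / h * cos (pi * of_int j))"
      using pS holf by (intro residue_simple'[where s = "S - (insert (of_real y) J - {p})"]) (simp_all only: Diff_iff insertI1 not_False_eq_True simp_thms)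
    also have "\<dots> = - (H p * of_real (cos (pi * of_int j) * h / (pi * (y - of_int j * h))))"
      unfolding p_def by (rule residue_algebra(1)[OF cj])
    also have "cos (pi * of_int j) * h / (pi * (y - of_int j * h)) = sinc_basis j h y / sin (pi / h * y)"
      unfolding sinc_basis_residue_form[OF h, of y j, OF yj] by (rule residue_algebra(2)[OF sy])
    finally show "residue f (of_real (of_int j * h)) =
        - (H (of_real (of_int j * h)) * of_real (sinc_basis j h y) / of_real (sin (pi / h * y)))"
      by (simp add: p_def)
  qed
  also have "H (of_real y) / of_real (sin (pi / h * y)) + \<dots> =
     (H (of_real y) - (\<Sum>j = - int M..int M. H (of_real (of_int j * h)) * of_real (sinc_basis j h y))) / of_real (sin (pi / h * y))"
    by (simp add: sum_negf diff_divide_distrib sum_divide_distrib)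
  finally show ?thesis using sy unfolding f_def by simp
qed


section \<open>Horizontal and vertical sides of the contour\<close>

lemma integral_cauchy_weight_le:
  fixes a b :: real
  assumes "a \<le> b"
  shows "((\<lambda>s. 1 / (1 + s\<^sup>2)) has_integral arctan b - arctan a) {a..b}" "arctan b - arctan a \<le> pi"
proof -
  show "((\<lambda>s. 1 / (1 + s\<^sup>2)) has_integral arctan b - arctan a) {a..b}"
    by (rule fundamental_theorem_of_calculus[OF assms])
       (auto simp flip: has_real_derivative_iff_has_vector_derivative simp: divide_inverse intro!: derivative_eq_intros)
  show "arctan b - arctan a \<le> pi" using arctan_ubound[of b] arctan_lbound[of a] by linarith
qed

text \<open>Source of the additional factor h in the quadrature error. Integration by parts against
  -(h / pi) cos(pi y / h) leaves two boundary terms of size h / (pi |\<sigma>|) and an integral of h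
  / (pi |w - y|^2), which arctan bounds by h / |\<sigma>|. The bound is uniform in s and in the
  interval.\<close>

lemma oscillatory_kernel_bound:
  fixes h s \<sigma> y0 y1 :: real
  assumes "0 < h" "\<sigma> \<noteq> 0" "y0 \<le> y1"
  shows "cmod (integral {y0..y1} (\<lambda>y. of_real (sin (pi / h * y)) / (Complex s \<sigma> - of_real y)))
     \<le> h * (2 + pi) / (pi * \<bar>\<sigma>\<bar>)"
proof (cases "y0 = y1")
  case True
  then show ?thesis using assms by (simp add: add_nonneg_nonneg)
next
  case False
  define w where "w = Complex s \<sigma>"
  have nz: "w - of_real y \<noteq> 0" for y using assms(2) by (auto simp: w_def complex_eq_iff)
  have nw: "(cmod (w - of_real y))\<^sup>2 = \<sigma>\<^sup>2 + (y - s)\<^sup>2" for y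
    by (simp add: w_def cmod_power2 power2_commute)
  have ge: "\<bar>\<sigma>\<bar> \<le> cmod (w - of_real y)" for y
    using abs_Im_le_cmod[of "w - of_real y"] by (simp add: w_def)
  define f where "f = (\<lambda>y. complex_of_real (sin (pi / h * y)) / (w - of_real y))"
  \<comment> \<open>Adding \<open>q\<close> to the running integral cancels \<open>f\<close>, so
    that \<open>Z\<close> has the derivative \<open>q'\<close> with a squared denominator;
    \<open>\<phi>\<close> is an antiderivative of the bound for the modulus of
    \<open>q'\<close>.\<close>
  define q where "q = (\<lambda>y. complex_of_real (h / pi) * of_real (cos (pi / h * y)) / (w - of_real y))"
  define q' where "q' = (\<lambda>y. complex_of_real (h / pi) * of_real (cos (pi / h * y)) / (w - of_real y)\<^sup>2)"
  define Z where "Z = (\<lambda>y. integral {y0..y} f + q y)"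
  define \<phi> where "\<phi> = (\<lambda>y. h / pi / \<bar>\<sigma>\<bar> * arctan ((y - s) / \<bar>\<sigma>\<bar>))"
  have contf: "continuous_on {y0..y1} f" unfolding f_def by (intro continuous_intros) (use nz in auto)
  have dq: "(q has_vector_derivative - f y + q' y) (at y within A)" for y A
  proof -
    have "((\<lambda>y. cos (pi / h * y)) has_vector_derivative - (pi / h) * sin (pi / h * y)) (at y within A)"
      unfolding has_real_derivative_iff_has_vector_derivative[symmetric]
      using assms(1) by (auto intro!: derivative_eq_intros)
    then have 1: "((\<lambda>y. complex_of_real (cos (pi / h * y))) has_vector_derivative of_real (- (pi / h) * sin (pi / h * y))) (at y within A)"
      by (rule bounded_linear.has_vector_derivative[OF bounded_linear_of_real])
    have "((\<lambda>z. inverse (w - z)) has_field_derivative inverse ((w - of_real y)\<^sup>2)) (at (of_real y))"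
      using nz[of y] by (auto intro!: derivative_eq_intros simp: field_simps power2_eq_square)
    then have 2: "((\<lambda>y. inverse (w - complex_of_real y)) has_vector_derivative inverse ((w - of_real y)\<^sup>2)) (at y within A)"
      by (rule has_vector_derivative_real_field)
    have 3: "((\<lambda>y. complex_of_real (h / pi) * (of_real (cos (pi / h * y)) * inverse (w - of_real y))) has_vector_derivative
       complex_of_real (h / pi) * (of_real (cos (pi / h * y)) * inverse ((w - of_real y)\<^sup>2) + of_real (- (pi / h) * sin (pi / h * y)) * inverse (w - of_real y))) (at y within A)"
      by (rule has_vector_derivative_mult_right[OF has_vector_derivative_mult[OF 1 2]])
    have "complex_of_real (h / pi) * (of_real (cos (pi / h * y)) * inverse ((w - of_real y)\<^sup>2) + of_real (- (pi / h) * sin (pi / h * y)) * inverse (w - of_real y)) =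
       q' y + (complex_of_real (h / pi) * of_real (- (pi / h))) * (of_real (sin (pi / h * y)) * inverse (w - of_real y))"
      by (simp only: q'_def divide_inverse[of "_ * _"] ring_distribs of_real_mult mult.assoc)
    also have "complex_of_real (h / pi) * of_real (- (pi / h)) = - 1"
    proof -
      have "h / pi * - (pi / h) = - 1"
        using less_imp_neq[OF assms(1), symmetric] by (simp only: mult_minus_right times_divide_times_eq mult.commute[of pi] divide_self mult_eq_0_iff pi_neq_zero simp_thms)
      then show ?thesis unfolding of_real_mult[symmetric] by (simp only: of_real_minus of_real_1)
    qed
    finally have "complex_of_real (h / pi) * (of_real (cos (pi / h * y)) * inverse ((w - of_real y)\<^sup>2) + of_real (- (pi / h) * sin (pi / h * y)) * inverse (w - of_real y))
       = - f y + q' y" unfolding f_def by (simp only: divide_inverse mult_minus1 add.commute)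
    then show ?thesis using 3 unfolding q_def by (simp only: divide_inverse[of "_ * _"] mult.assoc)
  qed
  have dZ: "(Z has_vector_derivative q' y) (at y within {y0..y1})" if "y \<in> {y0..y1}" for y
  proof -
    have "(Z has_vector_derivative f y + (- f y + q' y)) (at y within {y0..y1})" unfolding Z_def
      by (rule has_vector_derivative_add[OF integral_has_vector_derivative[OF contf that] dq])
    then show ?thesis by simp
  qed
  have d\<phi>: "(\<phi> has_vector_derivative h / pi / (\<sigma>\<^sup>2 + (y - s)\<^sup>2)) (at y)" for y
  proof -
    have eq: "h / pi / A * (inverse (1 + (t / A)\<^sup>2) * (1 / A)) = h / pi / (A\<^sup>2 + t\<^sup>2)" if "0 < A" for A t :: real
    proof -
      have "1 + (t / A)\<^sup>2 = (A\<^sup>2 + t\<^sup>2) / A\<^sup>2" using that by (simp add: power_divide add_divide_distrib)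
      then show ?thesis using that by (simp add: power2_eq_square)
    qed
    have "((\<lambda>y. (y - s) / \<bar>\<sigma>\<bar>) has_real_derivative 1 / \<bar>\<sigma>\<bar>) (at y)"
      by (intro DERIV_cdivide) (auto intro!: derivative_eq_intros)
    then have "((\<lambda>y. arctan ((y - s) / \<bar>\<sigma>\<bar>)) has_real_derivative inverse (1 + ((y - s) / \<bar>\<sigma>\<bar>)\<^sup>2) * (1 / \<bar>\<sigma>\<bar>)) (at y)"
      by (intro DERIV_chain2[OF DERIV_arctan])
    then have "(\<phi> has_real_derivative h / pi / \<bar>\<sigma>\<bar> * (inverse (1 + ((y - s) / \<bar>\<sigma>\<bar>)\<^sup>2) * (1 / \<bar>\<sigma>\<bar>))) (at y)"
      unfolding \<phi>_def by (rule DERIV_cmult)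
    moreover have "h / pi / \<bar>\<sigma>\<bar> * (inverse (1 + ((y - s) / \<bar>\<sigma>\<bar>)\<^sup>2) * (1 / \<bar>\<sigma>\<bar>)) = h / pi / (\<sigma>\<^sup>2 + (y - s)\<^sup>2)"
      using eq[of "\<bar>\<sigma>\<bar>" "y - s"] assms(2) by (simp only: power2_abs zero_less_abs_iff not_False_eq_True)
    ultimately show ?thesis by (simp only: has_real_derivative_iff_has_vector_derivative)
  qed
  have "norm (Z y1 - Z y0) \<le> \<phi> y1 - \<phi> y0"
  proof (rule differentiable_bound_general)
    show "y0 < y1" using assms False by simp
    show "continuous_on {y0..y1} Z" 
      unfolding continuous_on_eq_continuous_within by (blast intro: has_vector_derivative_continuous dZ)
    show "continuous_on {y0..y1} \<phi>" unfolding \<phi>_def by (intro continuous_intros) (use assms in auto)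
    fix y assume y: "y0 < y" "y < y1"
    have "at y within {y0..y1} = at y" using y by (intro at_within_interior) auto
    then show "(Z has_vector_derivative q' y) (at y)" using dZ[of y] y by simp
    show "(\<phi> has_vector_derivative h / pi / (\<sigma>\<^sup>2 + (y - s)\<^sup>2)) (at y)" by (rule d\<phi>)
    have "norm (q' y) = h / pi * \<bar>cos (pi / h * y)\<bar> / (\<sigma>\<^sup>2 + (y - s)\<^sup>2)"
      unfolding q'_def using assms(1) by (simp only: norm_divide norm_mult norm_power nw norm_of_real abs_divide abs_of_pos pi_gt_zero)
    also have "\<dots> \<le> h / pi * 1 / (\<sigma>\<^sup>2 + (y - s)\<^sup>2)"
      by (intro divide_right_mono mult_left_mono) (use assms in auto)
    finally show "norm (q' y) \<le> h / pi / (\<sigma>\<^sup>2 + (y - s)\<^sup>2)" by simp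
  qed
  also have "\<dots> = h / pi / \<bar>\<sigma>\<bar> * (arctan ((y1 - s) / \<bar>\<sigma>\<bar>) - arctan ((y0 - s) / \<bar>\<sigma>\<bar>))"
    by (simp add: \<phi>_def right_diff_distrib)
  also have "\<dots> \<le> h / pi / \<bar>\<sigma>\<bar> * pi"
    using arctan_ubound[of "(y1 - s) / \<bar>\<sigma>\<bar>"] arctan_lbound[of "(y0 - s) / \<bar>\<sigma>\<bar>"] assms
    by (intro mult_left_mono) auto
  finally have 1: "norm (Z y1 - Z y0) \<le> h / pi / \<bar>\<sigma>\<bar> * pi" .
  have 2: "norm (q y) \<le> h / pi / \<bar>\<sigma>\<bar>" for y
  proof -
    have "norm (q y) = h / pi * \<bar>cos (pi / h * y)\<bar> / cmod (w - of_real y)"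
      unfolding q_def using assms(1) by (simp only: norm_divide norm_mult norm_of_real abs_divide abs_of_pos pi_gt_zero)
    also have "\<dots> \<le> h / pi * 1 / \<bar>\<sigma>\<bar>"
      by (intro frac_le mult_left_mono ge) (use assms in auto)
    finally show ?thesis by simp
  qed
  have "integral {y0..y1} f = (Z y1 - Z y0) - q y1 + q y0" by (simp add: Z_def)
  then have "norm (integral {y0..y1} f) \<le> norm (Z y1 - Z y0) + norm (q y1) + norm (q y0)"
    using norm_triangle_ineq[of "Z y1 - Z y0 - q y1" "q y0"] norm_triangle_ineq4[of "Z y1 - Z y0" "q y1"] by simp
  also have "\<dots> \<le> h / pi / \<bar>\<sigma>\<bar> * pi + h / pi / \<bar>\<sigma>\<bar> + h / pi / \<bar>\<sigma>\<bar>" by (intro add_mono 1 2)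
  also have "\<dots> = h / pi / \<bar>\<sigma>\<bar> * (2 + pi)"
  proof -
    have "X * pi + X + X = X * (2 + pi)" for X :: real by (simp add: algebra_simps)
    then show ?thesis .
  qed
  also have "\<dots> = h * (2 + pi) / (pi * \<bar>\<sigma>\<bar>)" by (simp only: divide_divide_eq_left times_divide_eq_left)
  finally show ?thesis by (simp add: f_def w_def)
qed


lemma sin_complex_nz:
  assumes "0 < h" "Im w \<noteq> 0"
  shows "sin (of_real (pi / h) * w) \<noteq> 0"
  using assms sin_scaled_eq_0_iff[OF assms(1), of w] by auto

text \<open>The top side is traversed from right to left, hence its minus sign. The vertical sides
  stay contour integrals, since they will only be bounded.\<close>

lemma contour_integral_rectpath:
  assumes "continuous_on (path_image (rectpath (Complex (- R) (- c)) (Complex R c))) f" "0 < R" "0 < c"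
  shows "contour_integral (rectpath (Complex (- R) (- c)) (Complex R c)) f =
     integral {- R..R} (\<lambda>s. f (Complex s (- c))) + contour_integral (linepath (Complex R (- c)) (Complex R c)) f
     - integral {- R..R} (\<lambda>s. f (Complex s c)) + contour_integral (linepath (Complex (- R) c) (Complex (- R) (- c))) f"
proof -
  have im: "path_image (rectpath (Complex (- R) (- c)) (Complex R c)) =
      closed_segment (Complex (- R) (- c)) (Complex R (- c)) \<union> closed_segment (Complex R (- c)) (Complex R c) \<union>
      closed_segment (Complex R c) (Complex (- R) c) \<union> closed_segment (Complex (- R) c) (Complex (- R) (- c))"
    by (simp add: rectpath_def Let_def path_image_join Un_assoc)
  have ci: "f contour_integrable_on linepath (Complex (- R) (- c)) (Complex R (- c))"
     "f contour_integrable_on linepath (Complex R (- c)) (Complex R c)"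
     "f contour_integrable_on linepath (Complex R c) (Complex (- R) c)"
     "f contour_integrable_on linepath (Complex (- R) c) (Complex (- R) (- c))"
    by (intro contour_integrable_continuous_linepath continuous_on_subset[OF assms(1)]; use im in blast)+
  have "contour_integral (linepath (Complex R c) (Complex (- R) c)) f = - integral {- R..R} (\<lambda>s. f (Complex s c))"
    using contour_integral_reverse_linepath[of "Complex (- R) c" "Complex R c" f]
      contour_integral_linepath_horizontal[of "- R" R c f] assms(2) ci(3)
    by (metis contour_integral_reversepath contour_integrable_reversepath reversepath_linepath valid_path_linepath neg_less_pos minus_minus)
  moreover have "contour_integral (rectpath (Complex (- R) (- c)) (Complex R c)) f =
     contour_integral (linepath (Complex (- R) (- c)) (Complex R (- c))) f +
     (contour_integral (linepath (Complex R (- c)) (Complex R c)) f +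
     (contour_integral (linepath (Complex R c) (Complex (- R) c)) f +
      contour_integral (linepath (Complex (- R) c) (Complex (- R) (- c))) f))"
    unfolding rectpath_def Let_def using ci by (simp add: contour_integrable_joinI)
  ultimately show ?thesis using contour_integral_linepath_horizontal[of "- R" R "- c" f] assms(2) by simp
qed

text \<open>Contribution of the horizontal line at height \<sigma> to the interpolation error at y.
  The prefactor sin(pi y / h) is kept apart, because its oscillation is exploited when the error is
  integrated in y.\<close>

definition sinc_line :: "(complex \<Rightarrow> complex) \<Rightarrow> real \<Rightarrow> real \<Rightarrow> real \<Rightarrow> real \<Rightarrow> complex" where
  "sinc_line H h R \<sigma> y = integral {- R..R} (\<lambda>s. H (Complex s \<sigma>) / sin (of_real (pi / h) * Complex s \<sigma>) / (Complex s \<sigma> - of_real y))"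

text \<open>The horizontal sides carry the error that survives; the vertical sides only have to be
  small for large M. On them the sine is at least 1 in modulus, and the distance to y is at least h
  / 2 because y stays within the range of the nodes.\<close>

lemma sinc_interpolation_split:
  fixes H :: "complex \<Rightarrow> complex" and h c d y :: real
  assumes hol: "H holomorphic_on strip d" and h: "0 < h" and c: "0 < c" "c < d"
    and y: "\<bar>y\<bar> \<le> real M * h"
  defines "R \<equiv> (real M + 1 / 2) * h"
  assumes B: "\<And>w. \<bar>Re w\<bar> = R \<Longrightarrow> \<bar>Im w\<bar> \<le> c \<Longrightarrow> cmod (H w) \<le> B" and B0: "0 \<le> B"
  shows "cmod (H (of_real y) - (\<Sum>j = - int M..int M. H (of_real (of_int j * h)) * of_real (sinc_basis j h y))
     - of_real (sin (pi / h * y)) / (2 * of_real pi * \<i>) * (sinc_line H h R (- c) y - sinc_line H h R c y)) \<le> 4 * c * B / (pi * h)"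
proof -
  define f where "f = (\<lambda>w. H w / ((w - of_real y) * sin (of_real (pi / h) * w)))"
  have R: "0 < R" using h by (simp add: R_def)
  have yR: "\<bar>y\<bar> + h / 2 \<le> R" using y by (simp add: R_def algebra_simps)
  have im: "path_image (rectpath (Complex (- R) (- c)) (Complex R c)) =
      {z. Re z \<in> {- R, R} \<and> Im z \<in> {- c..c}} \<union> {z. Im z \<in> {- c, c} \<and> Re z \<in> {- R..R}}"
    using path_image_rectpath[of "Complex (- R) (- c)" "Complex R c"] R c by simp
  have sin_vert: "1 \<le> cmod (sin (of_real (pi / h) * z))" if z: "\<bar>Re z\<bar> = R" for z
  proof -
    have RR: "pi / h * R = pi * real M + pi / 2" using h by (simp add: R_def field_simps)
    have s: "sin (pi / h * R) = cos (pi * real M)" unfolding RR by (simp add: sin_add)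
    have "\<bar>cos (pi * real M)\<bar> = 1" by (simp add: cos_npi2 mult.commute)
    then have "\<bar>sin (pi / h * R)\<bar> = 1" using s by simp
    moreover have "Re z = R \<or> Re z = - R" using z by linarith
    ultimately have "\<bar>sin (pi / h * Re z)\<bar> = 1" by (elim disjE) simp_all
    then show ?thesis by (intro cmod_sin_ge(2)) simp
  qed
  have sin_nz: "sin (of_real (pi / h) * z) \<noteq> 0" if "\<bar>Re z\<bar> = R \<or> \<bar>Im z\<bar> = c" for z
    using that
  proof
    assume "\<bar>Re z\<bar> = R" then show ?thesis using sin_vert[of z] by auto
  next
    assume "\<bar>Im z\<bar> = c" then show ?thesis using c h by (intro sin_complex_nz) auto
  qed
  have y_nz: "z - of_real y \<noteq> 0" if "\<bar>Re z\<bar> = R \<or> \<bar>Im z\<bar> = c" for z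
    using that c h yR by (auto simp: complex_eq_iff)
  have "continuous_on (path_image (rectpath (Complex (- R) (- c)) (Complex R c))) f"
    unfolding f_def
  proof (intro continuous_on_divide continuous_on_mult continuous_on_diff continuous_on_id continuous_on_const continuous_on_sin)
    show "continuous_on (path_image (rectpath (Complex (- R) (- c)) (Complex R c))) H"
      by (rule continuous_on_subset[OF holomorphic_on_imp_continuous_on[OF hol]])
         (use c in \<open>auto simp: im strip_def abs_less_iff\<close>)
    show "\<forall>x\<in>path_image (rectpath (Complex (- R) (- c)) (Complex R c)). (x - of_real y) * sin (of_real (pi / h) * x) \<noteq> 0"
    proof
      fix x assume "x \<in> path_image (rectpath (Complex (- R) (- c)) (Complex R c))"
      then have "\<bar>Re x\<bar> = R \<or> \<bar>Im x\<bar> = c" using R c by (auto simp: im)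
      then show "(x - of_real y) * sin (of_real (pi / h) * x) \<noteq> 0" using sin_nz y_nz by simp
    qed
  qed
  note ce = contour_integral_rectpath[OF this R c(1)]
  have fb: "cmod (f z) \<le> B * (2 / h)" if z: "\<bar>Re z\<bar> = R" "\<bar>Im z\<bar> \<le> c" for z
  proof -
    have "h / 2 \<le> \<bar>Re (z - of_real y)\<bar>" using z(1) yR by (simp add: abs_if split: if_splits)
    also have "\<dots> \<le> cmod (z - of_real y)" by (rule abs_Re_le_cmod)
    finally have "h / 2 * 1 \<le> cmod (z - of_real y) * cmod (sin (of_real (pi / h) * z))"
      using sin_vert[OF z(1)] h by (intro mult_mono) auto
    then have "cmod (H z) / (cmod (z - of_real y) * cmod (sin (of_real (pi / h) * z))) \<le> B / (h / 2 * 1)"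
      using B[OF z] h B0 by (intro frac_le) auto
    then show ?thesis by (simp add: f_def norm_divide norm_mult)
  qed
  have vert: "cmod (contour_integral (linepath (Complex r p) (Complex r q)) f) \<le> B * (2 / h) * (2 * c)"
    if r: "\<bar>r\<bar> = R" and pq: "\<bar>p\<bar> = c" "\<bar>q\<bar> = c" "\<bar>q - p\<bar> = 2 * c" for r p q
  proof -
    have seg: "z \<in> closed_segment (Complex r p) (Complex r q) \<Longrightarrow> \<bar>Re z\<bar> = R \<and> \<bar>Im z\<bar> \<le> c" for z
      using r pq by (auto simp: closed_segment_same_Re closed_segment_eq_real_ivl split: if_splits)
    have "closed_segment (Complex r p) (Complex r q) \<subseteq> path_image (rectpath (Complex (- R) (- c)) (Complex R c))"
    proof
      fix z assume "z \<in> closed_segment (Complex r p) (Complex r q)"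
      then have "\<bar>Re z\<bar> = R \<and> \<bar>Im z\<bar> \<le> c" by (rule seg)
      then show "z \<in> path_image (rectpath (Complex (- R) (- c)) (Complex R c))" using R unfolding im by auto
    qed
    then have "f contour_integrable_on linepath (Complex r p) (Complex r q)"
      by (intro contour_integrable_continuous_linepath) (rule continuous_on_subset[OF \<open>continuous_on _ f\<close>])
    then have "cmod (contour_integral (linepath (Complex r p) (Complex r q)) f) \<le> B * (2 / h) * cmod (Complex r q - Complex r p)"
      using B0 h fb seg by (intro contour_integral_bound_linepath) auto
    also have "cmod (Complex r q - Complex r p) = 2 * c" using pq(3) by (simp add: complex_diff cmod_def)
    finally show ?thesis .
  qed
  define V where "V = contour_integral (linepath (Complex R (- c)) (Complex R c)) f + contour_integral (linepath (Complex (- R) c) (Complex (- R) (- c))) f"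
  have V: "cmod V \<le> B * (2 / h) * (2 * c) + B * (2 / h) * (2 * c)" unfolding V_def
    by (intro order_trans[OF norm_triangle_ineq] add_mono vert) (use R c in auto)
  have fl: "integral {- R..R} (\<lambda>s. f (Complex s \<sigma>)) = sinc_line H h R \<sigma> y" for \<sigma>
    unfolding sinc_line_def f_def by (simp only: divide_divide_eq_left mult.commute)
  have "H (of_real y) - (\<Sum>j = - int M..int M. H (of_real (of_int j * h)) * of_real (sinc_basis j h y)) =
     of_real (sin (pi / h * y)) / (2 * of_real pi * \<i>) * contour_integral (rectpath (Complex (- R) (- c)) (Complex R c)) f"
    unfolding f_def R_def by (rule sinc_interpolation_contour[OF hol h c]) (use y h in \<open>simp add: algebra_simps\<close>)
  also have "contour_integral (rectpath (Complex (- R) (- c)) (Complex R c)) f = (sinc_line H h R (- c) y - sinc_line H h R c y) + V"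
    unfolding ce fl V_def by simp
  finally have eq: "H (of_real y) - (\<Sum>j = - int M..int M. H (of_real (of_int j * h)) * of_real (sinc_basis j h y))
     - of_real (sin (pi / h * y)) / (2 * of_real pi * \<i>) * (sinc_line H h R (- c) y - sinc_line H h R c y) =
     of_real (sin (pi / h * y)) / (2 * of_real pi * \<i>) * V" by (simp add: ring_distribs)
  have "cmod (of_real (sin (pi / h * y)) / (2 * of_real pi * \<i>) * V) = \<bar>sin (pi / h * y)\<bar> / (2 * pi) * cmod V"
    by (simp add: norm_mult norm_divide)
  also have "\<dots> \<le> 1 / (2 * pi) * (B * (2 / h) * (2 * c) + B * (2 / h) * (2 * c))"
    by (intro mult_mono divide_right_mono V) auto
  also have "\<dots> = 4 * c * B / (pi * h)" using h by (simp add: field_simps)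
  finally show ?thesis unfolding eq .
qed

section \<open>Sinc interpolation and quadrature errors\<close>

text \<open>Lets the height c of the contour tend to d inside a finished inequality: the integrand
  lives on the open strip, so the contour itself cannot be placed at height d.\<close>

lemma le_at_left_limit:
  fixes f :: "real \<Rightarrow> real"
  assumes "\<And>c. 0 < c \<Longrightarrow> c < d \<Longrightarrow> X \<le> f c" "isCont f d" "0 < d"
  shows "X \<le> f d"
proof (rule tendsto_lowerbound)
  show "(f \<longlongrightarrow> f d) (at_left d)" using assms(2) by (simp add: continuous_at_imp_continuous_at_within continuous_within[symmetric])
  show "\<forall>\<^sub>F c in at_left d. X \<le> f c" unfolding eventually_at_left[OF assms(3)]
    by (intro exI[of _ 0]) (use assms in auto)
qed simp

lemma sinh_pos_quot: "0 < c \<Longrightarrow> 0 < h \<Longrightarrow> 0 < sinh (pi * c / h :: real)"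
  by simp

section \<open>Errors for integrands with double exponential decay on the strip\<close>

context
  fixes H :: "complex \<Rightarrow> complex" and d \<mu> B :: real
  assumes hol: "H holomorphic_on strip d" and \<mu>: "0 < \<mu>" and B: "0 \<le> B"
    and HB: "\<And>z. z \<in> strip d \<Longrightarrow> cmod (H z) \<le> B * exp (- \<mu> * cosh (Re z))"
begin

private definition G where "G h \<sigma> s = H (Complex s \<sigma>) / sin (of_real (pi / h) * Complex s \<sigma>)"

private lemma G_cont:
  assumes "0 < h" "0 < \<bar>\<sigma>\<bar>" "\<bar>\<sigma>\<bar> < d"
  shows "continuous_on A (G h \<sigma>)"
proof -
  have c1: "continuous_on A (\<lambda>s. Complex s \<sigma>)" by (intro continuous_intros)
  have "continuous_on A (\<lambda>s. H (Complex s \<sigma>))"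
    by (rule continuous_on_compose2[OF holomorphic_on_imp_continuous_on[OF hol] c1]) (use assms in \<open>auto simp: strip_def\<close>)
  then show ?thesis unfolding G_def
    by (intro continuous_on_divide continuous_on_sin continuous_on_mult continuous_on_const c1 ballI sin_complex_nz)
       (use assms in auto)
qed

text \<open>The factor 1 / sinh(pi |\<sigma>| / h), from the sine in the denominator, is the origin
  of the convergence rate; the decay of \<open>H\<close> enters as an integrable weight.\<close>

private lemma G_bound:
  assumes "0 < h" "0 < \<bar>\<sigma>\<bar>" "\<bar>\<sigma>\<bar> < d"
  shows "cmod (G h \<sigma> s) \<le> B * (2 / \<mu>) / sinh (pi * \<bar>\<sigma>\<bar> / h) * (1 / (1 + s\<^sup>2))"
proof -
  have 1: "sinh (pi * \<bar>\<sigma>\<bar> / h) \<le> cmod (sin (of_real (pi / h) * Complex s \<sigma>))"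
    using cmod_sin_ge(1)[of "of_real (pi / h) * Complex s \<sigma>"] assms(1) by (simp add: abs_mult)
  have "cmod (H (Complex s \<sigma>)) \<le> B * exp (- \<mu> * cosh s)"
    using HB[of "Complex s \<sigma>"] assms by (simp add: strip_def)
  also have "\<dots> \<le> B * ((2 / \<mu>) / (1 + s\<^sup>2))"
    by (intro mult_left_mono exp_cosh_le \<mu> B)
  finally have 2: "cmod (H (Complex s \<sigma>)) \<le> B * ((2 / \<mu>) / (1 + s\<^sup>2))" .
  have "cmod (G h \<sigma> s) \<le> B * ((2 / \<mu>) / (1 + s\<^sup>2)) / sinh (pi * \<bar>\<sigma>\<bar> / h)"
    unfolding G_def norm_divide using assms by (intro frac_le 1 2 sinh_pos_quot) (auto intro!: mult_nonneg_nonneg B divide_nonneg_nonneg simp: less_imp_le[OF \<mu>])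
  then show ?thesis by (simp add: mult_ac)
qed

private lemma sinc_line_eq: "sinc_line H h R \<sigma> y = integral {- R..R} (\<lambda>s. G h \<sigma> s / (Complex s \<sigma> - of_real y))"
  by (simp only: sinc_line_def G_def)

private lemma Cw: "0 < \<bar>\<sigma>\<bar> \<Longrightarrow> Complex s \<sigma> - of_real y \<noteq> 0" "\<bar>\<sigma>\<bar> \<le> cmod (Complex s \<sigma> - of_real y)"
  using abs_Im_le_cmod[of "Complex s \<sigma> - of_real y"] by (auto simp: complex_eq_iff)

private lemma weight_bound:
  assumes "0 \<le> R" "0 \<le> K" and "f integrable_on {- R..R}" "\<And>s. s \<in> {- R..R} \<Longrightarrow> cmod (f s) \<le> K * (1 / (1 + s\<^sup>2))"
  shows "cmod (integral {- R..R} f) \<le> K * pi"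
proof -
  have R: "- R \<le> R" using assms by simp
  note w = integral_cauchy_weight_le[OF R]
  have "cmod (integral {- R..R} f) \<le> integral {- R..R} (\<lambda>s. K * (1 / (1 + s\<^sup>2)))"
  proof (rule integral_norm_bound_integral[OF assms(3) _ assms(4)])
    show "(\<lambda>s. K * (1 / (1 + s\<^sup>2))) integrable_on {- R..R}"
      by (rule has_integral_integrable[OF has_integral_mult_right[OF w(1)]])
  qed
  also have "\<dots> = K * (arctan R - arctan (- R))"
    using w(1) by (metis integral_mult_right integral_unique)
  also have "\<dots> \<le> K * pi" by (intro mult_left_mono w(2) assms)
  finally show ?thesis .
qed

private lemma sinc_line_bound:
  assumes h: "0 < h" and \<sigma>: "0 < \<bar>\<sigma>\<bar>" "\<bar>\<sigma>\<bar> < d" and R: "0 \<le> R"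
  shows "cmod (sinc_line H h R \<sigma> y) \<le> B * (2 / \<mu>) / sinh (pi * \<bar>\<sigma>\<bar> / h) / \<bar>\<sigma>\<bar> * pi"
  unfolding sinc_line_eq
proof (rule weight_bound[OF R])
  show "0 \<le> B * (2 / \<mu>) / sinh (pi * \<bar>\<sigma>\<bar> / h) / \<bar>\<sigma>\<bar>"
    using B \<mu> h sinh_pos_quot[OF \<sigma>(1) h] by (intro divide_nonneg_nonneg mult_nonneg_nonneg) auto
  show "(\<lambda>s. G h \<sigma> s / (Complex s \<sigma> - of_real y)) integrable_on {- R..R}"
    using Cw(1)[OF \<sigma>(1)]
    by (intro integrable_continuous_real continuous_on_divide G_cont[OF h \<sigma>] continuous_intros) auto
  fix s
  have "cmod (G h \<sigma> s / (Complex s \<sigma> - of_real y)) \<le> (B * (2 / \<mu>) / sinh (pi * \<bar>\<sigma>\<bar> / h) * (1 / (1 + s\<^sup>2))) / \<bar>\<sigma>\<bar>"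
    unfolding norm_divide
  proof (rule frac_le[OF _ G_bound[OF h \<sigma>] \<sigma>(1) Cw(2)])
    show "0 \<le> B * (2 / \<mu>) / sinh (pi * \<bar>\<sigma>\<bar> / h) * (1 / (1 + s\<^sup>2))" using G_bound[OF h \<sigma>, of s] norm_ge_zero order_trans by blast
  qed
  then show "cmod (G h \<sigma> s / (Complex s \<sigma> - of_real y)) \<le> B * (2 / \<mu>) / sinh (pi * \<bar>\<sigma>\<bar> / h) / \<bar>\<sigma>\<bar> * (1 / (1 + s\<^sup>2))"
    by (simp only: times_divide_eq_left times_divide_eq_right divide_divide_eq_left mult_ac)
qed

private lemma cont2:
  assumes h: "0 < h" and \<sigma>: "0 < \<bar>\<sigma>\<bar>" "\<bar>\<sigma>\<bar> < d"
  shows "continuous_on X (\<lambda>(y, s). G h \<sigma> s / (Complex s \<sigma> - complex_of_real y))"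
  unfolding case_prod_beta
proof (intro continuous_on_divide continuous_intros ballI)
  show "continuous_on X (\<lambda>x. G h \<sigma> (snd x))"
    by (rule continuous_on_compose2[OF G_cont[OF h \<sigma>, of UNIV]]) (auto intro: continuous_intros)
  show "Complex (snd x) \<sigma> - complex_of_real (fst x) \<noteq> 0" for x by (rule Cw(1)[OF \<sigma>(1)])
qed

private lemma sinc_line_cont:
  assumes h: "0 < h" and \<sigma>: "0 < \<bar>\<sigma>\<bar>" "\<bar>\<sigma>\<bar> < d"
  shows "continuous_on A (sinc_line H h R \<sigma>)"
proof -
  have "continuous_on A (\<lambda>y. integral (cbox (- R) R) (\<lambda>s. G h \<sigma> s / (Complex s \<sigma> - complex_of_real y)))"
    by (rule integral_continuous_on_param[OF cont2[OF h \<sigma>]])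
  then show ?thesis by (simp only: sinc_line_eq[abs_def] box_real)
qed

text \<open>The order of integration is exchanged so that the oscillating sine is integrated against
  the bare kernel 1 / (w - y), which gains a factor h. A pointwise bound for
  \<open>sinc_line\<close> would lose it and would grow with the length of the interval.\<close>

private lemma sinc_line_integral_bound:
  assumes h: "0 < h" and \<sigma>: "0 < \<bar>\<sigma>\<bar>" "\<bar>\<sigma>\<bar> < d" and R: "0 \<le> R" and y: "y0 \<le> y1"
  shows "cmod (integral {y0..y1} (\<lambda>y. of_real (sin (pi / h * y)) * sinc_line H h R \<sigma> y))
    \<le> B * (2 / \<mu>) / sinh (pi * \<bar>\<sigma>\<bar> / h) * (h * (2 + pi) / (pi * \<bar>\<sigma>\<bar>)) * pi"
proof -
  let ?k = "\<lambda>y s. complex_of_real (sin (pi / h * y)) / (Complex s \<sigma> - of_real y)"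
  let ?f = "\<lambda>y s. complex_of_real (sin (pi / h * y)) * (G h \<sigma> s / (Complex s \<sigma> - of_real y))"
  have cf: "continuous_on X (\<lambda>(y, s). ?f y s)" for X
  proof -
    have "continuous_on X (\<lambda>p. complex_of_real (sin (pi / h * fst p)) * (case p of (y, s) \<Rightarrow> G h \<sigma> s / (Complex s \<sigma> - complex_of_real y)))"
      by (intro continuous_on_mult cont2[OF h \<sigma>] continuous_intros) (use h in auto)
    then show ?thesis by (simp add: case_prod_beta)
  qed
  have "integral {y0..y1} (\<lambda>y. of_real (sin (pi / h * y)) * sinc_line H h R \<sigma> y) = integral {y0..y1} (\<lambda>y. integral {- R..R} (?f y))"
    by (simp only: sinc_line_eq integral_mult_right)
  also have "\<dots> = integral {- R..R} (\<lambda>s. integral {y0..y1} (\<lambda>y. ?f y s))"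
    using integral_swap_continuous[OF cf[of "cbox (y0, - R) (y1, R)"]] by (simp only: box_real)
  also have "\<dots> = integral {- R..R} (\<lambda>s. G h \<sigma> s * integral {y0..y1} (\<lambda>y. ?k y s))"
    by (simp only: integral_mult_right[symmetric] times_divide_eq_left times_divide_eq_right mult.commute)
  also have "cmod \<dots> \<le> B * (2 / \<mu>) / sinh (pi * \<bar>\<sigma>\<bar> / h) * (h * (2 + pi) / (pi * \<bar>\<sigma>\<bar>)) * pi"
  proof (rule weight_bound[OF R])
    have kp: "0 \<le> h * (2 + pi) / (pi * \<bar>\<sigma>\<bar>)" using h by simp
    show "0 \<le> B * (2 / \<mu>) / sinh (pi * \<bar>\<sigma>\<bar> / h) * (h * (2 + pi) / (pi * \<bar>\<sigma>\<bar>))"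
      using B \<mu> h kp sinh_pos_quot[OF \<sigma>(1) h] by (intro divide_nonneg_nonneg mult_nonneg_nonneg) auto
    have "continuous_on {- R..R} (\<lambda>s. integral (cbox y0 y1) (\<lambda>y. ?f y s))"
      using cf[of UNIV] by (intro integral_continuous_on_param) (auto simp: case_prod_beta intro!: continuous_on_compose2[OF cf[of UNIV, unfolded case_prod_beta], of _ "\<lambda>x. (snd x, fst x)", simplified] continuous_intros)
    then have "continuous_on {- R..R} (\<lambda>s. integral {y0..y1} (\<lambda>y. ?f y s))" by (simp only: box_real)
    then have "continuous_on {- R..R} (\<lambda>s. G h \<sigma> s * integral {y0..y1} (\<lambda>y. ?k y s))"
      by (simp only: integral_mult_right[symmetric] times_divide_eq_left times_divide_eq_right mult.commute)
    then show "(\<lambda>s. G h \<sigma> s * integral {y0..y1} (\<lambda>y. ?k y s)) integrable_on {- R..R}" by (rule integrable_continuous_real)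
    fix s
    have "cmod (G h \<sigma> s * integral {y0..y1} (\<lambda>y. ?k y s)) \<le> B * (2 / \<mu>) / sinh (pi * \<bar>\<sigma>\<bar> / h) * (1 / (1 + s\<^sup>2)) * (h * (2 + pi) / (pi * \<bar>\<sigma>\<bar>))"
      unfolding norm_mult
    proof (rule mult_mono[OF G_bound[OF h \<sigma>] oscillatory_kernel_bound[OF h _ y]])
      show "0 \<le> B * (2 / \<mu>) / sinh (pi * \<bar>\<sigma>\<bar> / h) * (1 / (1 + s\<^sup>2))" using G_bound[OF h \<sigma>, of s] norm_ge_zero order_trans by blast
    qed (use \<sigma> in auto)
    then show "cmod (G h \<sigma> s * integral {y0..y1} (\<lambda>y. ?k y s)) \<le> B * (2 / \<mu>) / sinh (pi * \<bar>\<sigma>\<bar> / h) * (h * (2 + pi) / (pi * \<bar>\<sigma>\<bar>)) * (1 / (1 + s\<^sup>2))"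
      by (simp only: mult_ac)
  qed
  finally show ?thesis .
qed

private lemma vertical_bound:
  assumes "0 < h" "\<bar>Re w\<bar> = (real M + 1 / 2) * h" "\<bar>Im w\<bar> < d"
  shows "cmod (H w) \<le> B * exp (- \<mu> * cosh (real M * h))"
proof -
  have "cmod (H w) \<le> B * exp (- \<mu> * cosh (Re w))" using HB[of w] assms by (simp add: strip_def)
  also have "\<dots> \<le> B * exp (- \<mu> * cosh (real M * h))"
    using B \<mu> assms by (intro mult_left_mono exp_cosh_mono) auto
  finally show ?thesis .
qed

private lemma node_bound: "0 < d \<Longrightarrow> cmod (H (of_real x)) \<le> B * exp (- \<mu> * cosh x)"
  using HB[of "of_real x"] by (simp add: strip_def)

text \<open>Serves interpolation with K = 1 and quadrature with K = 3. The factor h turns the tail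
  into a Riemann sum, so that the bound stays finite as h tends to 0.\<close>

private lemma tail_bound:
  assumes "0 < d" "0 < h" "h \<le> 1" "N \<le> M" "\<And>j. cmod (S j) \<le> K" "0 \<le> K"
  shows "cmod (h * ((\<Sum>j = - int M..int M. H (of_real (of_int j * h)) * S j) - (\<Sum>j = - int N..int N. H (of_real (of_int j * h)) * S j)))
     \<le> K * B * ((4 / \<mu>) * exp (- (\<mu> / 2) * cosh (real N * h)) * (1 + pi))"
proof -
  let ?F = "{- int M..int M} - {- int N..int N}"
  have "(\<Sum>j = - int M..int M. H (of_real (of_int j * h)) * S j) - (\<Sum>j = - int N..int N. H (of_real (of_int j * h)) * S j)
     = (\<Sum>j\<in>?F. H (of_real (of_int j * h)) * S j)"
    using assms(4) by (subst sum_diff) auto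
  also have "cmod \<dots> \<le> (\<Sum>j\<in>?F. B * exp (- \<mu> * cosh (of_int j * h)) * K)"
    by (intro sum_norm_le) (simp only: norm_mult, intro mult_mono node_bound[OF assms(1)] assms(5) norm_ge_zero mult_nonneg_nonneg B exp_ge_zero)
  also have "\<dots> = K * B * (\<Sum>j\<in>?F. exp (- \<mu> * cosh (of_int j * h)))"
    by (simp add: sum_distrib_left mult_ac)
  finally have "h * cmod ((\<Sum>j = - int M..int M. H (of_real (of_int j * h)) * S j) - (\<Sum>j = - int N..int N. H (of_real (of_int j * h)) * S j))
     \<le> h * (K * B * (\<Sum>j\<in>?F. exp (- \<mu> * cosh (of_int j * h))))"
    using assms by (intro mult_left_mono) auto
  also have "\<dots> = K * B * (h * (\<Sum>j\<in>?F. exp (- \<mu> * cosh (of_int j * h))))" by (simp only: mult_ac)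
  also have "\<dots> \<le> K * B * ((4 / \<mu>) * exp (- (\<mu> / 2) * cosh (real N * h)) * (h + pi))"
    by (intro mult_left_mono sum_exp_cosh_tail_le) (use assms \<mu> B in auto)
  also have "\<dots> \<le> K * B * ((4 / \<mu>) * exp (- (\<mu> / 2) * cosh (real N * h)) * (1 + pi))"
    by (intro mult_left_mono) (use assms \<mu> B in auto)
  finally show ?thesis using assms by (simp add: norm_mult)
qed

lemma sinc_interpolation_error:
  assumes d: "0 < d" and h: "0 < h" "h \<le> 1"
  shows "cmod (H (of_real x) - (\<Sum>j = - int N..int N. H (of_real (of_int j * h)) * of_real (sinc_basis j h x)))
    \<le> B * (2 / (\<mu> * d * sinh (pi * d / h)) + (4 * d / pi + 4 / \<mu> * (1 + pi)) / h * exp (- (\<mu> / 2) * cosh (real N * h)))"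
    (is "?L \<le> _")
proof -
  let ?E = "exp (- (\<mu> / 2) * cosh (real N * h))"
  define T where "T M = (\<Sum>j = - int M..int M. H (of_real (of_int j * h)) * of_real (sinc_basis j h x))" for M
  have *: "?L \<le> B * (2 / (\<mu> * c * sinh (pi * c / h)) + (4 * d / pi + 4 / \<mu> * (1 + pi)) / h * ?E)"
    if c: "0 < c" "c < d" for c
  proof -
    \<comment> \<open>At least N and large enough for x to lie in the range of the nodes. No limit
      in M has to be taken: up to constants the vertical sides are already dominated by the
      truncation term \<open>?E\<close>.\<close>
    define M where "M = max N (nat \<lceil>\<bar>x\<bar> / h\<rceil>)"
    have "\<bar>x\<bar> / h \<le> real M" unfolding M_def using real_nat_ceiling_ge[of "\<bar>x\<bar> / h"]
      by (rule order_trans) simp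
    then have xM: "\<bar>x\<bar> \<le> real M * h" using h by (simp add: field_simps)
    define R where "R = (real M + 1 / 2) * h"
    have R: "0 \<le> R" using h by (simp add: R_def)
    define Q where "Q = of_real (sin (pi / h * x)) / (2 * of_real pi * \<i>) * (sinc_line H h R (- c) x - sinc_line H h R c x)"
    have Qb: "cmod Q \<le> B * (2 / (\<mu> * c * sinh (pi * c / h)))"
    proof -
      have 1: "cmod (sinc_line H h R (- c) x - sinc_line H h R c x) \<le> 2 * (B * (2 / \<mu>) / sinh (pi * c / h) / c * pi)"
        using norm_triangle_ineq4[of "sinc_line H h R (- c) x" "sinc_line H h R c x"]
          sinc_line_bound[OF h(1) _ _ R, of "- c" x] sinc_line_bound[OF h(1) _ _ R, of c x] c by simp
      have "cmod Q = \<bar>sin (pi / h * x)\<bar> / (2 * pi) * cmod (sinc_line H h R (- c) x - sinc_line H h R c x)"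
        unfolding Q_def by (simp add: norm_mult norm_divide)
      also have "\<dots> \<le> 1 / (2 * pi) * (2 * (B * (2 / \<mu>) / sinh (pi * c / h) / c * pi))"
        by (intro mult_mono divide_right_mono 1) auto
      finally show ?thesis by (simp add: mult_ac)
    qed
    have EM: "exp (- \<mu> * cosh (real M * h)) \<le> ?E"
    proof -
      have "exp (- \<mu> * cosh (real M * h)) \<le> exp (- (\<mu> / 2) * cosh (real M * h))"
        using \<mu> cosh_real_pos[of "real M * h"] by simp
      also have "\<dots> \<le> ?E" using \<mu> h by (intro exp_cosh_mono) (auto simp: M_def intro!: mult_right_mono)
      finally show ?thesis .
    qed
    have "cmod (H (of_real x) - T M - Q) \<le> 4 * c * (B * exp (- \<mu> * cosh (real M * h))) / (pi * h)"
      unfolding T_def Q_def R_def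
      by (rule sinc_interpolation_split[OF hol h(1) c xM vertical_bound]) (use c h B in auto)
    also have "\<dots> \<le> 4 * d * (B * ?E) / (pi * h)"
      using c h B EM by (intro divide_right_mono mult_mono mult_left_mono) auto
    finally have 1: "cmod (H (of_real x) - T M - Q) \<le> B * (4 * d / pi / h * ?E)" by (simp add: mult_ac)
    have "cmod (h * (T M - T N)) \<le> 1 * B * ((4 / \<mu>) * ?E * (1 + pi))"
      unfolding T_def
      by (rule tail_bound[OF d h]) (simp_all only: M_def max.cobounded1 sinc_basis_def norm_of_real sinc_le_1 zero_le_one)
    then have "h * cmod (T M - T N) \<le> B * ((4 / \<mu>) * ?E * (1 + pi))"
      using h by (simp only: norm_mult norm_of_real abs_of_pos mult_1_left)
    then have "cmod (T M - T N) \<le> B * ((4 / \<mu>) * ?E * (1 + pi)) / h"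
      using h by (subst pos_le_divide_eq) (simp_all only: mult.commute)
    then have 2: "cmod (T M - T N) \<le> B * (4 / \<mu> * (1 + pi) / h * ?E)"
      by (simp only: times_divide_eq_left times_divide_eq_right mult_ac)
    have "?L = cmod ((H (of_real x) - T M - Q) + Q + (T M - T N))" by (simp add: T_def)
    also have "\<dots> \<le> B * (4 * d / pi / h * ?E) + B * (2 / (\<mu> * c * sinh (pi * c / h))) + B * (4 / \<mu> * (1 + pi) / h * ?E)"
      by (intro order_trans[OF norm_triangle_ineq] add_mono 1 2 Qb)
    also have "\<dots> = B * (2 / (\<mu> * c * sinh (pi * c / h)) + (4 * d / pi + 4 / \<mu> * (1 + pi)) / h * ?E)"
      by (simp only: ring_distribs add_divide_distrib ac_simps)
    finally show ?thesis .
  qed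
  have "isCont (\<lambda>c. B * (2 / (\<mu> * c * sinh (pi * c / h)) + (4 * d / pi + 4 / \<mu> * (1 + pi)) / h * ?E)) d"
    using d \<mu> h by (intro continuous_intros) auto
  from le_at_left_limit[OF * this d] show ?thesis .
qed

private lemma integral_sinc_basis:
  assumes "0 < h" "y0 \<le> y1"
  shows "((\<lambda>y. sinc_basis j h y) has_integral h / pi * (Si (pi * (y1 - of_int j * h) / h) - Si (pi * (y0 - of_int j * h) / h))) {y0..y1}"
proof -
  have "((\<lambda>y. h / pi * Si (pi * (y - of_int j * h) / h)) has_real_derivative sinc_basis j h y) (at y within {y0..y1})" for y
  proof -
    have "((\<lambda>y. pi * (y - of_int j * h) / h) has_real_derivative pi * (1 - 0) / h) (at y within {y0..y1})"
      by (intro DERIV_cdivide DERIV_cmult DERIV_diff DERIV_ident DERIV_const)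
    then have "((\<lambda>y. h / pi * Si (pi * (y - of_int j * h) / h)) has_real_derivative h / pi * (sinc (pi * (y - of_int j * h) / h) * (pi * (1 - 0) / h))) (at y within {y0..y1})"
      by (intro DERIV_cmult DERIV_chain2[OF DERIV_Si])
    moreover have "h / pi * (t * (pi * (1 - 0) / h)) = t" for t using assms(1) by auto
    ultimately show ?thesis unfolding sinc_basis_def by (simp only:)
  qed
  then have "((\<lambda>y. sinc_basis j h y) has_integral h / pi * Si (pi * (y1 - of_int j * h) / h) - h / pi * Si (pi * (y0 - of_int j * h) / h)) {y0..y1}"
    by (intro fundamental_theorem_of_calculus[OF assms(2)]) (simp only: has_real_derivative_iff_has_vector_derivative[symmetric])
  then show ?thesis by (simp only: right_diff_distrib)
qed

text \<open>This is where the weights come from: (h / pi) Si is a primitive of the basis function,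
  up to scaling its argument, and the summand 1/2 in \<open>delta_minus1\<close> cancels in the
  difference. It normalises the weights so that the one for the lower node disappears as l tends to
  -infinity.\<close>

private lemma integral_sinc_basis_nodes:
  assumes "0 < h" "l \<le> i"
  shows "((\<lambda>y. complex_of_real (sinc_basis j h y)) has_integral of_real (h * (delta_minus1 (i - j) - delta_minus1 (l - j)))) {of_int l * h..of_int i * h}"
proof -
  have e: "pi * (of_int i * h - of_int j * h) / h = pi * of_int (i - j)" for i using assms(1) by (simp add: field_simps)
  have le: "of_int l * h \<le> of_int i * h" using assms by (intro mult_right_mono) auto
  have "h / pi * (Si (pi * of_int (i - j)) - Si (pi * of_int (l - j))) = h * (delta_minus1 (i - j) - delta_minus1 (l - j))"
    by (simp only: delta_minus1_def) (simp add: field_simps del: of_int_diff)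
  then have "((\<lambda>y. sinc_basis j h y) has_integral h * (delta_minus1 (i - j) - delta_minus1 (l - j))) {of_int l * h..of_int i * h}"
    using integral_sinc_basis[OF assms(1) le, of j] unfolding e by (simp only:)
  then show ?thesis by (rule has_integral_of_real)
qed

text \<open>The split interpolation formula integrated from the node -M h to the node i h. The
  vertical sides are integrated over a length of at most 2 M h, whence the factor M in the last
  term. The finite left end leaves \<open>P (- real M * h)\<close> and the weights
  \<open>delta_minus1 (- int M - j)\<close>, whose contributions vanish in the limit of large
  M.\<close>

private lemma quadrature_finite:
  fixes P :: "real \<Rightarrow> complex"
  assumes h: "0 < h" "h \<le> 1" and c: "0 < c" "c < d"
    and P: "\<And>x. (P has_vector_derivative H (of_real x)) (at x)" and i: "\<bar>i\<bar> \<le> int M"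
  defines "R \<equiv> (real M + 1 / 2) * h"
  shows "cmod ((P (of_int i * h) - P (- real M * h)) - h * (\<Sum>j = - int M..int M. H (of_real (of_int j * h)) * of_real (delta_minus1 (i - j) - delta_minus1 (- int M - j))))
    \<le> B * (2 * h * (2 + pi) / (\<mu> * pi * c * sinh (pi * c / h))) + 8 * d / pi * (real M * (B * exp (- \<mu> * cosh (real M * h))))"
proof -
  let ?y0 = "of_int (- int M) * h" and ?y1 = "of_int i * h"
  let ?V = "4 * c * (B * exp (- \<mu> * cosh (real M * h))) / (pi * h)"
  have R: "0 \<le> R" using h by (simp add: R_def)
  have y01: "?y0 \<le> ?y1" using h i by (intro mult_right_mono) auto
  \<comment> \<open>\<open>L\<close> is the contribution of the horizontal sides, estimated after
    integration to exploit the oscillation; \<open>D\<close> collects the vertical sides and is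
    estimated pointwise.\<close>
  define L where "L y = of_real (sin (pi / h * y)) * sinc_line H h R (- c) y - of_real (sin (pi / h * y)) * sinc_line H h R c y" for y
  define D where "D y = H (of_real y) - (\<Sum>j = - int M..int M. H (of_real (of_int j * h)) * of_real (sinc_basis j h y)) - 1 / (2 * of_real pi * \<i>) * L y" for y
  have Db: "cmod (D y) \<le> ?V" if y: "y \<in> {?y0..?y1}" for y
  proof -
    have "of_int i * h \<le> real M * h" using i h by (intro mult_right_mono) auto
    then have yM: "\<bar>y\<bar> \<le> real M * h" using y by auto
    have "D y = H (of_real y) - (\<Sum>j = - int M..int M. H (of_real (of_int j * h)) * of_real (sinc_basis j h y))
      - of_real (sin (pi / h * y)) / (2 * of_real pi * \<i>) * (sinc_line H h R (- c) y - sinc_line H h R c y)"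
      unfolding D_def L_def by (simp add: right_diff_distrib diff_divide_distrib)
    then show ?thesis unfolding R_def
      using sinc_interpolation_split[OF hol h(1) c yM vertical_bound] c h B by simp
  qed
  have i1: "((\<lambda>y. H (of_real y)) has_integral P ?y1 - P ?y0) {?y0..?y1}"
    by (intro fundamental_theorem_of_calculus y01 has_vector_derivative_at_within[OF P])
  have i2: "((\<lambda>y. \<Sum>j = - int M..int M. H (of_real (of_int j * h)) * of_real (sinc_basis j h y)) has_integral
     (\<Sum>j = - int M..int M. H (of_real (of_int j * h)) * of_real (h * (delta_minus1 (i - j) - delta_minus1 (- int M - j))))) {?y0..?y1}"
    by (intro has_integral_sum has_integral_mult_right integral_sinc_basis_nodes h) (use i in auto)
  have cs: "0 < \<bar>c\<bar>" "\<bar>c\<bar> < d" "0 < \<bar>- c\<bar>" "\<bar>- c\<bar> < d" using c by auto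
  have int: "(\<lambda>y. of_real (sin (pi / h * y)) * sinc_line H h R \<sigma> y) integrable_on {?y0..?y1}" if "0 < \<bar>\<sigma>\<bar>" "\<bar>\<sigma>\<bar> < d" for \<sigma>
    by (intro integrable_continuous_real continuous_on_mult sinc_line_cont h that continuous_intros) (use h in auto)
  have i3: "(L has_integral integral {?y0..?y1} L) {?y0..?y1}" unfolding L_def
    by (intro integrable_integral integrable_diff int cs)
  have Lb: "cmod (integral {?y0..?y1} L) \<le> 2 * (B * (2 / \<mu>) / sinh (pi * c / h) * (h * (2 + pi) / (pi * c)) * pi)"
  proof -
    have "integral {?y0..?y1} L = integral {?y0..?y1} (\<lambda>y. of_real (sin (pi / h * y)) * sinc_line H h R (- c) y) - integral {?y0..?y1} (\<lambda>y. of_real (sin (pi / h * y)) * sinc_line H h R c y)"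
      unfolding L_def by (intro integral_diff int cs)
    then show ?thesis
      using norm_triangle_ineq4[of "integral {?y0..?y1} (\<lambda>y. of_real (sin (pi / h * y)) * sinc_line H h R (- c) y)" "integral {?y0..?y1} (\<lambda>y. of_real (sin (pi / h * y)) * sinc_line H h R c y)"]
       sinc_line_integral_bound[OF h(1) cs(1,2) R y01] sinc_line_integral_bound[OF h(1) cs(3,4) R y01] c(1)
      by (simp only: abs_minus_cancel abs_of_pos mult_2)
  qed
  define S where "S = (\<Sum>j = - int M..int M. H (of_real (of_int j * h)) * of_real (delta_minus1 (i - j) - delta_minus1 (- int M - j)))"
  have S: "(\<Sum>j = - int M..int M. H (of_real (of_int j * h)) * of_real (h * (delta_minus1 (i - j) - delta_minus1 (- int M - j)))) = of_real h * S"
    unfolding S_def sum_distrib_left by (intro sum.cong refl) (simp only: of_real_mult mult_ac)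
  have "(D has_integral (P ?y1 - P ?y0) - of_real h * S - 1 / (2 * of_real pi * \<i>) * integral {?y0..?y1} L) {?y0..?y1}"
    unfolding D_def[abs_def] by (rule has_integral_diff[OF has_integral_diff[OF i1 i2[unfolded S]] has_integral_mult_right[OF i3]])
  then have "cmod ((P ?y1 - P ?y0) - h * S - 1 / (2 * of_real pi * \<i>) * integral {?y0..?y1} L) \<le> ?V * Henstock_Kurzweil_Integration.content (cbox ?y0 ?y1)"
    using Db c h B unfolding box_real(2)[symmetric] by (intro has_integral_bound[of ?V D]) auto
  also have "Henstock_Kurzweil_Integration.content (cbox ?y0 ?y1) = ?y1 - ?y0" using y01 by simp
  also have "?V * (?y1 - ?y0) \<le> ?V * (2 * real M * h)"
  proof (intro mult_left_mono)
    have "of_int i * h \<le> real M * h" using i h by (intro mult_right_mono) auto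
    then show "?y1 - ?y0 \<le> 2 * real M * h" by (simp add: mult.commute[of h])
  qed (use c h B in auto)
  also have "\<dots> = 8 * c / pi * (real M * (B * exp (- \<mu> * cosh (real M * h))))"
    using h by auto
  also have "\<dots> \<le> 8 * d / pi * (real M * (B * exp (- \<mu> * cosh (real M * h))))"
    using c B by (intro mult_right_mono divide_right_mono) auto
  finally have 1: "cmod ((P ?y1 - P ?y0) - h * S - 1 / (2 * of_real pi * \<i>) * integral {?y0..?y1} L) \<le> 8 * d / pi * (real M * (B * exp (- \<mu> * cosh (real M * h))))" .
  have "cmod (1 / (2 * of_real pi * \<i>) * integral {?y0..?y1} L) = 1 / (2 * pi) * cmod (integral {?y0..?y1} L)"
    by (simp add: norm_mult norm_divide)
  also have "\<dots> \<le> 1 / (2 * pi) * (2 * (B * (2 / \<mu>) / sinh (pi * c / h) * (h * (2 + pi) / (pi * c)) * pi))"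
    by (intro mult_left_mono Lb) auto
  also have "\<dots> = B * (2 * h * (2 + pi) / (\<mu> * pi * c * sinh (pi * c / h)))"
  proof -
    have "1 / (2 * p) * (2 * (B * (2 / m) / s * (h * t / (p * c)) * p)) = B * (2 * h * t / (m * p * c * s))" if "p \<noteq> 0" for p m s t :: real
      using that by (simp add: mult_ac)
    then show ?thesis using pi_neq_zero by blast
  qed
  finally have 2: "cmod (1 / (2 * of_real pi * \<i>) * integral {?y0..?y1} L) \<le> B * (2 * h * (2 + pi) / (\<mu> * pi * c * sinh (pi * c / h)))" .
  have "cmod ((P ?y1 - P ?y0) - h * S) \<le> B * (2 * h * (2 + pi) / (\<mu> * pi * c * sinh (pi * c / h))) + 8 * d / pi * (real M * (B * exp (- \<mu> * cosh (real M * h))))"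
    using norm_triangle_ineq[of "1 / (2 * of_real pi * \<i>) * integral {?y0..?y1} L" "(P ?y1 - P ?y0) - h * S - 1 / (2 * of_real pi * \<i>) * integral {?y0..?y1} L"] 1 2
    by (simp only: add_diff_cancel_left' diff_add_cancel add.commute[of "1 / (2 * of_real pi * \<i>) * integral {?y0..?y1} L"])
  moreover have "?y0 = - real M * h" by simp
  ultimately show ?thesis unfolding S_def by (simp only:)
qed

text \<open>The weight decays only like 1 / (1 + M + j) and is not small for j near -M, but there
  \<open>H\<close> is. The inequality 1 + M \<le> (1 + M + j) (1 + |j|) converts it into 1 / (1 +
  M), at the price of a factor 1 + |j| that the decay of \<open>H\<close> absorbs.\<close>

private lemma left_end_sum_tendsto:
  assumes d: "0 < d" and h: "0 < h"
  shows "(\<lambda>M. \<Sum>j = - int M..int M. H (of_real (of_int j * h)) * of_real (delta_minus1 (- int M - j))) \<longlonglongrightarrow> 0"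
proof -
  define K where "K = B * (4 / \<mu>)\<^sup>2 * (4 * (1 + 1 / h)) * ((h + pi) / h)"
  have "norm (\<Sum>j = - int M..int M. H (of_real (of_int j * h)) * of_real (delta_minus1 (- int M - j))) \<le> K * (1 / (1 + real M))" for M
  proof -
    have "cmod (H (of_real (of_int j * h)) * of_real (delta_minus1 (- int M - j))) \<le>
       B * (4 / \<mu>)\<^sup>2 * (4 * (1 + 1 / h)) * (1 / (1 + real M)) / h * (h / (1 + (of_int j * h)\<^sup>2))" if j: "j \<in> {- int M..int M}" for j
    proof -
      define t where "t = of_int j * h"
      have dm: "\<bar>delta_minus1 (- int M - j)\<bar> \<le> 2 / (1 + (real M + of_int j))"
      proof -
        have "\<not> 0 < - int M - j" "\<bar>real_of_int (- int M - j)\<bar> = real M + of_int j" using j by auto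
        then show ?thesis using delta_minus1_bound[of "- int M - j"] by (simp only: if_False diff_zero)
      qed
      have jM: "0 \<le> real M + of_int j" using j by auto
      have "1 + real M \<le> (1 + (real M + of_int j)) * (1 + \<bar>of_int j\<bar>)"
      proof -
        have "0 \<le> (real M + of_int j) * \<bar>of_int j\<bar>" using jM by (intro mult_nonneg_nonneg) auto
        moreover have "(1 + (real M + of_int j)) * (1 + \<bar>of_int j\<bar>) = 1 + real M + (of_int j + \<bar>of_int j\<bar>) + (real M + of_int j) * \<bar>of_int j\<bar>"
          by (simp only: ring_distribs mult_1_left mult_1_right ac_simps)
        moreover have "0 \<le> real_of_int j + \<bar>of_int j\<bar>" by simp
        ultimately show ?thesis by linarith
      qed
      then have "2 / (1 + (real M + of_int j)) \<le> 2 * (1 + \<bar>of_int j\<bar>) / (1 + real M)"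
      proof -
        assume a: "1 + real M \<le> (1 + (real M + of_int j)) * (1 + \<bar>of_int j\<bar>)"
        have "2 * (1 + real M) \<le> 2 * (1 + \<bar>of_int j\<bar>) * (1 + (real M + of_int j))"
          using mult_left_mono[OF a, of 2] by (simp only: mult_ac)
        then show ?thesis using jM by (intro mult_imp_div_pos_le mult_imp_le_div_pos) (simp_all add: mult_ac frac_le_eq divide_le_eq)
      qed
      also have "1 + \<bar>real_of_int j\<bar> \<le> (1 + 1 / h) * (2 * (1 + t\<^sup>2))"
      proof -
        have jt: "\<bar>real_of_int j\<bar> = \<bar>t\<bar> / h" unfolding t_def using h by (simp add: abs_mult)
        have "\<bar>t\<bar> \<le> 2 * (1 + t\<^sup>2)" "1 \<le> 2 * (1 + t\<^sup>2)"
        proof -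
          have "0 \<le> (\<bar>t\<bar> - 1)\<^sup>2" by simp
          then show "\<bar>t\<bar> \<le> 2 * (1 + t\<^sup>2)" by (simp add: power2_diff) 
          show "1 \<le> 2 * (1 + t\<^sup>2)" by simp
        qed
        then have "1 + \<bar>t\<bar> / h \<le> 2 * (1 + t\<^sup>2) + 2 * (1 + t\<^sup>2) / h" using h by (intro add_mono divide_right_mono) auto
        then show ?thesis unfolding jt by (simp add: distrib_right)
      qed
      finally have d2: "\<bar>delta_minus1 (- int M - j)\<bar> \<le> 2 * ((1 + 1 / h) * (2 * (1 + t\<^sup>2))) / (1 + real M)"
        using dm by (simp add: divide_right_mono)
      have t0: "0 < 1 + t\<^sup>2" by (simp add: add_pos_nonneg)
      \<comment> \<open>Two copies of the weight 1 / (1 + t^2): one absorbs the factor 1 + |j|, the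
        other keeps the sum bounded.\<close>
      have "exp (- \<mu> * cosh t) = exp (- (\<mu> / 2) * cosh t) * exp (- (\<mu> / 2) * cosh t)" by (simp flip: exp_add)
      also have "\<dots> \<le> ((2 / (\<mu> / 2)) / (1 + t\<^sup>2)) * ((2 / (\<mu> / 2)) / (1 + t\<^sup>2))"
        using \<mu> t0 by (intro mult_mono exp_cosh_le) auto
      also have "\<dots> = (4 / \<mu>)\<^sup>2 / (1 + t\<^sup>2) / (1 + t\<^sup>2)" by (simp add: power2_eq_square)
      finally have "B * exp (- \<mu> * cosh t) \<le> B * ((4 / \<mu>)\<^sup>2 / (1 + t\<^sup>2) / (1 + t\<^sup>2))" by (intro mult_left_mono B)
      then have "cmod (H (of_real t)) \<le> B * ((4 / \<mu>)\<^sup>2 / (1 + t\<^sup>2) / (1 + t\<^sup>2))" using node_bound[OF d, of t] by linarith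
      then have "cmod (H (of_real t) * of_real (delta_minus1 (- int M - j))) \<le>
         B * ((4 / \<mu>)\<^sup>2 / (1 + t\<^sup>2) / (1 + t\<^sup>2)) * (2 * ((1 + 1 / h) * (2 * (1 + t\<^sup>2))) / (1 + real M))"
        unfolding norm_mult norm_of_real using B t0 by (intro mult_mono d2) auto
      also have "\<dots> = B * (4 / \<mu>)\<^sup>2 * (4 * (1 + 1 / h)) * (1 / (1 + real M)) / h * (h / (1 + t\<^sup>2))"
      proof -
        have "B * (m / w / w) * (2 * (q * (2 * w)) / r) = B * m * (4 * q) * (1 / r) / h * (h / w)" if "w \<noteq> 0" for m w q r :: real
          using that h by (simp add: mult_ac)
        then show ?thesis using t0 by (metis less_irrefl)
      qed
      finally show ?thesis unfolding t_def .
    qed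
    then have "norm (\<Sum>j = - int M..int M. H (of_real (of_int j * h)) * of_real (delta_minus1 (- int M - j))) \<le>
      (\<Sum>j = - int M..int M. B * (4 / \<mu>)\<^sup>2 * (4 * (1 + 1 / h)) * (1 / (1 + real M)) / h * (h / (1 + (of_int j * h)\<^sup>2)))"
      by (intro sum_norm_le)
    also have "\<dots> = B * (4 / \<mu>)\<^sup>2 * (4 * (1 + 1 / h)) * (1 / (1 + real M)) / h * (\<Sum>j = - int M..int M. (h / (1 + (of_int j * h)\<^sup>2)))"
      by (rule sum_distrib_left[symmetric])
    also have "\<dots> \<le> B * (4 / \<mu>)\<^sup>2 * (4 * (1 + 1 / h)) * (1 / (1 + real M)) / h * (h + pi)"
      using B h by (intro mult_left_mono sum_inverse_square_le) auto
    finally show ?thesis by (simp add: K_def mult_ac)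
  qed
  moreover have "(\<lambda>M. K * (1 / (1 + real M))) \<longlonglongrightarrow> 0" by real_asymp
  ultimately show ?thesis by (rule Lim_null_comparison[OF always_eventually[OF allI]])
qed

text \<open>The two conditions on \<open>P\<close> say that it is the integral of \<open>H\<close>
  from -infinity. The contour bound is taken to the limit in M with N fixed, and afterwards c tends
  to d.\<close>

lemma sinc_quadrature_error:
  fixes P :: "real \<Rightarrow> complex"
  assumes d: "0 < d" and h: "0 < h" "h \<le> 1"
    and P: "\<And>x. (P has_vector_derivative H (of_real x)) (at x)" "(P \<longlongrightarrow> 0) at_bot" and i: "\<bar>i\<bar> \<le> int N"
  shows "cmod (P (of_int i * h) - h * (\<Sum>j = - int N..int N. H (of_real (of_int j * h)) * of_real (delta_minus1 (i - j))))
    \<le> B * (2 * h * (2 + pi) / (\<mu> * pi * d * sinh (pi * d / h)) + 12 / \<mu> * (1 + pi) * exp (- (\<mu> / 2) * cosh (real N * h)))"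
    (is "?L \<le> _")
proof -
  let ?E = "exp (- (\<mu> / 2) * cosh (real N * h))"
  define T where "T M = (\<Sum>j = - int M..int M. H (of_real (of_int j * h)) * of_real (delta_minus1 (i - j)))" for M
  define T' where "T' M = (\<Sum>j = - int M..int M. H (of_real (of_int j * h)) * of_real (delta_minus1 (- int M - j)))" for M
  have *: "?L \<le> B * (2 * h * (2 + pi) / (\<mu> * pi * c * sinh (pi * c / h)) + 12 / \<mu> * (1 + pi) * ?E)"
    if c: "0 < c" "c < d" for c
  proof -
    let ?X = "B * (2 * h * (2 + pi) / (\<mu> * pi * c * sinh (pi * c / h)))" and ?Y = "B * (12 / \<mu> * (1 + pi) * ?E)"
    let ?r = "\<lambda>M. 8 * d / pi * (B * (real M * exp (- \<mu> * cosh (real M * h)))) + cmod (P (- real M * h)) + h * cmod (T' M)"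
    have "?L \<le> ?X + ?Y + ?r M" if M: "N \<le> M" for M
    proof -
      \<comment> \<open>At most 1 from the step function plus 2 from the deviation; this crude 3
        turns the tail constant 4 / \<mu> into 12 / \<mu>.\<close>
      have d3: "\<bar>delta_minus1 m\<bar> \<le> 3" for m
      proof -
        have "2 / (1 + \<bar>real_of_int m\<bar>) \<le> 2" by (simp add: divide_le_eq)
        then show ?thesis using delta_minus1_bound[of m] by (auto split: if_splits)
      qed
      have "cmod (h * (T M - T N)) \<le> 3 * B * ((4 / \<mu>) * ?E * (1 + pi))"
        unfolding T_def by (rule tail_bound[OF d h M]) (simp_all only: norm_of_real d3 zero_le_numeral)
      moreover have "3 * B * ((4 / \<mu>) * ?E * (1 + pi)) = ?Y" by simp
      ultimately have 1: "cmod (h * (T M - T N)) \<le> ?Y" by (simp only:)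
      have "cmod ((P (of_int i * h) - P (- real M * h)) - h * (T M - T' M)) \<le> ?X + 8 * d / pi * (B * (real M * exp (- \<mu> * cosh (real M * h))))"
        using quadrature_finite[OF h c P(1), of i M] i M
        by (simp only: T_def T'_def sum_subtractf[symmetric] right_diff_distrib[symmetric] of_real_diff mult.left_commute[of "real M"])
      moreover have "P (of_int i * h) - h * T N = ((P (of_int i * h) - P (- real M * h)) - h * (T M - T' M)) + h * (T M - T N) + P (- real M * h) - h * T' M"
        by (simp add: algebra_simps)
      ultimately have "cmod (P (of_int i * h) - h * T N) \<le> (?X + 8 * d / pi * (B * (real M * exp (- \<mu> * cosh (real M * h))))) + ?Y + cmod (P (- real M * h)) + cmod (h * T' M)"
        using 1 by (smt (verit) norm_triangle_ineq norm_triangle_ineq4)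
      then show ?thesis using h by (simp add: T_def norm_mult)
    qed
    then have ev: "\<forall>\<^sub>F M in sequentially. ?L \<le> ?X + ?Y + ?r M" using eventually_ge_at_top by (rule eventually_mono[rotated])
    have "(\<lambda>M. real M * exp (- \<mu> * cosh (real M * h))) \<longlonglongrightarrow> 0"
    proof (rule Lim_null_comparison[OF always_eventually[OF allI]])
      fix M
      have "real M * exp (- \<mu> * cosh (real M * h)) \<le> real M * ((2 / \<mu>) / (1 + (real M * h)\<^sup>2))"
        by (intro mult_left_mono exp_cosh_le \<mu>) auto
      then show "norm (real M * exp (- \<mu> * cosh (real M * h))) \<le> real M * ((2 / \<mu>) / (1 + (real M * h)\<^sup>2))" by simp
      show "(\<lambda>M. real M * ((2 / \<mu>) / (1 + (real M * h)\<^sup>2))) \<longlonglongrightarrow> 0" using h(1) by real_asymp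
    qed
    moreover have "(\<lambda>M. P (- real M * h)) \<longlonglongrightarrow> 0"
    proof (rule filterlim_compose[OF P(2)])
      show "filterlim (\<lambda>M. - real M * h) at_bot sequentially" using h(1) by real_asymp
    qed
    ultimately have "?r \<longlonglongrightarrow> 8 * d / pi * (B * 0) + cmod 0 + h * cmod 0"
      using left_end_sum_tendsto[OF d h(1)] unfolding T'_def[symmetric]
      by (intro tendsto_add tendsto_mult tendsto_const tendsto_norm)
    then have "(\<lambda>M. ?X + ?Y + ?r M) \<longlonglongrightarrow> ?X + ?Y + (8 * d / pi * (B * 0) + cmod 0 + h * cmod 0)"
      by (rule tendsto_add[OF tendsto_const])
    from tendsto_lowerbound[OF this ev] have "?L \<le> ?X + ?Y" by simp
    then show ?thesis by (simp only: distrib_left)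
  qed
  have "isCont (\<lambda>c. B * (2 * h * (2 + pi) / (\<mu> * pi * c * sinh (pi * c / h)) + 12 / \<mu> * (1 + pi) * ?E)) d"
    using d \<mu> h by (intro continuous_intros) auto
  from le_at_left_limit[OF * this d] show ?thesis .
qed

end

section \<open>Volterra equations on a strip\<close>

text \<open>Cauchy's estimate for the second derivative on discs of radius r / 4 around points of
  the half-size disc; 64 is 2! times 2 times 16, the second factor because the estimate asks for
  values in an open ball. The remainder is proportional to M, so a bound that depends on a second
  variable is inherited by it.\<close>

lemma complex_taylor_two:
  fixes f :: "complex \<Rightarrow> complex"
  assumes hol: "f holomorphic_on ball z r" and r: "0 < r" and M: "0 < M"
    and fM: "\<And>w. w \<in> ball z r \<Longrightarrow> cmod (f w) \<le> M" and \<delta>: "cmod \<delta> < r / 2"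
  shows "cmod (f (z + \<delta>) - f z - deriv f z * \<delta>) \<le> 64 * M / r\<^sup>2 * (cmod \<delta>)\<^sup>2"
proof -
  let ?S = "ball z (r / 2)"
  have sub: "?S \<subseteq> ball z r" using r by (intro subset_ball) auto
  have "cmod ((deriv ^^ 0) f (z + \<delta>) - (\<Sum>i\<le>1. (deriv ^^ i) f z * (z + \<delta> - z) ^ i / fact i))
      \<le> (64 * M / r\<^sup>2) * cmod (z + \<delta> - z) ^ Suc 1 / fact 1"
  proof (rule complex_Taylor[where S = ?S])
    show "convex ?S" by simp
    show "z \<in> ?S" "z + \<delta> \<in> ?S" using r \<delta> by (auto simp: dist_norm)
    fix i x assume x: "x \<in> ?S"
    have "((deriv ^^ i) f has_field_derivative deriv ((deriv ^^ i) f) x) (at x)"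
      by (rule holomorphic_derivI[OF holomorphic_higher_deriv[OF hol open_ball] open_ball]) (use x sub in auto)
    then show "((deriv ^^ i) f has_field_derivative (deriv ^^ Suc i) f x) (at x within ?S)"
      by (simp add: has_field_derivative_at_within)
  next
    fix x assume x: "x \<in> ?S"
    have c: "cball x (r / 4) \<subseteq> ball z r"
      using x r by (intro subsetI) (auto simp: dist_norm, smt (verit) norm_triangle_ineq4 dist_norm dist_commute dist_triangle)
    have "cmod ((deriv ^^ 2) f x) \<le> fact 2 * (2 * M) / (r / 4) ^ 2"
    proof (rule Cauchy_higher_deriv_bound[where y = 0])
      show "f holomorphic_on ball x (r / 4)" by (rule holomorphic_on_subset[OF hol]) (use c ball_subset_cball in blast)
      show "continuous_on (cball x (r / 4)) f" by (rule continuous_on_subset[OF holomorphic_on_imp_continuous_on[OF hol] c])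
      fix w assume "w \<in> ball x (r / 4)"
      then have "w \<in> ball z r" using c ball_subset_cball by blast
      from fM[OF this] show "f w \<in> ball 0 (2 * M)" using M by simp
    qed (use r in auto)
    also have "fact 2 * (2 * M) / (r / 4) ^ 2 = 64 * M / r\<^sup>2" by (simp add: power_divide fact_2)
    finally show "cmod ((deriv ^^ Suc 1) f x) \<le> 64 * M / r\<^sup>2" by (simp only: Suc_1)
  qed
  then show ?thesis by (simp add: power2_eq_square algebra_simps)
qed

text \<open>Difference quotients in z are holomorphic in w and converge uniformly on
  \<open>S\<close>, because the Taylor remainder in z is uniform in w.\<close>

lemma deriv_parameter_holomorphic:
  fixes F :: "complex \<Rightarrow> complex \<Rightarrow> complex"
  assumes S: "open S" "z \<in> S"
    and h1: "\<And>w. w \<in> S \<Longrightarrow> (\<lambda>z. F z w) holomorphic_on S" and h2: "\<And>z. z \<in> S \<Longrightarrow> F z holomorphic_on S"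
    and M: "0 < M" "\<And>z w. z \<in> S \<Longrightarrow> w \<in> S \<Longrightarrow> cmod (F z w) \<le> M"
  shows "(\<lambda>w. deriv (\<lambda>z. F z w) z) holomorphic_on S"
proof -
  obtain r where r: "0 < r" "ball z r \<subseteq> S" using S open_contains_ball by blast
  \<comment> \<open>Any null sequence of non-zero increments below r / 2 would do; the largest one
    here is r / 3.\<close>
  define \<delta> where "\<delta> n = complex_of_real (r / (3 * (real n + 1)))" for n
  have n\<delta>: "cmod (\<delta> n) = r / (3 * (real n + 1))" for n using r by (simp add: \<delta>_def norm_divide norm_mult del: of_real_divide of_real_mult)
  have \<delta>2: "cmod (\<delta> n) < r / 2" for n
  proof -
    have "r / (3 * (real n + 1)) \<le> r / 3" using r by (intro divide_left_mono) auto
    then show ?thesis using r n\<delta>[of n] by linarith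
  qed
  have \<delta>0: "\<delta> n \<noteq> 0" for n using n\<delta>[of n] r by auto
  have zS: "z + \<delta> n \<in> S" for n using r \<delta>2[of n] by (intro subsetD[OF r(2)]) (auto simp: dist_norm)
  show ?thesis
  proof (rule holomorphic_uniform_sequence[OF S(1)])
    show "(\<lambda>w. (F (z + \<delta> n) w - F z w) / \<delta> n) holomorphic_on S" for n
      by (intro holomorphic_intros h2 zS S \<delta>0)
    fix x assume "x \<in> S"
    then obtain e where e: "0 < e" "cball x e \<subseteq> S" using S(1) open_contains_cball by blast
    have "uniform_limit S (\<lambda>n w. (F (z + \<delta> n) w - F z w) / \<delta> n) (\<lambda>w. deriv (\<lambda>z. F z w) z) sequentially"
    proof (rule uniform_limitI)
      fix \<epsilon> :: real assume \<epsilon>: "0 < \<epsilon>"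
      have "(\<lambda>n. 64 * M / r\<^sup>2 * (r / (3 * (real n + 1)))) \<longlonglongrightarrow> 0" by real_asymp
      then have "\<forall>\<^sub>F n in sequentially. 64 * M / r\<^sup>2 * (r / (3 * (real n + 1))) < \<epsilon>" using \<epsilon> by (rule order_tendstoD)
      then show "\<forall>\<^sub>F n in sequentially. \<forall>w\<in>S. dist ((F (z + \<delta> n) w - F z w) / \<delta> n) (deriv (\<lambda>z. F z w) z) < \<epsilon>"
      proof (rule eventually_mono, intro ballI)
        fix n w assume n: "64 * M / r\<^sup>2 * (r / (3 * (real n + 1))) < \<epsilon>" and w: "w \<in> S"
        have "cmod (F (z + \<delta> n) w - F z w - deriv (\<lambda>z. F z w) z * \<delta> n) \<le> 64 * M / r\<^sup>2 * (cmod (\<delta> n))\<^sup>2"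
          by (rule complex_taylor_two[OF holomorphic_on_subset[OF h1[OF w] r(2)] r(1) M(1) _ \<delta>2]) (use r M w in auto)
        then have "cmod (F (z + \<delta> n) w - F z w - deriv (\<lambda>z. F z w) z * \<delta> n) / cmod (\<delta> n) \<le> 64 * M / r\<^sup>2 * (cmod (\<delta> n))\<^sup>2 / cmod (\<delta> n)"
          by (rule divide_right_mono) simp
        also have "\<dots> = 64 * M / r\<^sup>2 * cmod (\<delta> n)" using \<delta>0[of n] by (simp add: power2_eq_square)
        finally have "cmod ((F (z + \<delta> n) w - F z w - deriv (\<lambda>z. F z w) z * \<delta> n) / \<delta> n) < \<epsilon>"
          using n by (simp only: norm_divide n\<delta>) 
        then show "dist ((F (z + \<delta> n) w - F z w) / \<delta> n) (deriv (\<lambda>z. F z w) z) < \<epsilon>"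
          using \<delta>0[of n] by (simp add: dist_norm diff_divide_distrib)
      qed
    qed
    then show "\<exists>d>0. cball x d \<subseteq> S \<and> uniform_limit (cball x d) (\<lambda>n w. (F (z + \<delta> n) w - F z w) / \<delta> n) (\<lambda>w. deriv (\<lambda>z. F z w) z) sequentially"
      using e uniform_limit_on_subset by blast
  qed
qed

text \<open>A version of Osgood's lemma: on the diagonal, the increment in the first variable is linear up to a
  quadratic error that is uniform in the second variable, by the Cauchy estimates.\<close>

lemma separately_holomorphic_diagonal:
  fixes F :: "complex \<Rightarrow> complex \<Rightarrow> complex"
  assumes S: "open S"
    and h1: "\<And>w. w \<in> S \<Longrightarrow> (\<lambda>z. F z w) holomorphic_on S" and h2: "\<And>z. z \<in> S \<Longrightarrow> F z holomorphic_on S"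
    and M: "0 < M" "\<And>z w. z \<in> S \<Longrightarrow> w \<in> S \<Longrightarrow> cmod (F z w) \<le> M"
  shows "(\<lambda>z. F z z) holomorphic_on S"
  unfolding holomorphic_on_open[OF S]
proof
  fix z assume z: "z \<in> S"
  obtain r where r: "0 < r" "ball z r \<subseteq> S" using S z open_contains_ball by blast
  define D where "D w = deriv (\<lambda>z. F z w) z" for w
  have "D holomorphic_on S" unfolding D_def[abs_def] by (rule deriv_parameter_holomorphic[OF S z h1 h2 M])
  then have "isCont D z" using S z holomorphic_on_imp_continuous_on continuous_on_eq_continuous_at by blast
  then have t2: "(\<lambda>\<delta>. D (z + \<delta>)) \<midarrow>0\<rightarrow> D z" by (simp add: isCont_iff)
  have "(F z has_field_derivative deriv (F z) z) (at z)" by (rule holomorphic_derivI[OF h2[OF z] S z])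
  then have t3: "(\<lambda>\<delta>. (F z (z + \<delta>) - F z z) / \<delta>) \<midarrow>0\<rightarrow> deriv (F z) z" by (simp add: DERIV_def)
  have t1: "(\<lambda>\<delta>. (F (z + \<delta>) (z + \<delta>) - F z (z + \<delta>) - D (z + \<delta>) * \<delta>) / \<delta>) \<midarrow>0\<rightarrow> 0"
  proof (rule Lim_null_comparison)
    show "\<forall>\<^sub>F \<delta> in at 0. norm ((F (z + \<delta>) (z + \<delta>) - F z (z + \<delta>) - D (z + \<delta>) * \<delta>) / \<delta>) \<le> 64 * M / r\<^sup>2 * cmod \<delta>"
      unfolding eventually_at
    proof (intro exI[of _ "r / 2"] conjI ballI impI)
      fix \<delta> :: complex assume \<delta>: "\<delta> \<noteq> 0 \<and> dist \<delta> 0 < r / 2"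
      then have zd: "z + \<delta> \<in> S" using r by (intro subsetD[OF r(2)]) (auto simp: dist_norm)
      have "cmod (F (z + \<delta>) (z + \<delta>) - F z (z + \<delta>) - D (z + \<delta>) * \<delta>) \<le> 64 * M / r\<^sup>2 * (cmod \<delta>)\<^sup>2"
        unfolding D_def
        by (rule complex_taylor_two[OF holomorphic_on_subset[OF h1[OF zd] r(2)] r(1) M(1)]) (use r M zd \<delta> in auto)
      then show "norm ((F (z + \<delta>) (z + \<delta>) - F z (z + \<delta>) - D (z + \<delta>) * \<delta>) / \<delta>) \<le> 64 * M / r\<^sup>2 * cmod \<delta>"
        using \<delta> unfolding norm_divide by (subst pos_divide_le_eq) (simp_all add: power2_eq_square mult.assoc)
    qed (use r in auto)
    show "(\<lambda>\<delta>. 64 * M / r\<^sup>2 * cmod \<delta>) \<midarrow>0\<rightarrow> 0"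
      by (intro tendsto_mult_right_zero tendsto_norm_zero tendsto_ident_at)
  qed
  \<comment> \<open>The diagonal increment is split into the quadratic remainder in the first
    variable, taken at the second argument z + \<delta>, its linear term
    \<open>D (z + \<delta>)\<close>, which is continuous in \<delta>, and the increment in the
    second variable alone.\<close>
  have "(\<lambda>\<delta>. (F (z + \<delta>) (z + \<delta>) - F z (z + \<delta>) - D (z + \<delta>) * \<delta>) / \<delta> + D (z + \<delta>) + (F z (z + \<delta>) - F z z) / \<delta>) \<midarrow>0\<rightarrow> 0 + D z + deriv (F z) z"
    by (intro tendsto_add t1 t2 t3)
  then have "(\<lambda>\<delta>. (F (z + \<delta>) (z + \<delta>) - F z z) / \<delta>) \<midarrow>0\<rightarrow> 0 + D z + deriv (F z) z"
    by (rule Lim_transform_eventually) (auto simp: eventually_at intro!: exI[of _ 1] simp: field_simps)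
  then show "\<exists>f'. ((\<lambda>z. F z z) has_field_derivative f') (at z)" unfolding DERIV_def by blast
qed

text \<open>The mean value inequality on (-infinity, x]. It replaces estimates of improper
  integrals: an integral from -infinity is treated as a primitive vanishing there, and
  \<open>\<phi>\<close> is an antiderivative of a bound for the integrand.\<close>

lemma norm_le_of_derivative_bound_from_bot:
  fixes P :: "real \<Rightarrow> complex"
  assumes "\<And>s. s \<le> x \<Longrightarrow> (P has_vector_derivative p s) (at s)" "(P \<longlongrightarrow> 0) at_bot"
    and "\<And>s. s \<le> x \<Longrightarrow> cmod (p s) \<le> \<phi>' s"
    and "\<And>s. s \<le> x \<Longrightarrow> (\<phi> has_real_derivative \<phi>' s) (at s)" "(\<phi> \<longlongrightarrow> l) at_bot"
  shows "cmod (P x) \<le> \<phi> x - l"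
proof -
  have "cmod (P x - P s) \<le> \<phi> x - \<phi> s" if "s < x" for s
  proof (rule differentiable_bound_general[OF that, where f' = p and \<phi>' = \<phi>'])
    show "continuous_on {s..x} P"
    proof (intro continuous_at_imp_continuous_on ballI)
      fix t assume "t \<in> {s..x}"
      then show "isCont P t" using assms(1)[of t] by (intro has_vector_derivative_continuous) auto
    qed
    show "continuous_on {s..x} \<phi>"
    proof (intro continuous_at_imp_continuous_on ballI)
      fix t assume "t \<in> {s..x}"
      then show "isCont \<phi> t" using assms(4)[of t] by (intro DERIV_isCont) auto
    qed
  qed (use assms in \<open>auto simp flip: has_real_derivative_iff_has_vector_derivative\<close>)
  then have ev: "\<forall>\<^sub>F s in at_bot. cmod (P x - P s) \<le> \<phi> x - \<phi> s"
    using eventually_gt_at_bot[of x] by (auto simp: eventually_at_bot_linorder intro!: exI[of _ "x - 1"])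
  have "((\<lambda>s. cmod (P x - P s)) \<longlongrightarrow> cmod (P x - 0)) at_bot" by (intro tendsto_intros assms)
  moreover have "((\<lambda>s. \<phi> x - \<phi> s) \<longlongrightarrow> \<phi> x - l) at_bot" by (intro tendsto_intros assms)
  ultimately show ?thesis using tendsto_le[OF _ _ _ ev] by fastforce
qed

lemma norm_le_of_cauchy_weight:
  fixes P :: "real \<Rightarrow> complex"
  assumes "\<And>s. s \<le> x \<Longrightarrow> (P has_vector_derivative p s) (at s)" "(P \<longlongrightarrow> 0) at_bot"
    and "\<And>s. s \<le> x \<Longrightarrow> cmod (p s) \<le> C / (1 + s\<^sup>2)"
  shows "cmod (P x) \<le> C * pi"
proof -
  have "0 \<le> C / (1 + x\<^sup>2)" using assms(3)[of x] norm_ge_zero order_trans by blast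
  moreover have "0 < 1 + x\<^sup>2" by (simp add: add_pos_nonneg)
  ultimately have C: "0 \<le> C" by (simp add: zero_le_divide_iff)
  have "cmod (P x) \<le> C * arctan x - C * (- (pi / 2))"
  proof (rule norm_le_of_derivative_bound_from_bot[OF assms(1,2,3)])
    show "((\<lambda>x. C * arctan x) has_real_derivative C / (1 + s\<^sup>2)) (at s)" for s
      unfolding divide_inverse by (rule DERIV_cmult[OF DERIV_arctan])
    show "((\<lambda>x. C * arctan x) \<longlongrightarrow> C * (- (pi / 2))) at_bot"
      by (rule tendsto_mult[OF tendsto_const tendsto_arctan_at_bot])
  qed auto
  also have "\<dots> \<le> C * (pi / 2) - C * (- (pi / 2))"
    using arctan_ubound[of x] C by (intro diff_mono mult_left_mono) auto
  finally show ?thesis by (simp add: algebra_simps)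
qed

text \<open>The weight exp(2 c arctan s) has logarithmic derivative 2 c / (1 + s^2), twice the bound
  of the kernel. Integration against the kernel therefore halves the weighted norm, however large c
  is; this is the contraction factor of the Picard iteration.\<close>

lemma norm_le_of_exp_arctan_weight:
  fixes P :: "real \<Rightarrow> complex"
  assumes "\<And>s. s \<le> x \<Longrightarrow> (P has_vector_derivative p s) (at s)" "(P \<longlongrightarrow> 0) at_bot"
    and "\<And>s. s \<le> x \<Longrightarrow> cmod (p s) \<le> c / (1 + s\<^sup>2) * (B * exp (2 * c * arctan s))" and c: "0 < c" and B: "0 \<le> B"
  shows "cmod (P x) \<le> B / 2 * exp (2 * c * arctan x)"
proof -
  have "cmod (P x) \<le> B / 2 * exp (2 * c * arctan x) - B / 2 * exp (2 * c * (- (pi / 2)))"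
  proof (rule norm_le_of_derivative_bound_from_bot[OF assms(1,2,3)])
    show "((\<lambda>x. B / 2 * exp (2 * c * arctan x)) has_real_derivative c / (1 + s\<^sup>2) * (B * exp (2 * c * arctan s))) (at s)" for s
    proof -
      have "((\<lambda>x. B / 2 * exp (2 * c * arctan x)) has_real_derivative B / 2 * (exp (2 * c * arctan s) * (2 * c * inverse (1 + s\<^sup>2)))) (at s)"
        by (intro DERIV_cmult DERIV_chain2[OF DERIV_exp] DERIV_arctan)
      moreover have "B / 2 * (E * (2 * c * inverse w)) = c / w * (B * E)" for E w :: real
      proof -
        have "b * (E * (2 * c * i)) = c * i * ((2 * b) * E)" for b i :: real by (simp only: mult_ac)
        from this[of "B / 2" "inverse w"] show ?thesis unfolding divide_inverse[of c w] by simp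
      qed
      ultimately show ?thesis by (simp only:)
    qed
    show "((\<lambda>x. B / 2 * exp (2 * c * arctan x)) \<longlongrightarrow> B / 2 * exp (2 * c * (- (pi / 2)))) at_bot"
      by (intro tendsto_mult tendsto_const tendsto_exp tendsto_arctan_at_bot)
  qed auto
  moreover have "0 \<le> B / 2 * exp (2 * c * (- (pi / 2)))" using B by simp
  ultimately show ?thesis by linarith
qed


text \<open>Primitives that vanish at \<open>-\<infinity>\<close> stand in for improper integrals along horizontal lines. The choice is junk
  unless the integrand decays, as required in lemma \<open>left_primitive\<close>.\<close>

definition left_primitive :: "real \<Rightarrow> (complex \<Rightarrow> complex) \<Rightarrow> complex \<Rightarrow> complex" where
  "left_primitive d H = (SOME P. (\<forall>\<zeta>\<in>strip d. (P has_field_derivative H \<zeta>) (at \<zeta>)) \<and>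
     (\<forall>y. \<bar>y\<bar> < d \<longrightarrow> ((\<lambda>x. P (Complex x y)) \<longlongrightarrow> 0) at_bot))"

lemma Complex_has_vector_derivative:
  assumes "(P has_field_derivative D) (at (Complex s y))"
  shows "((\<lambda>s. P (Complex s y)) has_vector_derivative D) (at s)"
proof -
  have "((\<lambda>s. of_real s + \<i> * of_real y) has_vector_derivative 1) (at s)"
    by (auto intro!: derivative_eq_intros)
  then have "((\<lambda>s. Complex s y) has_vector_derivative 1) (at s)" by (simp add: Complex_eq)
  from field_vector_diff_chain_at[OF this assms] show ?thesis by (simp add: o_def)
qed

text \<open>Some primitive exists because the strip is convex. Comparison with arctan shows that it
  has a limit at -infinity along the real axis, and subtracting this limit normalises it. The other
  horizontal lines share the limit, because the integrand tends to 0 on the vertical segments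
  joining them to the axis.\<close>

lemma left_primitive:
  assumes d: "0 < d" and hol: "H holomorphic_on strip d"
    and bd: "\<And>\<zeta>. \<zeta> \<in> strip d \<Longrightarrow> cmod (H \<zeta>) \<le> C / (1 + (Re \<zeta>)\<^sup>2)"
  shows "\<zeta> \<in> strip d \<Longrightarrow> (left_primitive d H has_field_derivative H \<zeta>) (at \<zeta>)"
    and "\<bar>y\<bar> < d \<Longrightarrow> ((\<lambda>x. left_primitive d H (Complex x y)) \<longlongrightarrow> 0) at_bot"
proof -
  obtain P where "\<And>x. x \<in> strip d \<Longrightarrow> (P has_field_derivative H x) (at x within strip d)"
    using holomorphic_convex_primitive'[OF convex_strip open_strip hol] by blast
  then have P: "(P has_field_derivative H x) (at x)" if "x \<in> strip d" for x
    using that open_strip by (metis at_within_open)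
  have inS: "Complex x y \<in> strip d" if "\<bar>y\<bar> < d" for x y using that by (simp add: strip_def)
  have C: "0 \<le> C"
  proof -
    have "cmod (H (Complex 0 0)) \<le> C" using bd[OF inS[of 0 0]] d by simp
    then show ?thesis using norm_ge_zero order_trans by blast
  qed
  have hb: "cmod (P (Complex t y) - P (Complex s y)) \<le> C * arctan t - C * arctan s" if st: "s < t" and y: "\<bar>y\<bar> < d" for s t y
  proof (rule differentiable_bound_general[OF st, where f' = "\<lambda>s. H (Complex s y)" and \<phi>' = "\<lambda>s. C / (1 + s\<^sup>2)"])
    have dP: "((\<lambda>s. P (Complex s y)) has_vector_derivative H (Complex s y)) (at s)" for s
      by (rule Complex_has_vector_derivative[OF P[OF inS[OF y]]])
    show "continuous_on {s..t} (\<lambda>s. P (Complex s y))"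
      by (intro continuous_at_imp_continuous_on ballI has_vector_derivative_continuous[OF dP])
    show "continuous_on {s..t} (\<lambda>s. C * arctan s)" by (intro continuous_intros)
    fix x
    show "((\<lambda>s. P (Complex s y)) has_vector_derivative H (Complex x y)) (at x)" by (rule dP)
    show "((\<lambda>s. C * arctan s) has_vector_derivative C / (1 + x\<^sup>2)) (at x)"
      unfolding has_real_derivative_iff_has_vector_derivative[symmetric] divide_inverse by (rule DERIV_cmult[OF DERIV_arctan])
    show "cmod (H (Complex x y)) \<le> C / (1 + x\<^sup>2)" using bd[OF inS[OF y], of x] by simp
  qed
  have at: "((\<lambda>x. C * arctan x) \<longlongrightarrow> C * (- (pi / 2))) at_bot"
    by (rule tendsto_mult[OF tendsto_const tendsto_arctan_at_bot])
  define p where "p n = P (Complex (- real n) 0)" for n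
  have "(\<lambda>n. C * arctan (- real n)) \<longlonglongrightarrow> C * (- (pi / 2))"
    by (rule filterlim_compose[OF at]) real_asymp
  then have ca: "Cauchy (\<lambda>n. C * arctan (- real n))" by (rule LIMSEQ_imp_Cauchy)
  have "Cauchy p"
  proof (rule metric_CauchyI)
    fix e :: real assume "0 < e"
    then obtain n0 where n0: "\<And>m n. m \<ge> n0 \<Longrightarrow> n \<ge> n0 \<Longrightarrow> dist (C * arctan (- real m)) (C * arctan (- real n)) < e"
      using metric_CauchyD[OF ca] by blast
    have "dist (p m) (p n) < e" if "m \<ge> n0" "n \<ge> n0" for m n
    proof -
      have "dist (p m) (p n) \<le> dist (C * arctan (- real m)) (C * arctan (- real n))"
      proof (cases m n rule: linorder_cases)
        case less
        then show ?thesis using hb[of "- real n" "- real m" 0] d by (simp add: p_def dist_norm)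
      next
        case equal
        then show ?thesis by simp
      next
        case greater
        then show ?thesis using hb[of "- real m" "- real n" 0] d by (simp add: p_def dist_norm norm_minus_commute)
      qed
      then show ?thesis using n0[OF that] by simp
    qed
    then show "\<exists>M. \<forall>m\<ge>M. \<forall>n\<ge>M. dist (p m) (p n) < e" by blast
  qed
  then obtain l where l: "p \<longlonglongrightarrow> l" using Cauchy_convergent convergent_def by blast
  have lb: "cmod (P (Complex x 0) - l) \<le> C * arctan x - C * (- (pi / 2))" for x
  proof (rule tendsto_le[OF sequentially_bot])
    show "(\<lambda>n. C * arctan x - C * arctan (- real n)) \<longlonglongrightarrow> C * arctan x - C * (- (pi / 2))"
      by (intro tendsto_diff tendsto_const \<open>(\<lambda>n. C * arctan (- real n)) \<longlonglongrightarrow> C * (- (pi / 2))\<close>)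
    show "(\<lambda>n. cmod (P (Complex x 0) - p n)) \<longlonglongrightarrow> cmod (P (Complex x 0) - l)"
      by (intro tendsto_norm tendsto_diff tendsto_const l)
    have "\<forall>\<^sub>F n in sequentially. - real n < x" by real_asymp
    then show "\<forall>\<^sub>F n in sequentially. cmod (P (Complex x 0) - p n) \<le> C * arctan x - C * arctan (- real n)"
      by (rule eventually_mono) (use hb d in \<open>simp add: p_def\<close>)
  qed
  define Q where "Q \<zeta> = P \<zeta> - l" for \<zeta>
  have Q1: "(Q has_field_derivative H x) (at x)" if "x \<in> strip d" for x
    unfolding Q_def[abs_def] using DERIV_diff[OF P[OF that] DERIV_const[of l]] by simp
  have Q2: "((\<lambda>x. Q (Complex x y)) \<longlongrightarrow> 0) at_bot" if y: "\<bar>y\<bar> < d" for y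
  proof (rule Lim_null_comparison)
    have "cmod (Q (Complex x y)) \<le> C / (1 + x\<^sup>2) * d + (C * arctan x - C * (- (pi / 2)))" for x
    proof -
      have seg: "closed_segment (Complex x 0) (Complex x y) \<subseteq> strip d \<inter> {z. Re z = x}"
        using y d by (auto simp: closed_segment_same_Re strip_def closed_segment_eq_real_ivl split: if_splits)
      have "cmod (P (Complex x y) - P (Complex x 0)) \<le> C / (1 + x\<^sup>2) * cmod (Complex x y - Complex x 0)"
      proof (rule field_differentiable_bound[OF convex_closed_segment])
        fix z assume "z \<in> closed_segment (Complex x 0) (Complex x y)"
        then have z: "z \<in> strip d" "Re z = x" using seg by auto
        then show "(P has_field_derivative H z) (at z within closed_segment (Complex x 0) (Complex x y))"
          using P has_field_derivative_at_within by blast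
        show "cmod (H z) \<le> C / (1 + x\<^sup>2)" using bd[OF z(1)] z(2) by simp
      qed auto
      also have "\<dots> \<le> C / (1 + x\<^sup>2) * d" using y C by (intro mult_left_mono) (auto simp: complex_diff cmod_def)
      finally have "cmod (P (Complex x y) - P (Complex x 0)) \<le> C / (1 + x\<^sup>2) * d" .
      moreover have "Q (Complex x y) = (P (Complex x y) - P (Complex x 0)) + (P (Complex x 0) - l)" by (simp add: Q_def)
      ultimately show ?thesis by (simp only: order_trans[OF norm_triangle_ineq add_mono[OF _ lb]])
    qed
    then show "\<forall>\<^sub>F x in at_bot. norm (Q (Complex x y)) \<le> C / (1 + x\<^sup>2) * d + (C * arctan x - C * (- (pi / 2)))" by simp
    have "((\<lambda>x. C / (1 + x\<^sup>2) * d) \<longlongrightarrow> 0) at_bot" by real_asymp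
    moreover have "((\<lambda>x. C * arctan x - C * (- (pi / 2))) \<longlongrightarrow> C * (- (pi / 2)) - C * (- (pi / 2))) at_bot"
      by (intro tendsto_diff at tendsto_const)
    ultimately show "((\<lambda>x. C / (1 + x\<^sup>2) * d + (C * arctan x - C * (- (pi / 2)))) \<longlongrightarrow> 0) at_bot"
      using tendsto_add by fastforce
  qed
  have ex: "\<exists>P. (\<forall>\<zeta>\<in>strip d. (P has_field_derivative H \<zeta>) (at \<zeta>)) \<and> (\<forall>y. \<bar>y\<bar> < d \<longrightarrow> ((\<lambda>x. P (Complex x y)) \<longlongrightarrow> 0) at_bot)"
    using Q1 Q2 by blast
  show "\<zeta> \<in> strip d \<Longrightarrow> (left_primitive d H has_field_derivative H \<zeta>) (at \<zeta>)"
    and "\<bar>y\<bar> < d \<Longrightarrow> ((\<lambda>x. left_primitive d H (Complex x y)) \<longlongrightarrow> 0) at_bot"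
    using someI_ex[OF ex] unfolding left_primitive_def by blast+
qed


lemma left_primitive_line:
  assumes "0 < d" "H holomorphic_on strip d" "\<And>\<zeta>. \<zeta> \<in> strip d \<Longrightarrow> cmod (H \<zeta>) \<le> C / (1 + (Re \<zeta>)\<^sup>2)" "\<bar>y\<bar> < d"
  shows "((\<lambda>s. left_primitive d H (Complex s y)) has_vector_derivative H (Complex s y)) (at s)"
  by (rule Complex_has_vector_derivative[OF left_primitive(1)[OF assms(1-3)]]) (use assms(4) in \<open>simp_all add: strip_def\<close>)

section \<open>Picard iteration for the Volterra operator on the strip\<close>

context
  fixes d c :: real and K :: "complex \<Rightarrow> complex \<Rightarrow> complex"
  assumes d: "0 < d" and c: "0 < c"
    and K1: "\<And>w. w \<in> strip d \<Longrightarrow> (\<lambda>z. K z w) holomorphic_on strip d"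
    and K2: "\<And>z. z \<in> strip d \<Longrightarrow> K z holomorphic_on strip d"
    and Kb: "\<And>z w. z \<in> strip d \<Longrightarrow> w \<in> strip d \<Longrightarrow> cmod (K z w) \<le> c / (1 + (Re w)\<^sup>2)"
begin

text \<open>The first complex argument is the parameter of the kernel, the second the end point of
  integration; the Volterra operator itself is the diagonal \<open>W f z z\<close>. They are kept
  apart because holomorphy is proved in each of them separately.\<close>

private definition W :: "(complex \<Rightarrow> complex) \<Rightarrow> complex \<Rightarrow> complex \<Rightarrow> complex" where
  "W f z = left_primitive d (\<lambda>w. K z w * f w)"

private lemma Kf:
  assumes "f holomorphic_on strip d" "\<And>w. w \<in> strip d \<Longrightarrow> cmod (f w) \<le> M" "z \<in> strip d"
  shows "(\<lambda>w. K z w * f w) holomorphic_on strip d" "w \<in> strip d \<Longrightarrow> cmod (K z w * f w) \<le> (c * M) / (1 + (Re w)\<^sup>2)"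
proof -
  show "(\<lambda>w. K z w * f w) holomorphic_on strip d" by (intro holomorphic_on_mult K2 assms)
  assume w: "w \<in> strip d"
  have "cmod (K z w * f w) \<le> c / (1 + (Re w)\<^sup>2) * M"
    unfolding norm_mult using order_trans[OF norm_ge_zero Kb[OF assms(3) w]] by (intro mult_mono Kb assms w) auto
  then show "cmod (K z w * f w) \<le> (c * M) / (1 + (Re w)\<^sup>2)" by (simp only: times_divide_eq_left)
qed

private lemma W_bound:
  assumes "f holomorphic_on strip d" "\<And>w. w \<in> strip d \<Longrightarrow> cmod (f w) \<le> M" "z \<in> strip d" "\<eta> \<in> strip d"
  shows "cmod (W f z \<eta>) \<le> c * M * pi"
proof -
  note k = Kf[OF assms(1-3)]
  have y: "\<bar>Im \<eta>\<bar> < d" using assms(4) by (simp add: strip_def)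
  have "cmod ((\<lambda>s. W f z (Complex s (Im \<eta>))) (Re \<eta>)) \<le> c * M * pi"
    unfolding W_def
    by (rule norm_le_of_cauchy_weight[OF left_primitive_line[OF d k y] left_primitive(2)[OF d k y]])
       (use k(2)[of "Complex _ (Im \<eta>)"] y in \<open>simp_all add: strip_def\<close>)
  then show ?thesis by simp
qed

private lemma W_diff:
  assumes f: "f holomorphic_on strip d" "\<And>w. w \<in> strip d \<Longrightarrow> cmod (f w) \<le> M"
    and g: "g holomorphic_on strip d" "\<And>w. w \<in> strip d \<Longrightarrow> cmod (g w) \<le> M'"
    and z: "z \<in> strip d" "\<eta> \<in> strip d" and B: "0 \<le> B"
    and fg: "\<And>w. w \<in> strip d \<Longrightarrow> cmod (f w - g w) \<le> B * exp (2 * c * arctan (Re w))"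
  shows "cmod (W f z \<eta> - W g z \<eta>) \<le> B / 2 * exp (2 * c * arctan (Re \<eta>))"
proof -
  note kf = Kf[OF f z(1)] and kg = Kf[OF g z(1)]
  have y: "\<bar>Im \<eta>\<bar> < d" using z(2) by (simp add: strip_def)
  have "cmod ((\<lambda>s. W f z (Complex s (Im \<eta>)) - W g z (Complex s (Im \<eta>))) (Re \<eta>)) \<le> B / 2 * exp (2 * c * arctan (Re \<eta>))"
  proof (rule norm_le_of_exp_arctan_weight[OF _ _ _ c B])
    show "((\<lambda>s. W f z (Complex s (Im \<eta>)) - W g z (Complex s (Im \<eta>))) has_vector_derivative
        K z (Complex s (Im \<eta>)) * f (Complex s (Im \<eta>)) - K z (Complex s (Im \<eta>)) * g (Complex s (Im \<eta>))) (at s)" for s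
      unfolding W_def by (rule has_vector_derivative_diff[OF left_primitive_line[OF d kf y] left_primitive_line[OF d kg y]])
    show "((\<lambda>s. W f z (Complex s (Im \<eta>)) - W g z (Complex s (Im \<eta>))) \<longlongrightarrow> 0) at_bot"
      unfolding W_def using tendsto_diff[OF left_primitive(2)[OF d kf y] left_primitive(2)[OF d kg y]] by simp
    fix s
    have w: "Complex s (Im \<eta>) \<in> strip d" using y by (simp add: strip_def)
    have "cmod (K z (Complex s (Im \<eta>)) * (f (Complex s (Im \<eta>)) - g (Complex s (Im \<eta>)))) \<le> c / (1 + s\<^sup>2) * (B * exp (2 * c * arctan s))"
      unfolding norm_mult using Kb[OF z(1) w] fg[OF w] c
      by (intro mult_mono) (auto intro!: divide_nonneg_nonneg add_nonneg_nonneg)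
    then show "cmod (K z (Complex s (Im \<eta>)) * f (Complex s (Im \<eta>)) - K z (Complex s (Im \<eta>)) * g (Complex s (Im \<eta>))) \<le> c / (1 + s\<^sup>2) * (B * exp (2 * c * arctan s))"
      by (simp only: right_diff_distrib)
  qed
  then show ?thesis by simp
qed

text \<open>In the end point, \<open>W f z\<close> is a primitive. In the kernel parameter one
  differentiates under the integral: the derivative is the primitive of the z-derivative of K times
  f, which is available because that derivative inherits the integrable weight of K.\<close>

private lemma W_holomorphic:
  assumes f: "f holomorphic_on strip d" "\<And>w. w \<in> strip d \<Longrightarrow> cmod (f w) \<le> M" and M: "0 < M"
  shows "(\<lambda>z. W f z z) holomorphic_on strip d"
proof (rule separately_holomorphic_diagonal[OF open_strip, where F = "W f"])
  show "0 < c * M * pi" using c M by simp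
  show "cmod (W f z w) \<le> c * M * pi" if "z \<in> strip d" "w \<in> strip d" for z w by (rule W_bound[OF f that])
  show "W f z holomorphic_on strip d" if z: "z \<in> strip d" for z
    unfolding holomorphic_on_open[OF open_strip] W_def using left_primitive(1)[OF d Kf[OF f z]] by blast
  fix \<eta> assume \<eta>: "\<eta> \<in> strip d"
  then have y: "\<bar>Im \<eta>\<bar> < d" by (simp add: strip_def)
  show "(\<lambda>z. W f z \<eta>) holomorphic_on strip d"
    unfolding holomorphic_on_open[OF open_strip]
  proof
    fix z assume z: "z \<in> strip d"
    obtain r where r: "0 < r" "ball z r \<subseteq> strip d" using open_strip z open_contains_ball by blast
    define D where "D w = deriv (\<lambda>z. K z w) z" for w
    have q: "0 < 1 + (Re w)\<^sup>2" for w :: complex by (simp add: add_pos_nonneg)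
    have Kc: "cmod (K z w) \<le> c" if "z \<in> strip d" "w \<in> strip d" for z w
    proof -
      have "c / (1 + (Re w)\<^sup>2) \<le> c / 1" using c q[of w] by (intro divide_left_mono) simp_all
      then show ?thesis using Kb[OF that] by simp
    qed
    have Dh: "D holomorphic_on strip d"
      unfolding D_def[abs_def] by (rule deriv_parameter_holomorphic[OF open_strip z K1 K2 c Kc])
    have rem: "cmod (K (z + \<delta>) w - K z w - D w * \<delta>) \<le> 64 * c / r\<^sup>2 * (cmod \<delta>)\<^sup>2 / (1 + (Re w)\<^sup>2)"
      if w: "w \<in> strip d" and \<delta>: "cmod \<delta> < r / 2" for w \<delta>
    proof -
      have "cmod (K (z + \<delta>) w - K z w - D w * \<delta>) \<le> 64 * (c / (1 + (Re w)\<^sup>2)) / r\<^sup>2 * (cmod \<delta>)\<^sup>2"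
        unfolding D_def
        by (rule complex_taylor_two[OF holomorphic_on_subset[OF K1[OF w] r(2)] r(1) _ _ \<delta>]) (use c q r Kb w in auto)
      then show ?thesis by (simp only: times_divide_eq_left times_divide_eq_right divide_divide_eq_left mult_ac)
    qed
    have zd: "z + \<delta> \<in> strip d" if "cmod \<delta> < r / 2" for \<delta>
      using that r by (intro subsetD[OF r(2)]) (auto simp: dist_norm)
    \<comment> \<open>A fixed increment that makes the Taylor formula bound \<open>D w\<close>
      itself: \<open>D w * \<delta>0\<close> is a combination of the remainder and two values of
      \<open>K\<close>, all of which carry the weight 1 / (1 + (Re w)^2).\<close>
    define \<delta>0 where "\<delta>0 = complex_of_real (r / 4)"
    have \<delta>0: "cmod \<delta>0 = r / 4" "cmod \<delta>0 < r / 2" using r by (simp_all add: \<delta>0_def)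
    define C where "C = (64 * c / r\<^sup>2 * (r / 4)\<^sup>2 + 2 * c) / (r / 4)"
    have Db: "cmod (D w * f w) \<le> C * M / (1 + (Re w)\<^sup>2)" if w: "w \<in> strip d" for w
    proof -
      have "cmod (D w * \<delta>0) \<le> cmod (K (z + \<delta>0) w - K z w - D w * \<delta>0) + cmod (K (z + \<delta>0) w) + cmod (K z w)"
        using norm_triangle_ineq4[of "K (z + \<delta>0) w - K z w" "K (z + \<delta>0) w - K z w - D w * \<delta>0"] norm_triangle_ineq4[of "K (z + \<delta>0) w" "K z w"]
        by (simp add: algebra_simps)
      also have "\<dots> \<le> 64 * c / r\<^sup>2 * (r / 4)\<^sup>2 / (1 + (Re w)\<^sup>2) + c / (1 + (Re w)\<^sup>2) + c / (1 + (Re w)\<^sup>2)"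
        using rem[OF w \<delta>0(2)] Kb[OF zd[OF \<delta>0(2)] w] Kb[OF z w] unfolding \<delta>0(1) by (intro add_mono)
      also have "\<dots> = (64 * c / r\<^sup>2 * (r / 4)\<^sup>2 + 2 * c) / (1 + (Re w)\<^sup>2)" by (simp only: add_divide_distrib mult_2 add.assoc)
      finally have "cmod (D w) * (r / 4) \<le> (64 * c / r\<^sup>2 * (r / 4)\<^sup>2 + 2 * c) / (1 + (Re w)\<^sup>2)"
        unfolding norm_mult \<delta>0(1) .
      then have "cmod (D w) \<le> (64 * c / r\<^sup>2 * (r / 4)\<^sup>2 + 2 * c) / (1 + (Re w)\<^sup>2) / (r / 4)"
        using r by (subst pos_le_divide_eq) auto
      also have "\<dots> = C / (1 + (Re w)\<^sup>2)" by (simp only: C_def divide_divide_eq_left mult.commute)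
      finally have D1: "cmod (D w) \<le> C / (1 + (Re w)\<^sup>2)" .
      have "cmod (D w * f w) \<le> C / (1 + (Re w)\<^sup>2) * M"
        unfolding norm_mult using order_trans[OF norm_ge_zero D1] by (intro mult_mono D1 f w) auto
      then show ?thesis by (simp only: times_divide_eq_left)
    qed
    have Dfh: "(\<lambda>w. D w * f w) holomorphic_on strip d" by (intro holomorphic_on_mult Dh f)
    define L where "L = left_primitive d (\<lambda>w. D w * f w)"
    \<comment> \<open>The quadratic remainder is integrated along the horizontal line through
      \<eta>, where its weight has total mass pi; the estimate stays quadratic in \<delta> and
      identifies \<open>L \<eta>\<close> as the derivative.\<close>
    have main: "cmod (W f (z + \<delta>) \<eta> - W f z \<eta> - L \<eta> * \<delta>) \<le> 64 * c / r\<^sup>2 * M * pi * (cmod \<delta>)\<^sup>2" if \<delta>: "cmod \<delta> < r / 2" for \<delta>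
    proof -
      note k1 = Kf[OF f zd[OF \<delta>]] and k2 = Kf[OF f z]
      let ?p = "\<lambda>s. W f (z + \<delta>) (Complex s (Im \<eta>)) - W f z (Complex s (Im \<eta>)) - L (Complex s (Im \<eta>)) * \<delta>"
      have "cmod (?p (Re \<eta>)) \<le> 64 * c / r\<^sup>2 * (cmod \<delta>)\<^sup>2 * M * pi"
      proof (rule norm_le_of_cauchy_weight[where P = ?p])
        show "(?p has_vector_derivative K (z + \<delta>) (Complex s (Im \<eta>)) * f (Complex s (Im \<eta>)) - K z (Complex s (Im \<eta>)) * f (Complex s (Im \<eta>)) - D (Complex s (Im \<eta>)) * f (Complex s (Im \<eta>)) * \<delta>) (at s)" for s
          unfolding W_def L_def
          by (rule has_vector_derivative_diff[OF has_vector_derivative_diff[OF left_primitive_line[OF d k1 y] left_primitive_line[OF d k2 y]]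
              has_vector_derivative_mult_left[OF left_primitive_line[OF d Dfh Db y]]])
        show "(?p \<longlongrightarrow> 0) at_bot"
          unfolding W_def L_def
          using tendsto_diff[OF tendsto_diff[OF left_primitive(2)[OF d k1 y] left_primitive(2)[OF d k2 y]]
              tendsto_mult_left_zero[OF left_primitive(2)[OF d Dfh Db y], of \<delta>]] by simp
        fix s
        define w where "w = Complex s (Im \<eta>)"
        have w: "w \<in> strip d" using y by (simp add: w_def strip_def)
        have "K (z + \<delta>) w * f w - K z w * f w - D w * f w * \<delta> = (K (z + \<delta>) w - K z w - D w * \<delta>) * f w" by (simp add: algebra_simps)
        also have "cmod \<dots> \<le> 64 * c / r\<^sup>2 * (cmod \<delta>)\<^sup>2 / (1 + (Re w)\<^sup>2) * M"
          unfolding norm_mult using order_trans[OF norm_ge_zero rem[OF w \<delta>]] by (intro mult_mono rem f w \<delta>) auto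
        finally show "cmod (K (z + \<delta>) (Complex s (Im \<eta>)) * f (Complex s (Im \<eta>)) - K z (Complex s (Im \<eta>)) * f (Complex s (Im \<eta>)) - D (Complex s (Im \<eta>)) * f (Complex s (Im \<eta>)) * \<delta>) \<le> 64 * c / r\<^sup>2 * (cmod \<delta>)\<^sup>2 * M / (1 + s\<^sup>2)"
          unfolding w_def by (simp only: times_divide_eq_left complex.sel)
      qed
      then show ?thesis by (simp add: mult_ac)
    qed
    have "(\<lambda>\<delta>. (W f (z + \<delta>) \<eta> - W f z \<eta>) / \<delta> - L \<eta>) \<midarrow>0\<rightarrow> 0"
    proof (rule Lim_null_comparison)
      show "\<forall>\<^sub>F \<delta> in at 0. norm ((W f (z + \<delta>) \<eta> - W f z \<eta>) / \<delta> - L \<eta>) \<le> 64 * c / r\<^sup>2 * M * pi * cmod \<delta>"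
        unfolding eventually_at
      proof (intro exI[of _ "r / 2"] conjI ballI impI)
        fix \<delta> :: complex assume \<delta>: "\<delta> \<noteq> 0 \<and> dist \<delta> 0 < r / 2"
        have "(W f (z + \<delta>) \<eta> - W f z \<eta>) / \<delta> - L \<eta> = (W f (z + \<delta>) \<eta> - W f z \<eta> - L \<eta> * \<delta>) / \<delta>"
          using \<delta> by (simp add: diff_divide_distrib)
        then have "norm ((W f (z + \<delta>) \<eta> - W f z \<eta>) / \<delta> - L \<eta>) = cmod (W f (z + \<delta>) \<eta> - W f z \<eta> - L \<eta> * \<delta>) / cmod \<delta>"
          by (simp only: norm_divide)
        also have "\<dots> \<le> 64 * c / r\<^sup>2 * M * pi * (cmod \<delta>)\<^sup>2 / cmod \<delta>"
          using \<delta> by (intro divide_right_mono main) auto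
        also have "\<dots> = 64 * c / r\<^sup>2 * M * pi * cmod \<delta>" using \<delta> by (simp add: power2_eq_square)
        finally show "norm ((W f (z + \<delta>) \<eta> - W f z \<eta>) / \<delta> - L \<eta>) \<le> 64 * c / r\<^sup>2 * M * pi * cmod \<delta>" .
      qed (use r in auto)
      show "(\<lambda>\<delta>. 64 * c / r\<^sup>2 * M * pi * cmod \<delta>) \<midarrow>0\<rightarrow> 0"
        by (intro tendsto_mult_right_zero tendsto_norm_zero tendsto_ident_at)
    qed
    then have "((\<lambda>z. W f z \<eta>) has_field_derivative L \<eta>) (at z)"
      unfolding DERIV_def by (simp add: LIM_zero_iff)
    then show "\<exists>f'. ((\<lambda>z. W f z \<eta>) has_field_derivative f') (at z)" by blast
  qed
qed

lemma volterra_strip: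
  assumes g: "g holomorphic_on strip d" "\<And>z. z \<in> strip d \<Longrightarrow> cmod (g z) \<le> G"
  obtains U M where "U holomorphic_on strip d" "\<And>z. z \<in> strip d \<Longrightarrow> cmod (U z) \<le> M"
    "\<And>z. z \<in> strip d \<Longrightarrow> U z = g z + left_primitive d (\<lambda>w. K z w * U w) z"
proof -
  define E where "E z = exp (2 * c * arctan (Re z))" for z
  define e where "e = exp (c * pi)"
  have E: "1 \<le> e * E z" "0 < E z" "E z \<le> e" for z
  proof -
    have "- (pi / 2) \<le> arctan (Re z)" "arctan (Re z) \<le> pi / 2" using arctan_lbound[of "Re z"] arctan_ubound[of "Re z"] by linarith+
    from mult_left_mono[OF this(1), of "2 * c"] mult_left_mono[OF this(2), of "2 * c"]
    have "0 \<le> c * pi + 2 * c * arctan (Re z)" "2 * c * arctan (Re z) \<le> c * pi" using c by simp_all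
    then show "1 \<le> e * E z" "E z \<le> e" by (simp_all add: e_def E_def flip: exp_add)
    show "0 < E z" by (simp add: E_def)
  qed
  have e0: "0 < e" by (simp add: e_def)
  \<comment> \<open>Bounds g in the weighted norm: the weight may be as small as exp(-c pi) = 1 / e.
    The summand 1 secures positivity.\<close>
  define G' where "G' = (\<bar>G\<bar> + 1) * e"
  have G': "0 < G'" using e0 by (simp add: G'_def add_nonneg_pos)
  have gE: "cmod (g z) \<le> G' * E z" if "z \<in> strip d" for z
  proof -
    have "cmod (g z) \<le> (\<bar>G\<bar> + 1) * 1" using g(2)[OF that] abs_ge_self[of G] by simp
    also have "\<dots> \<le> (\<bar>G\<bar> + 1) * (e * E z)" by (intro mult_left_mono E) auto
    finally show ?thesis by (simp add: G'_def)
  qed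
  define M where "M = 2 * G' * e"
  have M: "0 < M" using G' e0 by (simp add: M_def)
  define U where "U = rec_nat (\<lambda>_. 0 :: complex) (\<lambda>_ f z. g z + W f z z)"
  have U0: "U 0 = (\<lambda>_. 0)" and US: "U (Suc n) = (\<lambda>z. g z + W (U n) z z)" for n by (simp_all add: U_def)
  have bE: "cmod x \<le> M" if "cmod x \<le> 2 * G' * E z" for x z
  proof -
    have "2 * G' * E z \<le> M" unfolding M_def using G' by (intro mult_left_mono E) auto
    then show ?thesis using that by simp
  qed
  have Wb: "cmod (W f z z - W h z z) \<le> B / 2 * E z"
    if "f holomorphic_on strip d" "\<And>w. w \<in> strip d \<Longrightarrow> cmod (f w) \<le> M" "h holomorphic_on strip d" "\<And>w. w \<in> strip d \<Longrightarrow> cmod (h w) \<le> M"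
      "z \<in> strip d" "0 \<le> B" "\<And>w. w \<in> strip d \<Longrightarrow> cmod (f w - h w) \<le> B * E w" for f h z B
    unfolding E_def by (rule W_diff) (use that in \<open>auto simp: E_def\<close>)
  have W0: "W (\<lambda>_. 0) z z = 0" if z: "z \<in> strip d" for z
  proof -
    have "cmod (W (\<lambda>_. 0) z z) \<le> c * 0 * pi" by (rule W_bound) (use z in auto)
    then show ?thesis by simp
  qed
  \<comment> \<open>The ball of radius 2 G' in the weighted norm is invariant: g contributes G', and
    the halved previous iterate another G'.\<close>
  have U: "U n holomorphic_on strip d \<and> (\<forall>z\<in>strip d. cmod (U n z) \<le> 2 * G' * E z)" for n
  proof (induction n)
    case 0
    then show ?case using G' E(2) by (simp add: U0 less_imp_le)
  next
    case (Suc n)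
    have UM: "cmod (U n z) \<le> M" if "z \<in> strip d" for z using Suc that bE by blast
    have "cmod (U (Suc n) z) \<le> 2 * G' * E z" if z: "z \<in> strip d" for z
    proof -
      have "cmod (W (U n) z z - W (\<lambda>_. 0) z z) \<le> 2 * G' / 2 * E z"
        by (rule Wb) (use Suc UM z G' M in auto)
      then show ?thesis using W0[OF z] gE[OF z] norm_triangle_ineq[of "g z" "W (U n) z z"] by (simp add: US)
    qed
    moreover have "U (Suc n) holomorphic_on strip d" unfolding US
      by (intro holomorphic_on_add g W_holomorphic[OF _ UM M]) (use Suc in auto)
    ultimately show ?case by blast
  qed
  have UM: "cmod (U n z) \<le> M" if "z \<in> strip d" for n z using U that bE by blast
  have UD: "\<forall>z\<in>strip d. cmod (U (Suc n) z - U n z) \<le> G' * (1 / 2) ^ n * E z" for n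
  proof (induction n)
    case 0
    then show ?case using gE W0 by (simp add: U0 US)
  next
    case (Suc n)
    show ?case
    proof
      fix z assume z: "z \<in> strip d"
      have "cmod (W (U (Suc n)) z z - W (U n) z z) \<le> G' * (1 / 2) ^ n / 2 * E z"
        by (rule Wb[OF _ UM _ UM z]) (use U Suc G' in auto)
      then show "cmod (U (Suc (Suc n)) z - U (Suc n) z) \<le> G' * (1 / 2) ^ Suc n * E z"
        by (simp add: US[of "Suc n"] US[of n])
    qed
  qed
  define V where "V z = (\<Sum>i. U (Suc i) z - U i z)" for z
  have "uniform_limit (strip d) (\<lambda>n z. \<Sum>i<n. U (Suc i) z - U i z) V sequentially"
    unfolding V_def
  proof (rule Weierstrass_m_test)
    show "cmod (U (Suc n) z - U n z) \<le> G' * e * (1 / 2) ^ n" if "z \<in> strip d" for n z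
    proof -
      have "cmod (U (Suc n) z - U n z) \<le> G' * (1 / 2) ^ n * E z" using UD that by blast
      also have "\<dots> \<le> G' * (1 / 2) ^ n * e" using G' by (intro mult_left_mono E) auto
      finally show ?thesis by (simp only: mult_ac)
    qed
    show "summable (\<lambda>n. G' * e * (1 / 2) ^ n)" by (intro summable_mult summable_geometric) auto
  qed
  moreover have "(\<Sum>i<n. U (Suc i) z - U i z) = U n z" for n z
    by (induction n) (simp_all add: U0)
  ultimately have lim: "uniform_limit (strip d) U V sequentially" by simp
  have Vh: "V holomorphic_on strip d"
  proof (rule holomorphic_uniform_sequence[OF open_strip])
    show "U n holomorphic_on strip d" for n using U by blast
    fix x assume "x \<in> strip d"
    then obtain r where "0 < r" "cball x r \<subseteq> strip d" using open_strip open_contains_cball by blast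
    then show "\<exists>r>0. cball x r \<subseteq> strip d \<and> uniform_limit (cball x r) U V sequentially"
      using uniform_limit_on_subset[OF lim] by blast
  qed
  have ptw: "(\<lambda>n. U n z) \<longlonglongrightarrow> V z" if "z \<in> strip d" for z
    using tendsto_uniform_limitI[OF lim that] .
  have VM: "cmod (V z) \<le> M" if z: "z \<in> strip d" for z
    by (rule tendsto_upperbound[OF tendsto_norm[OF ptw[OF z]]]) (use UM[OF z] in auto)
  have "V z = g z + W V z z" if z: "z \<in> strip d" for z
  proof -
    have "(\<lambda>n. W (U n) z z - W V z z) \<longlonglongrightarrow> 0"
    proof (rule LIMSEQ_I)
      fix \<epsilon> :: real assume \<epsilon>: "0 < \<epsilon>"
      \<comment> \<open>Continuity of the operator under uniform convergence: distance B / e in the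
        supremum norm gives distance B in the weighted norm, since 1 \<le> e E, and the image is
        measured with E \<le> e.\<close>
      define B where "B = \<epsilon> / e"
      have B: "0 < B" using \<epsilon> e0 by (simp add: B_def)
      have Be: "0 < B / e" using B e0 by simp
      obtain n0 where n0: "\<And>n w. n \<ge> n0 \<Longrightarrow> w \<in> strip d \<Longrightarrow> dist (U n w) (V w) < B / e"
        using uniform_limitD[OF lim Be] unfolding eventually_sequentially by blast
      have "cmod (W (U n) z z - W V z z - 0) < \<epsilon>" if n: "n \<ge> n0" for n
      proof -
        have "cmod (W (U n) z z - W V z z) \<le> B / 2 * E z"
        proof (rule Wb[OF _ UM Vh VM z less_imp_le[OF B]])
          show "U n holomorphic_on strip d" using U by blast
          fix w assume "w \<in> strip d"
          then have "cmod (U n w - V w) \<le> B / e * 1" using n0[OF n, of w] by (simp add: dist_norm)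
          also have "\<dots> \<le> B / e * (e * E w)" by (intro mult_left_mono E less_imp_le[OF Be])
          finally show "cmod (U n w - V w) \<le> B * E w" using e0 by simp
        qed
        also have "\<dots> \<le> B / 2 * e" using B by (intro mult_left_mono E) auto
        also have "\<dots> < B * e" using B e0 by simp
        finally show ?thesis using e0 by (simp add: B_def)
      qed
      then show "\<exists>no. \<forall>n\<ge>no. norm (W (U n) z z - W V z z - 0) < \<epsilon>" by blast
    qed
    then have "(\<lambda>n. g z + W V z z + (W (U n) z z - W V z z)) \<longlonglongrightarrow> g z + W V z z + 0" by (intro tendsto_add tendsto_const)
    then have "(\<lambda>n. U (Suc n) z) \<longlonglongrightarrow> g z + W V z z" by (simp add: US)
    moreover have "(\<lambda>n. U (Suc n) z) \<longlonglongrightarrow> V z" using ptw[OF z] by (rule LIMSEQ_Suc)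
    ultimately show ?thesis using LIMSEQ_unique by blast
  qed
  then show ?thesis using that[OF Vh VM] unfolding W_def by blast
qed

end

section \<open>The double-exponential transformation\<close>

lemma of_real_hyperbolic:
  "of_real (sinh x) = (sinh (of_real x) :: 'a::{banach,real_normed_field})"
  "of_real (cosh x) = (cosh (of_real x) :: 'a::{banach,real_normed_field})"
  "of_real (tanh x) = (tanh (of_real x) :: 'a::{banach,real_normed_field})"
proof -
  show s: "of_real (sinh x) = (sinh (of_real x) :: 'a)"
    by (simp add: sinh_def scaleR_conv_of_real exp_of_real[symmetric] flip: of_real_minus)
  show c: "of_real (cosh x) = (cosh (of_real x) :: 'a)"
    by (simp add: cosh_def scaleR_conv_of_real exp_of_real[symmetric] flip: of_real_minus)
  show "of_real (tanh x) = (tanh (of_real x) :: 'a)"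
    by (simp only: tanh_def of_real_divide s c)
qed

lemma Re_Im_sinh: "Re (sinh z) = sinh (Re z) * cos (Im z)" "Im (sinh z) = cosh (Re z) * sin (Im z)"
  by (simp_all add: sinh_def cosh_def Re_exp Im_exp algebra_simps)

lemma cmod_cosh_le: "cmod (cosh z) \<le> cosh (Re z)"
proof -
  have "cmod (exp z + exp (- z)) \<le> exp (Re z) + exp (- Re z)"
    using norm_triangle_ineq[of "exp z" "exp (- z)"] by simp
  then show ?thesis by (simp add: cosh_def)
qed

lemma cmod_cosh_ge: "sinh \<bar>Re z\<bar> \<le> cmod (cosh z)"
proof -
  have "\<bar>exp (Re z) - exp (- Re z)\<bar> \<le> cmod (exp z + exp (- z))"
    using norm_triangle_ineq3[of "exp z" "- exp (- z)"] by simp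
  moreover have "sinh \<bar>Re z\<bar> = \<bar>exp (Re z) - exp (- Re z)\<bar> / 2"
    by (cases "0 \<le> Re z") (simp_all add: sinh_def abs_if)
  ultimately show ?thesis by (simp add: cosh_def)
qed

text \<open>The derivative of psi wherever cosh(pi/2 sinh x) does not vanish. An explicit formula
  over both fields lets real values be transported to the strip by \<open>of_real\<close>.\<close>

definition de_dpsi :: "real \<Rightarrow> real \<Rightarrow> 'a \<Rightarrow> 'a :: {banach, real_normed_field}" where
  "de_dpsi a b x = of_real ((b - a) / 2) * ((1 - (tanh (of_real (pi / 2) * sinh x))\<^sup>2) * (of_real (pi / 2) * cosh x))"

lemma de_psi_has_field_derivative:
  fixes x :: "'a :: {banach, real_normed_field}"
  assumes "cosh (of_real (pi / 2) * sinh x) \<noteq> 0"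
  shows "(de_psi a b has_field_derivative de_dpsi a b x) (at x)"
proof -
  have "((\<lambda>x. of_real (pi / 2) * sinh x) has_field_derivative of_real (pi / 2) * cosh x) (at x)"
    by (rule DERIV_cmult[OF has_field_derivative_sinh[OF DERIV_ident, simplified]])
  from has_field_derivative_tanh[OF assms this]
  have "((\<lambda>x. of_real ((b - a) / 2) * tanh (of_real (pi / 2) * sinh x) + of_real ((b + a) / 2)) has_field_derivative de_dpsi a b x + 0) (at x)"
    unfolding de_dpsi_def by (intro DERIV_add DERIV_cmult DERIV_const)
  then show ?thesis by (simp add: de_psi_def[abs_def])
qed

lemma of_real_de_psi: "of_real (de_psi a b x) = (de_psi a b (of_real x) :: 'a::{banach,real_normed_field})"
  by (simp only: de_psi_def of_real_add of_real_mult of_real_hyperbolic of_real_eq_id id_apply)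

lemma of_real_de_dpsi: "of_real (de_dpsi a b x) = (de_dpsi a b (of_real x) :: 'a::{banach,real_normed_field})"
  by (simp only: de_dpsi_def of_real_mult of_real_hyperbolic of_real_diff of_real_power of_real_1 of_real_eq_id id_apply)

lemma de_psi_real_derivative: "(de_psi a b has_real_derivative de_dpsi a b x) (at x)"
  by (rule de_psi_has_field_derivative) (simp add: cosh_real_nonzero)

lemma deriv_de_psi: "deriv (de_psi a b) x = de_dpsi a b (x :: real)"
  by (rule DERIV_imp_deriv[OF de_psi_real_derivative])

text \<open>From 1 + tanh w = exp w / cosh w and 1 - tanh w = exp(-w) / cosh w. In this form a lower
  bound for cosh w yields both boundedness of psi and its decay towards the respective end.\<close>

lemma de_psi_minus_ends:
  fixes z :: "'a :: {banach, real_normed_field}"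
  defines "w \<equiv> of_real (pi / 2) * sinh z"
  assumes "cosh w \<noteq> 0"
  shows "de_psi a b z - of_real a = of_real ((b - a) / 2) * (exp w / cosh w)"
    and "of_real b - de_psi a b z = of_real ((b - a) / 2) * (exp (- w) / cosh w)"
proof -
  have 1: "1 + tanh w = exp w / cosh w" "1 - tanh w = exp (- w) / cosh w"
    using assms(2) sinh_plus_cosh[of w] cosh_minus_sinh[of w] by (simp_all add: tanh_def field_simps)
  have "of_real a = of_real ((b + a) / 2) - (of_real ((b - a) / 2) :: 'a)" "of_real b = of_real ((b + a) / 2) + (of_real ((b - a) / 2) :: 'a)"
    unfolding of_real_diff[symmetric] of_real_add[symmetric] by (simp_all add: field_simps)
  then have "de_psi a b z - of_real a = of_real ((b - a) / 2) * (1 + tanh w)" "of_real b - de_psi a b z = of_real ((b - a) / 2) * (1 - tanh w)"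
  proof -
    have "L * T + m - (m - L) = L * (1 + T)" "m + L - (L * T + m) = L * (1 - T)" for L m T :: 'a
      by (simp_all only: ring_distribs) simp_all
    then show "de_psi a b z - of_real a = of_real ((b - a) / 2) * (1 + tanh w)" "of_real b - de_psi a b z = of_real ((b - a) / 2) * (1 - tanh w)"
      unfolding de_psi_def w_def[symmetric]
      using \<open>of_real a = of_real ((b + a) / 2) - (of_real ((b - a) / 2) :: 'a)\<close> \<open>of_real b = of_real ((b + a) / 2) + (of_real ((b - a) / 2) :: 'a)\<close> by (simp_all only:)
  qed
  then show "de_psi a b z - of_real a = of_real ((b - a) / 2) * (exp w / cosh w)"
    "of_real b - de_psi a b z = of_real ((b - a) / 2) * (exp (- w) / cosh w)" by (simp_all only: 1)
qed

text \<open>A zero requires exp(2w) = -1, so w is purely imaginary; as cos(Im z) > 0, this forces Re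
  z = 0, and then w = i q with |2q| < pi, too small for cos(2q) = -1. The zero at z = i pi / 2 sits
  on the excluded boundary.\<close>

lemma cosh_sinh_strip_nonzero:
  assumes "\<bar>Im z\<bar> < pi / 2"
  shows "cosh (of_real (pi / 2) * sinh z :: complex) \<noteq> 0"
proof
  let ?w = "of_real (pi / 2) * sinh z"
  assume "cosh ?w = 0"
  then have e: "exp ?w ^ 2 = - 1" by (simp add: cosh_zero_iff)
  then have "cmod (exp ?w) ^ 2 = 1" unfolding norm_power[symmetric] by simp
  then have "cmod (exp ?w) = 1" by (simp add: power2_eq_1_iff) (smt (verit) exp_gt_zero norm_exp_eq_Re)
  then have p: "Re ?w = 0" by simp
  have c: "0 < cos (Im z)" using assms by (intro cos_gt_zero_pi) auto
  have "sinh (Re z) = 0" using p c by (simp add: Re_Im_sinh)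
  then have x: "Re z = 0" by simp
  define q where "q = Im ?w"
  have q: "q = pi / 2 * sin (Im z)" by (simp add: q_def Re_Im_sinh x)
  have "\<bar>sin (Im z)\<bar> < 1"
  proof -
    have "(sin (Im z))\<^sup>2 < 1" using c sin_cos_squared_add[of "Im z"] by (smt (verit) zero_less_power)
    then show ?thesis by (simp add: abs_square_less_1)
  qed
  then have "\<bar>2 * q\<bar> < pi" unfolding q by (simp add: abs_mult)
  then have "cos pi < cos \<bar>2 * q\<bar>" by (intro cos_monotone_0_pi) auto
  then have "- 1 < cos (2 * q)" by (simp add: abs_if split: if_splits)
  moreover have "exp (of_nat 2 * ?w) = - 1" using e by (simp only: exp_of_nat_mult)
  then have "Re (exp (2 * ?w)) = - 1" by simp
  then have "exp (Re (2 * ?w)) * cos (Im (2 * ?w)) = - 1" by (simp only: Re_exp)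
  moreover have "Re (2 * ?w) = 0" "Im (2 * ?w) = 2 * q" using p by (simp_all add: q_def)
  ultimately show False by (simp only: exp_zero mult_1_left)
qed

text \<open>Where |Re w| \<ge> 1, the modulus of cosh w is at least sinh |Re w|, comparable to exp
  |Re w|. The rest of the closed strip lies in a compact set, on which a non-vanishing continuous
  function has a positive minimum.\<close>

lemma cosh_sinh_strip_lower_bound:
  assumes d: "0 < d" "d < pi / 2"
  obtains c where "0 < c" "\<And>z. \<bar>Im z\<bar> \<le> d \<Longrightarrow> c * exp \<bar>Re (of_real (pi / 2) * sinh z)\<bar> \<le> cmod (cosh (of_real (pi / 2) * sinh z))"
proof -
  let ?w = "\<lambda>z. of_real (pi / 2) * sinh z :: complex"
  have cd: "0 < cos d" using d by (intro cos_gt_zero_pi) auto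
  have cy: "cos d \<le> cos y" if "\<bar>y\<bar> \<le> d" for y
    using cos_monotone_0_pi_le[of "\<bar>y\<bar>" d] that d by simp
  \<comment> \<open>From |Re w| \<ge> (pi / 2) cos(d) |Re z|: the condition |Re w| < 1 confines |Re
    z| to values below X.\<close>
  define X where "X = 2 / (pi * cos d)"
  have X: "0 < X" using cd by (simp add: X_def)
  define K where "K = cbox (Complex (- X) (- d)) (Complex X d)"
  have inK: "z \<in> K" if z: "\<bar>Im z\<bar> \<le> d" "\<bar>Re (?w z)\<bar> < 1" for z
  proof -
    have "pi / 2 * (\<bar>sinh (Re z)\<bar> * cos (Im z)) < 1"
      using z(2) cy[OF z(1)] cd by (simp add: Re_Im_sinh abs_mult)
    moreover have "pi / 2 * (\<bar>Re z\<bar> * cos d) \<le> pi / 2 * (\<bar>sinh (Re z)\<bar> * cos (Im z))"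
    proof (intro mult_left_mono mult_mono cy z)
      show "\<bar>Re z\<bar> \<le> \<bar>sinh (Re z)\<bar>" by (rule abs_le_abs_sinh)
    qed (use cd in auto)
    ultimately have "pi / 2 * (\<bar>Re z\<bar> * cos d) < 1" by linarith
    then have "\<bar>Re z\<bar> < X" using cd by (simp add: X_def field_simps)
    then show ?thesis using z(1) by (auto simp: K_def in_cbox_complex_iff)
  qed
  have "continuous_on K (\<lambda>z. cmod (cosh (?w z)))"
    unfolding cosh_def sinh_def by (intro continuous_intros)
  moreover have "compact K" unfolding K_def by (rule compact_cbox)
  moreover have "K \<noteq> {}"
  proof -
    have "0 \<in> K" unfolding K_def in_cbox_complex_iff using X d by simp
    then show ?thesis by blast
  qed
  ultimately have "\<exists>x\<in>K. \<forall>y\<in>K. cmod (cosh (?w x)) \<le> cmod (cosh (?w y))"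
    by (intro continuous_attains_inf)
  then obtain z0 where z0: "z0 \<in> K" "\<And>z. z \<in> K \<Longrightarrow> cmod (cosh (?w z0)) \<le> cmod (cosh (?w z))" by blast
  define m where "m = cmod (cosh (?w z0))"
  have "\<bar>Im z0\<bar> < pi / 2" using z0(1) d by (auto simp: K_def in_cbox_complex_iff)
  from cosh_sinh_strip_nonzero[OF this] have m: "0 < m" by (simp add: m_def)
  define c where "c = min (1 / 4) (m / exp 1)"
  have c: "0 < c" using m by (simp add: c_def)
  have "c * exp \<bar>Re (?w z)\<bar> \<le> cmod (cosh (?w z))" if z: "\<bar>Im z\<bar> \<le> d" for z
  proof (cases "\<bar>Re (?w z)\<bar> < 1")
    case True
    have "c * exp \<bar>Re (?w z)\<bar> \<le> m / exp 1 * exp 1"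
      using True m by (intro mult_mono) (auto simp: c_def)
    also have "\<dots> = m" by simp
    also have "\<dots> \<le> cmod (cosh (?w z))" unfolding m_def by (rule z0(2)[OF inK[OF z True]])
    finally show ?thesis .
  next
    case False
    define p where "p = \<bar>Re (?w z)\<bar>"
    have p: "1 \<le> p" using False by (simp add: p_def)
    have "2 \<le> exp p" using exp_ge_add_one_self[of p] p by linarith
    then have "exp (- p) \<le> 1 / 2" by (simp add: exp_minus inverse_eq_divide divide_le_eq)
    then have "exp p / 4 \<le> sinh p" using \<open>2 \<le> exp p\<close> by (simp add: sinh_def)
    moreover have "c * exp p \<le> 1 / 4 * exp p" unfolding c_def by (intro mult_right_mono min.cobounded1) simp
    ultimately show ?thesis using cmod_cosh_ge[of "?w z"] unfolding p_def[symmetric] by linarith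
  qed
  with c show ?thesis by (rule that)
qed

text \<open>With w = pi/2 sinh z, the real part of w grows like \<kappa> cosh(Re z) with \<kappa> =
  (pi / 2) cos d, and all quantities are governed by exp(-2 |Re w|). Half of the resulting exponent
  2 \<kappa> is given up to absorb the factor cosh z in psi'.\<close>

lemma de_psi_strip_bounds:
  assumes ab: "a < b" and d: "0 < d" "d < pi / 2"
  obtains \<kappa> A where "0 < \<kappa>" "0 < A"
    "\<And>z. z \<in> strip d \<Longrightarrow> cmod (de_psi a b z - of_real a) \<le> A"
    "\<And>z. z \<in> strip d \<Longrightarrow> cmod (of_real b - de_psi a b z) \<le> A"
    "\<And>z. z \<in> strip d \<Longrightarrow> Re z \<le> 0 \<Longrightarrow> cmod (de_psi a b z - of_real a) \<le> A * exp (- \<kappa> * cosh (Re z))"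
    "\<And>z. z \<in> strip d \<Longrightarrow> 0 \<le> Re z \<Longrightarrow> cmod (of_real b - de_psi a b z) \<le> A * exp (- \<kappa> * cosh (Re z))"
    "\<And>z. z \<in> strip d \<Longrightarrow> cmod (de_dpsi a b z) \<le> A * exp (- \<kappa> * cosh (Re z))"
    "\<And>z. z \<in> strip d \<Longrightarrow> (de_psi a b has_field_derivative de_dpsi a b z) (at z)"
proof -
  let ?w = "\<lambda>z. of_real (pi / 2) * sinh z :: complex"
  obtain c where c: "0 < c" "\<And>z. \<bar>Im z\<bar> \<le> d \<Longrightarrow> c * exp \<bar>Re (?w z)\<bar> \<le> cmod (cosh (?w z))"
    using cosh_sinh_strip_lower_bound[OF d] by blast
  have cd: "0 < cos d" using d by (intro cos_gt_zero_pi) auto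
  define \<kappa> where "\<kappa> = pi / 2 * cos d"
  have \<kappa>: "0 < \<kappa>" using cd by (simp add: \<kappa>_def)
  have nz: "cosh (?w z) \<noteq> 0" if "z \<in> strip d" for z
    using that d by (intro cosh_sinh_strip_nonzero) (auto simp: strip_def)
  have cl: "c * exp \<bar>Re (?w z)\<bar> \<le> cmod (cosh (?w z))" if "z \<in> strip d" for z
    using that c(2) by (simp add: strip_def)
  have rw: "Re (?w z) = pi / 2 * (sinh (Re z) * cos (Im z))" for z by (simp add: Re_Im_sinh)
  have cy: "cos d \<le> cos (Im z)" if "z \<in> strip d" for z
    using cos_monotone_0_pi_le[of "\<bar>Im z\<bar>" d] that d by (simp add: strip_def)
  \<comment> \<open>The loss of 1 from cosh makes the comparison valid near Re z = 0 as well, where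
    sinh vanishes; it costs only the constant factor exp(2 \<kappa>).\<close>
  have pl: "\<kappa> * (cosh (Re z) - 1) \<le> \<bar>Re (?w z)\<bar>" if z: "z \<in> strip d" for z
  proof -
    have 1: "cosh x - 1 \<le> \<bar>sinh x\<bar>" for x :: real
    proof -
      have "cosh y - sinh y \<le> 1" if "0 \<le> y" for y :: real using that by (simp add: cosh_minus_sinh)
      from this[of "\<bar>x\<bar>"] show ?thesis by (cases "0 \<le> x") auto
    qed
    have "cos d * (cosh (Re z) - 1) \<le> cos (Im z) * \<bar>sinh (Re z)\<bar>"
      using cy[OF z] cd cosh_real_ge_1[of "Re z"] by (intro mult_mono 1) auto
    then have "pi / 2 * (cos d * (cosh (Re z) - 1)) \<le> pi / 2 * (cos (Im z) * \<bar>sinh (Re z)\<bar>)"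
      by (intro mult_left_mono) auto
    also have "\<dots> = \<bar>Re (?w z)\<bar>" unfolding rw using cy[OF z] cd by (simp add: abs_mult)
    finally show ?thesis by (simp only: \<kappa>_def mult.assoc)
  qed
  have ep: "exp (- (2 * \<bar>Re (?w z)\<bar>)) \<le> exp (2 * \<kappa>) * exp (- (2 * \<kappa>) * cosh (Re z))" if z: "z \<in> strip d" for z
    using pl[OF z] unfolding exp_add[symmetric] exp_le_cancel_iff by (simp add: algebra_simps)
  define L where "L = (b - a) / 2"
  have L: "0 < L" using ab by (simp add: L_def)
  have e1: "cmod (exp v / cosh (?w z)) \<le> exp (Re v - \<bar>Re (?w z)\<bar>) / c" if z: "z \<in> strip d" for v z
  proof -
    have "cmod (exp v / cosh (?w z)) \<le> exp (Re v) / (c * exp \<bar>Re (?w z)\<bar>)"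
      unfolding norm_divide norm_exp_eq_Re
      by (intro divide_left_mono[OF cl[OF z] exp_ge_zero] mult_pos_pos zero_less_norm_iff[THEN iffD2] nz z c exp_gt_zero)
    then show ?thesis by (simp only: exp_diff divide_divide_eq_left mult.commute)
  qed
  have ends: "cmod (de_psi a b z - of_real a) \<le> L * (exp (Re (?w z) - \<bar>Re (?w z)\<bar>) / c)"
     "cmod (of_real b - de_psi a b z) \<le> L * (exp (- Re (?w z) - \<bar>Re (?w z)\<bar>) / c)" if z: "z \<in> strip d" for z
  proof -
    have "cmod (de_psi a b z - of_real a) = L * cmod (exp (?w z) / cosh (?w z))"
      unfolding de_psi_minus_ends(1)[OF nz[OF z]] norm_mult norm_of_real L_def[symmetric] using L by simp
    also have "\<dots> \<le> L * (exp (Re (?w z) - \<bar>Re (?w z)\<bar>) / c)" by (intro mult_left_mono e1 z less_imp_le[OF L])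
    finally show "cmod (de_psi a b z - of_real a) \<le> L * (exp (Re (?w z) - \<bar>Re (?w z)\<bar>) / c)" .
    have "cmod (of_real b - de_psi a b z) = L * cmod (exp (- ?w z) / cosh (?w z))"
      unfolding de_psi_minus_ends(2)[OF nz[OF z]] norm_mult norm_of_real L_def[symmetric] using L by simp
    also have "\<dots> \<le> L * (exp (Re (- ?w z) - \<bar>Re (?w z)\<bar>) / c)" by (intro mult_left_mono e1 z less_imp_le[OF L])
    finally show "cmod (of_real b - de_psi a b z) \<le> L * (exp (- Re (?w z) - \<bar>Re (?w z)\<bar>) / c)" by simp
  qed
  define A where "A = L / c + L / c * exp (2 * \<kappa>) + L * (pi / 2) / c\<^sup>2 * exp (2 * \<kappa>) / \<kappa>"
  have Lc: "0 \<le> L / c" "0 \<le> L / c * exp (2 * \<kappa>)" "0 \<le> L * (pi / 2) / c\<^sup>2 * exp (2 * \<kappa>) / \<kappa>" using L c \<kappa> by simp_all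
  have A0: "0 < A" unfolding A_def using L c Lc by (intro add_pos_nonneg) auto
  have A1: "L / c \<le> A" "L / c * exp (2 * \<kappa>) \<le> A" "L * (pi / 2) / c\<^sup>2 * exp (2 * \<kappa>) / \<kappa> \<le> A" using Lc unfolding A_def by linarith+
  have kk: "exp (- (2 * \<kappa>) * cosh x) \<le> exp (- \<kappa> * cosh x)" for x :: real
    using \<kappa> cosh_real_pos[of x] by simp
  have half: "L * (exp t / c) \<le> A * exp (- \<kappa> * cosh (Re z))" if z: "z \<in> strip d" and t: "t = - (2 * \<bar>Re (?w z)\<bar>)" for t z
  proof -
    have "L * (exp t / c) = L / c * exp t" by simp
    also have "\<dots> \<le> L / c * (exp (2 * \<kappa>) * exp (- (2 * \<kappa>) * cosh (Re z)))" unfolding t by (intro mult_left_mono ep z Lc)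
    also have "\<dots> = L / c * exp (2 * \<kappa>) * exp (- (2 * \<kappa>) * cosh (Re z))" by (simp only: mult.assoc)
    also have "\<dots> \<le> A * exp (- \<kappa> * cosh (Re z))" by (intro mult_mono A1 kk) (use A0 in auto)
    finally show ?thesis .
  qed
  have full: "L * (exp t / c) \<le> A" if "t \<le> 0" for t
  proof -
    have "L / c * exp t \<le> L / c * 1" using that by (intro mult_left_mono Lc) simp
    then show ?thesis using A1(1) by simp
  qed
  have sg: "Re (?w z) \<le> 0" if "z \<in> strip d" "Re z \<le> 0" for z
    unfolding rw using cy[OF that(1)] cd that(2) by (intro mult_nonneg_nonpos mult_nonpos_nonneg) auto
  have sg': "0 \<le> Re (?w z)" if "z \<in> strip d" "0 \<le> Re z" for z
    unfolding rw using cy[OF that(1)] cd that(2) by (intro mult_nonneg_nonneg) auto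
  show ?thesis
  proof (rule that[OF \<kappa> A0])
    fix z assume z: "z \<in> strip d"
    show "cmod (de_psi a b z - of_real a) \<le> A" using ends(1)[OF z] full[of "Re (?w z) - \<bar>Re (?w z)\<bar>"] by linarith
    show "cmod (of_real b - de_psi a b z) \<le> A" using ends(2)[OF z] full[of "- Re (?w z) - \<bar>Re (?w z)\<bar>"] by linarith
    show "cmod (de_psi a b z - of_real a) \<le> A * exp (- \<kappa> * cosh (Re z))" if "Re z \<le> 0"
      using ends(1)[OF z] half[OF z, of "Re (?w z) - \<bar>Re (?w z)\<bar>"] sg[OF z that] by linarith
    show "cmod (of_real b - de_psi a b z) \<le> A * exp (- \<kappa> * cosh (Re z))" if "0 \<le> Re z"
      using ends(2)[OF z] half[OF z, of "- Re (?w z) - \<bar>Re (?w z)\<bar>"] sg'[OF z that] by linarith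
    show "(de_psi a b has_field_derivative de_dpsi a b z) (at z)" by (rule de_psi_has_field_derivative[OF nz[OF z]])
    have "1 - (tanh (?w z))\<^sup>2 = 1 / (cosh (?w z))\<^sup>2"
    proof -
      have "1 - (S / C)\<^sup>2 = 1 / C\<^sup>2" if "C\<^sup>2 = S\<^sup>2 + 1" "C \<noteq> 0" for S C :: complex
      proof -
        have "1 - (S / C)\<^sup>2 = (C\<^sup>2 - S\<^sup>2) / C\<^sup>2" using that(2) by (simp add: power_divide diff_divide_distrib)
        then show ?thesis using that(1) by simp
      qed
      from this[OF cosh_square_eq nz[OF z]] show ?thesis unfolding tanh_def .
    qed
    then have "de_dpsi a b z = of_real L * (of_real (pi / 2) * cosh z / (cosh (?w z))\<^sup>2)"
      unfolding de_dpsi_def L_def by simp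
    then have "cmod (de_dpsi a b z) = L * (pi / 2 * cmod (cosh z) / (cmod (cosh (?w z)))\<^sup>2)"
      using L by (simp only: norm_mult norm_divide norm_power norm_of_real abs_of_pos pi_gt_zero abs_divide abs_numeral)
    also have "\<dots> \<le> L * (pi / 2 * cosh (Re z) / (c * exp \<bar>Re (?w z)\<bar>)\<^sup>2)"
      using c by (intro mult_left_mono frac_le mult_left_mono cmod_cosh_le power_mono cl z less_imp_le[OF L]) auto
    also have "\<dots> = L * (pi / 2) / c\<^sup>2 * (cosh (Re z) * exp (- (2 * \<bar>Re (?w z)\<bar>)))"
    proof -
      have "L * (q * ch / (c * exp p)\<^sup>2) = L * q / c\<^sup>2 * (ch * exp (- (2 * p)))" for q ch p :: real
      proof -
        have "exp (- (2 * p)) = inverse ((exp p)\<^sup>2)" by (simp only: exp_minus exp_double)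
        then show ?thesis by (simp only: power_mult_distrib divide_inverse inverse_mult_distrib mult_ac)
      qed
      then show ?thesis .
    qed
    also have "\<dots> \<le> L * (pi / 2) / c\<^sup>2 * (1 / \<kappa> * exp (\<kappa> * cosh (Re z)) * (exp (2 * \<kappa>) * exp (- (2 * \<kappa>) * cosh (Re z))))"
    proof (intro mult_left_mono mult_mono ep z)
      have "\<kappa> * cosh (Re z) \<le> exp (\<kappa> * cosh (Re z))" using exp_ge_add_one_self[of "\<kappa> * cosh (Re z)"] by linarith
      then show "cosh (Re z) \<le> 1 / \<kappa> * exp (\<kappa> * cosh (Re z))" using \<kappa> by (simp add: pos_le_divide_eq mult.commute)
    qed (use L c \<kappa> in auto)
    also have "\<dots> = L * (pi / 2) / c\<^sup>2 * exp (2 * \<kappa>) / \<kappa> * (exp (\<kappa> * cosh (Re z)) * exp (- (2 * \<kappa>) * cosh (Re z)))" by simp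
    also have "exp (\<kappa> * cosh (Re z)) * exp (- (2 * \<kappa>) * cosh (Re z)) = exp (- \<kappa> * cosh (Re z))"
      unfolding exp_add[symmetric] by simp
    also have "L * (pi / 2) / c\<^sup>2 * exp (2 * \<kappa>) / \<kappa> * exp (- \<kappa> * cosh (Re z)) \<le> A * exp (- \<kappa> * cosh (Re z))"
      by (intro mult_right_mono A1) simp
    finally show "cmod (de_dpsi a b z) \<le> A * exp (- \<kappa> * cosh (Re z))" .
  qed
qed

lemma de_psi_real_properties:
  assumes "a < b"
  shows "a < de_psi a b x" "de_psi a b x < b" "0 < de_dpsi a b (x::real)" "strict_mono (de_psi a b :: real \<Rightarrow> real)"
    and "(de_psi a b \<longlongrightarrow> a) at_bot" "(de_psi a b \<longlongrightarrow> b) at_top"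
proof -
  have "(b - a) / 2 * tanh t > (b - a) / 2 * (- 1)" "(b - a) / 2 * tanh t < (b - a) / 2 * 1" for t
    using assms tanh_real_gt_neg1[of t] tanh_real_lt_1[of t] by (intro mult_strict_left_mono; simp)+
  from this[of "pi / 2 * sinh x"] show "a < de_psi a b x" "de_psi a b x < b" by (simp_all add: de_psi_def field_simps)
  have "(tanh (pi / 2 * sinh x))\<^sup>2 < 1"
    using tanh_real_gt_neg1[of "pi / 2 * sinh x"] tanh_real_lt_1[of "pi / 2 * sinh x"] by (simp add: abs_square_less_1 abs_less_iff)
  then show "0 < de_dpsi a b x" using assms cosh_real_pos[of x] by (simp add: de_dpsi_def)
  show "strict_mono (de_psi a b :: real \<Rightarrow> real)"
    using assms by (intro strict_monoI) (simp add: de_psi_def)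
  have s: "filterlim (\<lambda>x::real. pi / 2 * sinh x) at_top at_top" "filterlim (\<lambda>x::real. pi / 2 * sinh x) at_bot at_bot"
    by (rule filterlim_tendsto_pos_mult_at_top[OF tendsto_const _ sinh_real_at_top])
       (simp, rule filterlim_tendsto_pos_mult_at_bot[OF tendsto_const _ sinh_real_at_bot], simp)
  have t: "((tanh :: real \<Rightarrow> real) \<longlongrightarrow> 1) at_top" "((tanh :: real \<Rightarrow> real) \<longlongrightarrow> - 1) at_bot"
    by (rule tanh_real_at_top tanh_real_at_bot)+
  have "((\<lambda>x. (b - a) / 2 * tanh (pi / 2 * sinh x) + (b + a) / 2) \<longlongrightarrow> (b - a) / 2 * (- 1) + (b + a) / 2) at_bot"
    by (intro tendsto_add tendsto_mult tendsto_const filterlim_compose[OF t(2) s(2)])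
  then show "(de_psi a b \<longlongrightarrow> a) at_bot" by (simp add: de_psi_def[abs_def] field_simps)
  have "((\<lambda>x. (b - a) / 2 * tanh (pi / 2 * sinh x) + (b + a) / 2) \<longlongrightarrow> (b - a) / 2 * 1 + (b + a) / 2) at_top"
    by (intro tendsto_add tendsto_mult tendsto_const filterlim_compose[OF t(1) s(1)])
  then show "(de_psi a b \<longlongrightarrow> b) at_top" by (simp add: de_psi_def[abs_def] field_simps)
qed

lemma de_phi_de_psi: "a < b \<Longrightarrow> de_phi a b (de_psi a b x) = x"
  unfolding de_phi_def by (rule inv_f_f) (rule strict_mono_imp_inj_on[OF de_psi_real_properties(4)])

lemma de_psi_de_phi:
  assumes "a < b" "a < t" "t < b"
  shows "de_psi a b (de_phi a b t) = t"
proof -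
  have "\<forall>\<^sub>F x in at_bot. de_psi a b x < t" using de_psi_real_properties(5)[OF assms(1)] assms(2) by (rule order_tendstoD)
  then obtain x1 where x1: "de_psi a b x1 < t" by (auto simp: eventually_at_bot_linorder)
  have "\<forall>\<^sub>F x in at_top. t < de_psi a b x" using de_psi_real_properties(6)[OF assms(1)] assms(3) by (rule order_tendstoD)
  then obtain x2 where x2: "t < de_psi a b x2" by (auto simp: eventually_at_top_linorder)
  have "de_psi a b x1 < de_psi a b x2" using x1 x2 by linarith
  then have x12: "x1 \<le> x2" using strict_mono_less[OF de_psi_real_properties(4)[OF assms(1)]] by simp
  have "\<exists>x\<ge>x1. x \<le> x2 \<and> de_psi a b x = t"
    by (rule IVT') (use x1 x2 x12 DERIV_isCont[OF de_psi_real_derivative] in \<open>auto intro!: continuous_at_imp_continuous_on\<close>)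
  then show ?thesis unfolding de_phi_def by (auto intro!: f_inv_into_f)
qed

section \<open>Analytic continuation of the solution\<close>

lemma interval_point_simps:
  assumes "a < b"
  shows "interval_point a b a = Left_End" "interval_point a b b = Right_End"
    "interval_point a b (de_psi a b x) = Inner (of_real x)"
  using assms de_psi_real_properties(1,2)[OF assms, of x] by (simp_all add: interval_point_def de_phi_de_psi)

text \<open>The change of variables r = psi(s), stated as a derivative together with a limit at
  -infinity: this is the form that the estimates on half-lines and the quadrature bound
  accept.\<close>

lemma integral_de_psi_substitution:
  fixes f :: "real \<Rightarrow> complex"
  assumes ab: "a < b" and f: "continuous_on {a..b} f"
  shows "((\<lambda>s. integral {a..de_psi a b s} f) has_vector_derivative de_dpsi a b s *\<^sub>R f (de_psi a b s)) (at s)"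
    and "((\<lambda>s. integral {a..de_psi a b s} f) \<longlongrightarrow> 0) at_bot"
proof -
  note p = de_psi_real_properties[OF ab]
  have in_ab: "de_psi a b s \<in> {a..b}" for s using p(1,2)[of s] by simp
  have "((\<lambda>t. integral {a..t} f) has_vector_derivative f (de_psi a b s)) (at (de_psi a b s) within {a..b})"
    by (rule integral_has_vector_derivative[OF f in_ab])
  moreover have "at (de_psi a b s) within {a..b} = at (de_psi a b s)" using p(1,2)[of s] by (intro at_within_interior) auto
  ultimately have "((\<lambda>t. integral {a..t} f) has_vector_derivative f (de_psi a b s)) (at (de_psi a b s))" by simp
  from vector_diff_chain_at[OF de_psi_real_derivative[unfolded has_real_derivative_iff_has_vector_derivative] this]
  show "((\<lambda>s. integral {a..de_psi a b s} f) has_vector_derivative de_dpsi a b s *\<^sub>R f (de_psi a b s)) (at s)"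
    by (simp add: o_def)
  have "continuous_on {a..b} (\<lambda>t. integral {a..t} f)"
    using indefinite_integral_continuous_1[OF integrable_continuous_real[OF f]] .
  then have "\<forall>x\<in>{a..b}. ((\<lambda>t. integral {a..t} f) \<longlongrightarrow> integral {a..x} f) (at x within {a..b})"
    by (simp only: continuous_on_def)
  from bspec[OF this, of a] ab
  have "((\<lambda>t. integral {a..t} f) \<longlongrightarrow> integral {a..a} f) (at a within {a..b})" by simp
  moreover have "filterlim (de_psi a b) (at a within {a..b}) at_bot"
    unfolding filterlim_at using p(1,2,5) in_ab by (auto simp: less_imp_neq[symmetric])
  ultimately show "((\<lambda>s. integral {a..de_psi a b s} f) \<longlongrightarrow> 0) at_bot"
    using filterlim_compose by fastforce
qed

lemma continuous_bounded_interval: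
  fixes f :: "real \<Rightarrow> complex"
  assumes "continuous_on {a..b} f"
  obtains M where "0 < M" "\<And>t. t \<in> {a..b} \<Longrightarrow> cmod (f t) \<le> M"
proof -
  have "bounded (f ` {a..b})" using assms by (intro compact_imp_bounded compact_continuous_image) auto
  then show ?thesis using that unfolding bounded_pos by auto
qed

lemma powr_exp_bound:
  fixes x A \<alpha> t :: real
  assumes "0 \<le> x" "x \<le> A * exp t" "0 < A" "0 < \<alpha>"
  shows "x powr \<alpha> \<le> A powr \<alpha> * exp (\<alpha> * t)"
proof -
  have "x powr \<alpha> \<le> (A * exp t) powr \<alpha>" using assms by (intro powr_mono2) auto
  also have "\<dots> = A powr \<alpha> * exp (\<alpha> * t)" using assms by (simp add: powr_mult powr_def[of "exp t"])
  finally show ?thesis .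
qed

locale volterra_problem =
  fixes a b \<alpha> d :: real
    and g :: "surface_point \<Rightarrow> complex"
    and k :: "surface_point \<Rightarrow> surface_point \<Rightarrow> complex"
    and u :: "real \<Rightarrow> complex"
  assumes ab: "a < b" and \<alpha>: "0 < \<alpha>" "\<alpha> \<le> 1" and d: "0 < d" "d < pi / 2"
    and k_cont: "continuous_on ({a..b} \<times> {a..b}) (\<lambda>(t, s). k (interval_point a b t) (interval_point a b s))"
    and k_hol2: "\<forall>z\<in>de_surface d. H_infty d (\<lambda>w. k z w)"
    and k_hol1: "\<forall>w\<in>de_surface d. H_infty d (\<lambda>z. k z w)"
    and g_M: "M_space a b \<alpha> d g"
    and k_M: "M_space_uniform a b \<alpha> d k"
    and u_cont: "continuous_on {a..b} u"
    and u_eq: "\<forall>t\<in>{a..b}. u t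
           - integral {a..t} (\<lambda>s. k (interval_point a b t) (interval_point a b s) * u s)
           = g (interval_point a b t)"
begin

lemma strip_surface: "z \<in> strip d \<Longrightarrow> Inner z \<in> de_surface d"
  by (simp add: de_surface_def)

text \<open>The bound for a section of k might depend on the section. The Hoelder condition, uniform
  in w, compares k(z, w) with k(0, w) through the value at the left end, and the single section k(0,
  .) is bounded.\<close>

lemma k_bounded: obtains K where "0 < K" "\<And>z w. z \<in> strip d \<Longrightarrow> w \<in> strip d \<Longrightarrow> cmod (k (Inner z) (Inner w)) \<le> K"
proof -
  obtain \<kappa> A where A: "0 < A" "\<And>z. z \<in> strip d \<Longrightarrow> cmod (de_psi a b z - of_real a) \<le> A"
    using de_psi_strip_bounds[OF ab d] by metis
  obtain L where L: "\<And>z w. z \<in> de_surface d \<Longrightarrow> w \<in> de_surface d \<Longrightarrow> norm (k z w - k Left_End w) \<le> L * norm (surface_value a b z - of_real a) powr \<alpha>"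
    using k_M unfolding M_space_uniform_def by blast
  have L': "cmod (k (Inner z) (Inner w) - k Left_End (Inner w)) \<le> \<bar>L\<bar> * A powr \<alpha>" if "z \<in> strip d" "w \<in> strip d" for z w
  proof -
    have "cmod (k (Inner z) (Inner w) - k Left_End (Inner w)) \<le> L * cmod (de_psi a b z - of_real a) powr \<alpha>"
      using L[of "Inner z" "Inner w"] that by (simp add: strip_surface)
    also have "\<dots> \<le> \<bar>L\<bar> * A powr \<alpha>" using A that \<alpha> by (intro mult_mono powr_mono2) auto
    finally show ?thesis .
  qed
  have z0: "0 \<in> strip d" using d by (simp add: strip_def)
  have "bounded ((\<lambda>w. k (Inner 0) w) ` de_surface d)" using k_hol2 strip_surface[OF z0] unfolding H_infty_def by blast
  then obtain K0 where K0: "0 < K0" "\<And>w. w \<in> strip d \<Longrightarrow> cmod (k (Inner 0) (Inner w)) \<le> K0"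
    unfolding bounded_pos using strip_surface by blast
  show ?thesis
  proof (rule that[of "K0 + 2 * (\<bar>L\<bar> * A powr \<alpha>)"])
    show "0 < K0 + 2 * (\<bar>L\<bar> * A powr \<alpha>)" using K0(1) by (intro add_pos_nonneg) auto
    fix z w assume zw: "z \<in> strip d" "w \<in> strip d"
    have "k (Inner z) (Inner w) = (k (Inner z) (Inner w) - k Left_End (Inner w)) - (k (Inner 0) (Inner w) - k Left_End (Inner w)) + k (Inner 0) (Inner w)" by simp
    then have "cmod (k (Inner z) (Inner w)) \<le> cmod (k (Inner z) (Inner w) - k Left_End (Inner w)) + cmod (k (Inner 0) (Inner w) - k Left_End (Inner w)) + cmod (k (Inner 0) (Inner w))"
      using norm_triangle_ineq[of "(k (Inner z) (Inner w) - k Left_End (Inner w)) - (k (Inner 0) (Inner w) - k Left_End (Inner w))" "k (Inner 0) (Inner w)"]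
        norm_triangle_ineq4[of "k (Inner z) (Inner w) - k Left_End (Inner w)" "k (Inner 0) (Inner w) - k Left_End (Inner w)"] by simp
    then show "cmod (k (Inner z) (Inner w)) \<le> K0 + 2 * (\<bar>L\<bar> * A powr \<alpha>)"
      using L'[OF zw] L'[OF z0 zw(2)] K0(2)[OF zw(2)] by linarith
  qed
qed

lemma k_section_cont: "t \<in> {a..b} \<Longrightarrow> continuous_on {a..b} (\<lambda>s. k (interval_point a b t) (interval_point a b s) * u s)"
  by (intro continuous_on_mult u_cont continuous_on_compose2[OF k_cont, of _ "\<lambda>s. (t, s)", simplified]) (auto intro: continuous_intros)

text \<open>In the variable zeta the kernel is k times psi'. Solving the equation on the strip gives
  some \<open>U\<close>; that it extends u is a separate contraction argument on the real line. The
  decay follows by comparing the equation for \<open>U\<close> with the equation for u at t = a and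
  t = b.\<close>

lemma solution_extension:
  obtains U \<mu> B where "U holomorphic_on strip d" "0 < \<mu>" "0 < B"
    "\<And>z. z \<in> strip d \<Longrightarrow> cmod (U z) \<le> B"
    "\<And>x. U (of_real x) = u (de_psi a b x)"
    "\<And>z. z \<in> strip d \<Longrightarrow> Re z \<le> 0 \<Longrightarrow> cmod (U z - u a) \<le> B * exp (- \<mu> * cosh (Re z))"
    "\<And>z. z \<in> strip d \<Longrightarrow> 0 \<le> Re z \<Longrightarrow> cmod (U z - u b) \<le> B * exp (- \<mu> * cosh (Re z))"
proof -
  obtain \<kappa> A where \<kappa>: "0 < \<kappa>" and A: "0 < A"
    and pa: "\<And>z. z \<in> strip d \<Longrightarrow> Re z \<le> 0 \<Longrightarrow> cmod (de_psi a b z - of_real a) \<le> A * exp (- \<kappa> * cosh (Re z))"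
    and pb: "\<And>z. z \<in> strip d \<Longrightarrow> 0 \<le> Re z \<Longrightarrow> cmod (of_real b - de_psi a b z) \<le> A * exp (- \<kappa> * cosh (Re z))"
    and dp: "\<And>z. z \<in> strip d \<Longrightarrow> cmod (de_dpsi a b z) \<le> A * exp (- \<kappa> * cosh (Re z))"
    and hp: "\<And>z. z \<in> strip d \<Longrightarrow> (de_psi a b has_field_derivative de_dpsi a b z) (at z)"
    using de_psi_strip_bounds[OF ab d] by metis
  obtain K where K: "0 < K" "\<And>z w. z \<in> strip d \<Longrightarrow> w \<in> strip d \<Longrightarrow> cmod (k (Inner z) (Inner w)) \<le> K"
    using k_bounded by blast
  note p = de_psi_real_properties[OF ab]
  note ip = interval_point_simps[OF ab]
  have in_ab: "de_psi a b s \<in> {a..b}" for s using p(1,2)[of s] by simp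
  have rs: "complex_of_real x \<in> strip d" for x using d by (simp add: strip_def)
  have y0: "\<bar>0::real\<bar> < d" using d by simp
  have re: "Complex s 0 = complex_of_real s" for s by (simp add: complex_of_real_def)
  define Kf where "Kf z w = k (Inner z) (Inner w) * de_dpsi a b w" for z w
  define c where "c = K * (A * (2 / \<kappa>))"
  have c: "0 < c" using K A \<kappa> by (simp add: c_def)
  have dq: "cmod (de_dpsi a b w) \<le> A * (2 / \<kappa>) / (1 + (Re w)\<^sup>2)" if "w \<in> strip d" for w
  proof -
    have "A * exp (- \<kappa> * cosh (Re w)) \<le> A * ((2 / \<kappa>) / (1 + (Re w)\<^sup>2))" using A by (intro mult_left_mono exp_cosh_le \<kappa>) auto
    then show ?thesis using dp[OF that] by simp
  qed
  have dpsi_hol: "de_dpsi a b holomorphic_on strip d"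
  proof -
    have "de_psi a b holomorphic_on strip d" unfolding holomorphic_on_open[OF open_strip] using hp by blast
    then have "deriv (de_psi a b) holomorphic_on strip d" by (rule holomorphic_deriv[OF _ open_strip])
    then show ?thesis by (rule holomorphic_transform) (use hp DERIV_imp_deriv in blast)
  qed
  have hol: "(\<lambda>\<zeta>. f (Inner \<zeta>)) holomorphic_on strip d" if "H_infty d f" for f
    using that unfolding H_infty_def by (blast intro: analytic_imp_holomorphic)
  have K1: "(\<lambda>z. Kf z w) holomorphic_on strip d" if "w \<in> strip d" for w
    unfolding Kf_def using k_hol1 strip_surface[OF that] by (intro holomorphic_on_mult holomorphic_on_const hol) blast
  have K2: "Kf z holomorphic_on strip d" if "z \<in> strip d" for z
    unfolding Kf_def[abs_def] using k_hol2 strip_surface[OF that] by (intro holomorphic_on_mult dpsi_hol hol) blast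
  have Kb0: "cmod (Kf z w) \<le> K * (A * exp (- \<kappa> * cosh (Re w)))" if "z \<in> strip d" "w \<in> strip d" for z w
    unfolding Kf_def norm_mult by (intro mult_mono K dp that) (use K in auto)
  have Kb: "cmod (Kf z w) \<le> c / (1 + (Re w)\<^sup>2)" if "z \<in> strip d" "w \<in> strip d" for z w
  proof -
    have "cmod (Kf z w) \<le> K * (A * (2 / \<kappa>) / (1 + (Re w)\<^sup>2))"
      unfolding Kf_def norm_mult by (intro mult_mono K dq that) (use K in auto)
    then show ?thesis by (simp add: c_def)
  qed
  obtain Lg where Lg: "\<And>z. z \<in> strip d \<Longrightarrow> cmod (g (Inner z) - g Left_End) \<le> Lg * cmod (de_psi a b z - of_real a) powr \<alpha>"
      "\<And>z. z \<in> strip d \<Longrightarrow> cmod (g Right_End - g (Inner z)) \<le> Lg * cmod (of_real b - de_psi a b z) powr \<alpha>"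
    using g_M strip_surface unfolding M_space_def by (metis surface_value.simps(1))
  obtain Lk where Lk: "\<And>z w. z \<in> strip d \<Longrightarrow> w \<in> strip d \<Longrightarrow> cmod (k Right_End (Inner w) - k (Inner z) (Inner w)) \<le> Lk * cmod (of_real b - de_psi a b z) powr \<alpha>"
    using k_M strip_surface unfolding M_space_uniform_def by (metis surface_value.simps(1))
  have gH: "H_infty d g" using g_M unfolding M_space_def by blast
  then obtain G where G: "\<And>z. z \<in> strip d \<Longrightarrow> cmod (g (Inner z)) \<le> G"
    unfolding H_infty_def bounded_iff using strip_surface by blast
  obtain U M where U: "U holomorphic_on strip d" "\<And>z. z \<in> strip d \<Longrightarrow> cmod (U z) \<le> M"
    "\<And>z. z \<in> strip d \<Longrightarrow> U z = g (Inner z) + left_primitive d (\<lambda>w. Kf z w * U w) z"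
    using volterra_strip[OF d(1) c K1 K2 Kb hol[OF gH] G] by metis
  define P where "P z = left_primitive d (\<lambda>w. Kf z w * U w)" for z
  have M0: "0 \<le> M" using U(2)[OF rs[of 0]] norm_ge_zero order_trans by blast
  have KUh: "(\<lambda>w. Kf z w * U w) holomorphic_on strip d" if "z \<in> strip d" for z
    by (intro holomorphic_on_mult K2 U that)
  have KUb: "cmod (Kf z w * U w) \<le> c * M / (1 + (Re w)\<^sup>2)" if "z \<in> strip d" "w \<in> strip d" for z w
  proof -
    have "cmod (Kf z w * U w) \<le> c / (1 + (Re w)\<^sup>2) * M"
      unfolding norm_mult by (intro mult_mono Kb U that order_trans[OF norm_ge_zero Kb[OF that]]) auto
    then show ?thesis by simp
  qed
  have KUe: "cmod (Kf z w * U w) \<le> K * A * M * exp (- \<kappa> * cosh (Re w))" if "z \<in> strip d" "w \<in> strip d" for z w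
  proof -
    have "cmod (Kf z w * U w) \<le> K * (A * exp (- \<kappa> * cosh (Re w))) * M"
      unfolding norm_mult by (intro mult_mono Kb0 U that order_trans[OF norm_ge_zero Kb0[OF that]]) auto
    then show ?thesis by (simp only: mult_ac)
  qed
  have Pl: "((\<lambda>s. P z (Complex s y)) has_vector_derivative Kf z (Complex s y) * U (Complex s y)) (at s)"
    if z: "z \<in> strip d" and y: "\<bar>y\<bar> < d" for z y s
    unfolding P_def by (rule left_primitive_line[OF d(1) KUh[OF z] KUb[OF z] y])
  have Pt: "((\<lambda>s. P z (Complex s y)) \<longlongrightarrow> 0) at_bot" if z: "z \<in> strip d" and y: "\<bar>y\<bar> < d" for z y
    unfolding P_def by (rule left_primitive(2)[OF d(1) KUh[OF z] KUb[OF z] y])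
  have Pd: "(P z has_field_derivative Kf z w * U w) (at w)" if z: "z \<in> strip d" and w: "w \<in> strip d" for z w
    unfolding P_def by (rule left_primitive(1)[OF d(1) KUh[OF z] KUb[OF z] w])
  obtain Mu where Mu: "0 < Mu" "\<And>t. t \<in> {a..b} \<Longrightarrow> cmod (u t) \<le> Mu" using continuous_bounded_interval[OF u_cont] by blast

  define D where "D x = U (of_real x) - u (de_psi a b x)" for x
  define E where "E x = exp (2 * c * arctan x)" for x
  \<comment> \<open>On the real line the difference of the two equations is homogeneous in
    \<open>D\<close>, so any weighted bound for \<open>D\<close> can be halved; iterated, this
    forces D = 0.\<close>
  have D_step: "cmod (D x) \<le> B / 2 * E x" if B: "0 \<le> B" and DB: "\<And>s. cmod (D s) \<le> B * E s" for B x
  proof -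
    define f where "f r = k (interval_point a b (de_psi a b x)) (interval_point a b r) * u r" for r
    have fc: "continuous_on {a..b} f" unfolding f_def by (rule k_section_cont[OF in_ab])
    define p where "p s = P (of_real x) (Complex s 0) - integral {a..de_psi a b s} f" for s
    have "cmod (p x) \<le> B / 2 * exp (2 * c * arctan x)"
    proof (rule norm_le_of_exp_arctan_weight[OF _ _ _ c B])
      show "(p has_vector_derivative Kf (of_real x) (Complex s 0) * U (Complex s 0) - de_dpsi a b s *\<^sub>R f (de_psi a b s)) (at s)" for s
        unfolding p_def[abs_def]
        by (rule has_vector_derivative_diff[OF Pl[OF rs y0] integral_de_psi_substitution(1)[OF ab fc]])
      show "(p \<longlongrightarrow> 0) at_bot" unfolding p_def[abs_def]
        using tendsto_diff[OF Pt[OF rs y0] integral_de_psi_substitution(2)[OF ab fc]] by simp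
      fix s
      have "Kf (of_real x) (Complex s 0) * U (Complex s 0) - de_dpsi a b s *\<^sub>R f (de_psi a b s) = Kf (of_real x) (of_real s) * D s"
        unfolding re f_def ip Kf_def D_def scaleR_conv_of_real of_real_de_dpsi by (simp only: right_diff_distrib mult_ac)
      also have "cmod \<dots> \<le> c / (1 + s\<^sup>2) * (B * E s)"
        unfolding norm_mult using Kb[OF rs rs, of x s] DB[of s] order_trans[OF norm_ge_zero Kb[OF rs rs, of x s]]
        by (intro mult_mono) simp_all
      finally show "cmod (Kf (of_real x) (Complex s 0) * U (Complex s 0) - de_dpsi a b s *\<^sub>R f (de_psi a b s)) \<le> c / (1 + s\<^sup>2) * (B * exp (2 * c * arctan s))"
        unfolding E_def .
    qed
    moreover have "p x = D x"
    proof -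
      have "u (de_psi a b x) - integral {a..de_psi a b x} f = g (interval_point a b (de_psi a b x))"
        using u_eq in_ab[of x] unfolding f_def by blast
      then show ?thesis using U(3)[OF rs[of x]] unfolding p_def D_def re P_def[symmetric] ip by (simp add: algebra_simps)
    qed
    ultimately show ?thesis unfolding E_def by simp
  qed
  have Eb: "1 \<le> exp (c * pi) * E x" for x
  proof -
    have "- (pi / 2) \<le> arctan x" using arctan_lbound[of x] by linarith
    from mult_left_mono[OF this, of "2 * c"] have "0 \<le> c * pi + 2 * c * arctan x" using c by simp
    then show ?thesis by (simp add: E_def flip: exp_add)
  qed
  have D_it: "\<forall>x. cmod (D x) \<le> (M + Mu) * exp (c * pi) * (1 / 2) ^ n * E x" for n
  proof (induction n)
    case 0
    show ?case
    proof
      fix x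
      have "cmod (D x) \<le> (M + Mu) * 1" unfolding D_def
        using norm_triangle_ineq4[of "U (of_real x)" "u (de_psi a b x)"] U(2)[OF rs[of x]] Mu(2)[OF in_ab[of x]] by simp
      also have "\<dots> \<le> (M + Mu) * (exp (c * pi) * E x)" using M0 Mu by (intro mult_left_mono Eb) auto
      finally show "cmod (D x) \<le> (M + Mu) * exp (c * pi) * (1 / 2) ^ 0 * E x" by simp
    qed
  next
    case (Suc n)
    show ?case
    proof
      fix x
      have "cmod (D x) \<le> (M + Mu) * exp (c * pi) * (1 / 2) ^ n / 2 * E x"
        by (rule D_step) (use Suc M0 Mu in auto)
      then show "cmod (D x) \<le> (M + Mu) * exp (c * pi) * (1 / 2) ^ Suc n * E x" by simp
    qed
  qed
  have U_real: "U (of_real x) = u (de_psi a b x)" for x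
  proof -
    have "(\<lambda>n. (M + Mu) * exp (c * pi) * (1 / 2) ^ n * E x) \<longlonglongrightarrow> (M + Mu) * exp (c * pi) * 0 * E x"
      by (intro tendsto_mult tendsto_const LIMSEQ_power_zero) auto
    then have "cmod (D x) \<le> (M + Mu) * exp (c * pi) * 0 * E x"
      by (rule tendsto_lowerbound) (use D_it in auto)
    then show ?thesis by (simp add: D_def)
  qed

  \<comment> \<open>Below \<alpha> \<kappa>, the rate supplied by the Hoelder conditions, and, as
    \<alpha> \<le> 1, at most \<kappa> / 2, since half of the decay of psi' is spent on
    integrability.\<close>
  define \<mu> where "\<mu> = \<alpha> * \<kappa> / 2"
  have \<mu>: "0 < \<mu>" using \<alpha> \<kappa> by (simp add: \<mu>_def)
  have \<mu>le: "\<mu> \<le> \<kappa> / 2" "\<mu> \<le> \<alpha> * \<kappa>" "\<mu> \<le> \<kappa>"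
    using \<alpha> \<kappa> mult_right_mono[OF \<alpha>(2), of \<kappa>] by (simp_all add: \<mu>_def)
  have ex\<mu>: "exp (- \<nu> * cosh x) \<le> exp (- \<mu> * cosh x)" if "\<mu> \<le> \<nu>" for \<nu> x :: real
    using that cosh_real_pos[of x] by (simp add: mult_right_mono)
  have pw: "l * x powr \<alpha> \<le> \<bar>l\<bar> * A powr \<alpha> * exp (- \<mu> * cosh t)" if "0 \<le> x" "x \<le> A * exp (- \<kappa> * cosh t)" for l x t
  proof -
    have "l * x powr \<alpha> \<le> \<bar>l\<bar> * (A powr \<alpha> * exp (\<alpha> * (- \<kappa> * cosh t)))"
      by (intro mult_mono powr_exp_bound that A \<alpha>) auto
    also have "\<alpha> * (- \<kappa> * cosh t) = - (\<alpha> * \<kappa>) * cosh t" by simp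
    also have "\<bar>l\<bar> * (A powr \<alpha> * exp (- (\<alpha> * \<kappa>) * cosh t)) \<le> \<bar>l\<bar> * (A powr \<alpha> * exp (- \<mu> * cosh t))"
      by (intro mult_left_mono ex\<mu> \<mu>le) auto
    finally show ?thesis by (simp only: mult.assoc)
  qed
  have ua: "u a = g Left_End" using u_eq[rule_format, of a] ab by (simp add: ip)

  define B1 where "B1 = \<bar>Lg\<bar> * A powr \<alpha> + K * A * M * (4 / \<kappa>) * pi"
  \<comment> \<open>The integral in the equation is empty at t = a, so u(a) = g(a); only the Hoelder
    condition on g and the decay of psi' enter.\<close>
  have left: "cmod (U z - u a) \<le> B1 * exp (- \<mu> * cosh (Re z))" if z: "z \<in> strip d" "Re z \<le> 0" for z
  proof -
    have y: "\<bar>Im z\<bar> < d" using z by (simp add: strip_def)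
    have ws: "Complex s (Im z) \<in> strip d" for s using y by (simp add: strip_def)
    have "cmod ((\<lambda>s. P z (Complex s (Im z))) (Re z)) \<le> K * A * M * exp (- \<mu> * cosh (Re z)) * (4 / \<kappa>) * pi"
    proof (rule norm_le_of_cauchy_weight[OF Pl[OF z(1) y] Pt[OF z(1) y]])
      fix s assume s: "s \<le> Re z"
      \<comment> \<open>Since s \<le> Re z \<le> 0, half of the exponent may be frozen at Re z; the
        other half keeps the integrand integrable.\<close>
      have "exp (- \<kappa> * cosh s) = exp (- (\<kappa> / 2) * cosh s) * exp (- (\<kappa> / 2) * cosh s)" by (simp flip: exp_add)
      also have "\<dots> \<le> exp (- \<mu> * cosh (Re z)) * ((2 / (\<kappa> / 2)) / (1 + s\<^sup>2))"
      proof (intro mult_mono exp_cosh_le)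
        have "exp (- (\<kappa> / 2) * cosh s) \<le> exp (- (\<kappa> / 2) * cosh (Re z))" using s z \<kappa> by (intro exp_cosh_mono) auto
        also have "\<dots> \<le> exp (- \<mu> * cosh (Re z))" by (rule ex\<mu>[OF \<mu>le(1)])
        finally show "exp (- (\<kappa> / 2) * cosh s) \<le> exp (- \<mu> * cosh (Re z))" .
      qed (use \<kappa> in auto)
      finally have "K * A * M * exp (- \<kappa> * cosh s) \<le> K * A * M * (exp (- \<mu> * cosh (Re z)) * ((2 / (\<kappa> / 2)) / (1 + s\<^sup>2)))"
        using K A M0 by (intro mult_left_mono) auto
      then show "cmod (Kf z (Complex s (Im z)) * U (Complex s (Im z))) \<le> K * A * M * exp (- \<mu> * cosh (Re z)) * (4 / \<kappa>) / (1 + s\<^sup>2)"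
        using KUe[OF z(1) ws, of s] by simp
    qed
    then have 1: "cmod (P z z) \<le> K * A * M * (4 / \<kappa>) * pi * exp (- \<mu> * cosh (Re z))" by (simp add: mult_ac)
    have 2: "cmod (g (Inner z) - g Left_End) \<le> \<bar>Lg\<bar> * A powr \<alpha> * exp (- \<mu> * cosh (Re z))"
      using Lg(1)[OF z(1)] pw[OF norm_ge_zero pa[OF z], of Lg] by linarith
    have "U z - u a = (g (Inner z) - g Left_End) + P z z" using U(3)[OF z(1)] by (simp add: ua P_def)
    then have "cmod (U z - u a) \<le> cmod (g (Inner z) - g Left_End) + cmod (P z z)" by (simp only: norm_triangle_ineq)
    also have "\<dots> \<le> B1 * exp (- \<mu> * cosh (Re z))" using 1 2 unfolding B1_def distrib_right by (rule add_mono[rotated])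
    finally show ?thesis .
  qed

  define f where "f r = k Right_End (interval_point a b r) * u r" for r
  have fc: "continuous_on {a..b} f" using k_section_cont[of b] ab unfolding f_def ip by simp
  obtain Mf where Mf: "0 < Mf" "\<And>t. t \<in> {a..b} \<Longrightarrow> cmod (f t) \<le> Mf" using continuous_bounded_interval[OF fc] by blast
  have "u b - integral {a..b} f = g Right_End" using u_eq[rule_format, of b] ab unfolding ip f_def by simp
  then have ub: "u b = g Right_End + integral {a..b} f" by (simp add: diff_eq_eq)
  define B2 where "B2 = \<bar>Lg\<bar> * A powr \<alpha> + K * A * M * d + \<bar>Lk\<bar> * A powr \<alpha> * Mu * (A * (2 / \<kappa>)) * pi + Mf * A"
  \<comment> \<open>The integral for z turns into the one for u(b) in three moves: vertically down
    to the real line, then from the kernel parameter z to the right end by the Hoelder condition on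
    k, and finally from psi(Re z) to b as upper limit. Each costs a multiple of
    \<open>?E\<close>.\<close>
  have right: "cmod (U z - u b) \<le> B2 * exp (- \<mu> * cosh (Re z))" if z: "z \<in> strip d" "0 \<le> Re z" for z
  proof -
    have y: "\<bar>Im z\<bar> < d" using z by (simp add: strip_def)
    let ?E = "exp (- \<mu> * cosh (Re z))"
    have 1: "cmod (g Right_End - g (Inner z)) \<le> \<bar>Lg\<bar> * A powr \<alpha> * ?E"
      using Lg(2)[OF z(1)] pw[OF norm_ge_zero pb[OF z], of Lg] by linarith
    have 2: "cmod (P z z - P z (of_real (Re z))) \<le> K * A * M * d * ?E"
    proof -
      have seg: "w \<in> strip d \<and> Re w = Re z" if "w \<in> closed_segment (of_real (Re z)) z" for w
        using that y d by (auto simp: closed_segment_same_Re strip_def closed_segment_eq_real_ivl split: if_splits)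
      have "cmod (P z z - P z (of_real (Re z))) \<le> K * A * M * exp (- \<kappa> * cosh (Re z)) * cmod (z - of_real (Re z))"
      proof (rule field_differentiable_bound[OF convex_closed_segment])
        fix w assume w: "w \<in> closed_segment (of_real (Re z)) z"
        show "(P z has_field_derivative Kf z w * U w) (at w within closed_segment (of_real (Re z)) z)"
          using Pd[OF z(1)] seg[OF w] has_field_derivative_at_within by blast
        show "cmod (Kf z w * U w) \<le> K * A * M * exp (- \<kappa> * cosh (Re z))" using KUe[OF z(1), of w] seg[OF w] by auto
      qed auto
      also have "\<dots> \<le> K * A * M * ?E * d"
      proof (intro mult_mono mult_left_mono ex\<mu> \<mu>le)
        have "cmod (z - of_real (Re z)) = \<bar>Im z\<bar>" by (simp add: cmod_def)
        then show "cmod (z - of_real (Re z)) \<le> d" using y by simp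
      qed (use K A M0 in auto)
      finally show ?thesis by (simp only: mult_ac)
    qed
    have 3: "cmod (P z (of_real (Re z)) - integral {a..de_psi a b (Re z)} f) \<le> \<bar>Lk\<bar> * A powr \<alpha> * Mu * (A * (2 / \<kappa>)) * pi * ?E"
    proof -
      define p where "p s = P z (Complex s 0) - integral {a..de_psi a b s} f" for s
      have "cmod (p (Re z)) \<le> (\<bar>Lk\<bar> * A powr \<alpha> * ?E * (A * (2 / \<kappa>)) * Mu) * pi"
      proof (rule norm_le_of_cauchy_weight)
        show "(p has_vector_derivative Kf z (Complex s 0) * U (Complex s 0) - de_dpsi a b s *\<^sub>R f (de_psi a b s)) (at s)" for s
          unfolding p_def[abs_def]
          by (rule has_vector_derivative_diff[OF Pl[OF z(1) y0] integral_de_psi_substitution(1)[OF ab fc]])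
        show "(p \<longlongrightarrow> 0) at_bot" unfolding p_def[abs_def]
          using tendsto_diff[OF Pt[OF z(1) y0] integral_de_psi_substitution(2)[OF ab fc]] by simp
        fix s
        have "Kf z (Complex s 0) * U (Complex s 0) - de_dpsi a b s *\<^sub>R f (de_psi a b s) =
            - (k Right_End (Inner (of_real s)) - k (Inner z) (Inner (of_real s))) * de_dpsi a b (of_real s) * u (de_psi a b s)"
          unfolding re f_def ip Kf_def U_real scaleR_conv_of_real of_real_de_dpsi by (simp add: algebra_simps)
        also have "cmod \<dots> \<le> \<bar>Lk\<bar> * A powr \<alpha> * ?E * (A * (2 / \<kappa>) / (1 + s\<^sup>2)) * Mu"
          unfolding norm_mult norm_minus_cancel
        proof (intro mult_mono Mu in_ab)
          show "cmod (k Right_End (Inner (of_real s)) - k (Inner z) (Inner (of_real s))) \<le> \<bar>Lk\<bar> * A powr \<alpha> * ?E"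
            using Lk[OF z(1) rs, of s] pw[OF norm_ge_zero pb[OF z], of Lk] by linarith
          show "cmod (de_dpsi a b (of_real s)) \<le> A * (2 / \<kappa>) / (1 + s\<^sup>2)" using dq[OF rs, of s] by simp
        qed (use A \<kappa> in \<open>auto intro!: mult_nonneg_nonneg divide_nonneg_nonneg add_nonneg_nonneg\<close>)
        finally show "cmod (Kf z (Complex s 0) * U (Complex s 0) - de_dpsi a b s *\<^sub>R f (de_psi a b s)) \<le> (\<bar>Lk\<bar> * A powr \<alpha> * ?E * (A * (2 / \<kappa>)) * Mu) / (1 + s\<^sup>2)"
          by simp
      qed
      then show ?thesis unfolding p_def re by (simp only: mult_ac)
    qed
    have 4: "cmod (integral {a..b} f - integral {a..de_psi a b (Re z)} f) \<le> Mf * A * ?E"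
    proof -
      have i: "integral {a..b} f = integral {a..de_psi a b (Re z)} f + integral {de_psi a b (Re z)..b} f"
        using Henstock_Kurzweil_Integration.integral_combine[OF _ _ integrable_continuous_real[OF fc]] in_ab[of "Re z"] by (metis atLeastAtMost_iff)
      have fs: "continuous_on {de_psi a b (Re z)..b} f" using fc by (rule continuous_on_subset) (use in_ab[of "Re z"] in auto)
      have "cmod (integral {de_psi a b (Re z)..b} f) \<le> Mf * (b - de_psi a b (Re z))"
        by (rule integral_bound) (use fs Mf in_ab[of "Re z"] in auto)
      also have "b - de_psi a b (Re z) = cmod (of_real b - de_psi a b (complex_of_real (Re z)))"
        unfolding of_real_de_psi[symmetric] of_real_diff[symmetric] norm_of_real using p(2)[of "Re z"] by simp
      also have "Mf * \<dots> \<le> Mf * (A * exp (- \<kappa> * cosh (Re z)))" using pb[OF rs, of "Re z"] z Mf by (intro mult_left_mono) auto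
      also have "\<dots> \<le> Mf * (A * ?E)" using Mf A by (intro mult_left_mono ex\<mu> \<mu>le) auto
      finally show ?thesis unfolding i by simp
    qed
    have "U z - u b = - (g Right_End - g (Inner z)) + (P z z - P z (of_real (Re z))) + (P z (of_real (Re z)) - integral {a..de_psi a b (Re z)} f)
        - (integral {a..b} f - integral {a..de_psi a b (Re z)} f)" using U(3)[OF z(1)] by (simp add: ub P_def)
    also have "cmod \<dots> \<le> \<bar>Lg\<bar> * A powr \<alpha> * ?E + K * A * M * d * ?E + \<bar>Lk\<bar> * A powr \<alpha> * Mu * (A * (2 / \<kappa>)) * pi * ?E + Mf * A * ?E"
      by (intro order_trans[OF norm_triangle_ineq4] order_trans[OF norm_triangle_ineq] add_mono 2 3 4) (use 1 in \<open>simp only: norm_minus_cancel\<close>)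
    finally show ?thesis unfolding B2_def distrib_right .
  qed
  define B where "B = \<bar>B1\<bar> + \<bar>B2\<bar> + M + 1"
  have B: "0 < B" "M \<le> B" "B1 \<le> B" "B2 \<le> B" using M0 unfolding B_def by linarith+
  show ?thesis
  proof (rule that[OF U(1) \<mu> B(1) _ U_real])
    show "cmod (U z) \<le> B" if "z \<in> strip d" for z using U(2)[OF that] B by linarith
    show "cmod (U z - u a) \<le> B * exp (- \<mu> * cosh (Re z))" if "z \<in> strip d" "Re z \<le> 0" for z
      by (rule order_trans[OF left[OF that] mult_right_mono[OF B(3)]]) simp
    show "cmod (U z - u b) \<le> B * exp (- \<mu> * cosh (Re z))" if "z \<in> strip d" "0 \<le> Re z" for z
      by (rule order_trans[OF right[OF that] mult_right_mono[OF B(4)]]) simp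
  qed
qed

end

section \<open>Stability of the collocation system\<close>

lemma sum_int_nat:
  "(\<Sum>j = - int N..int N. f j) = (\<Sum>p = 0..<2 * N + 1. f (int p - int N))"
proof -
  have "(\<lambda>p. int p - int N) ` {0..<2 * N + 1} = {- int N..int N}"
  proof
    show "{- int N..int N} \<subseteq> (\<lambda>p. int p - int N) ` {0..<2 * N + 1}"
    proof
      fix j assume "j \<in> {- int N..int N}"
      then have "j = int (nat (j + int N)) - int N" "nat (j + int N) \<in> {0..<2 * N + 1}" by auto
      then show "j \<in> (\<lambda>p. int p - int N) ` {0..<2 * N + 1}" by blast
    qed
  qed auto
  moreover have "inj_on (\<lambda>p. int p - int N) {0..<2 * N + 1}" by (simp add: inj_on_def)
  ultimately show ?thesis by (metis (no_types, lifting) sum.reindex_cong)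
qed

text \<open>The weights \<open>\<delta>\<^sub>i\<^sub>-\<^sub>j\<close> differ from those of a strictly lower triangular matrix only by terms of order
  \<open>1 / (1 + \<bar>i - j\<bar>)\<close>. By Cauchy-Schwarz these contribute a perturbation of size \<open>sqrt h\<close>, and the triangular part is
  controlled by the discrete Gronwall inequality.\<close>

lemma collocation_stability:
  fixes kk :: "int \<Rightarrow> int \<Rightarrow> complex" and w :: "int \<Rightarrow> real" and x r :: "int \<Rightarrow> complex"
  assumes h: "0 < h" "h \<le> 1" and K: "0 \<le> K" "\<And>i j. cmod (kk i j) \<le> K"
    and w: "\<And>j. 0 \<le> w j" "\<And>j. w j \<le> C / (1 + (of_int j * h)\<^sup>2)" and C: "0 \<le> C"
    and eq: "\<And>i. i \<in> {- int N..int N} \<Longrightarrow> x i = r i + (\<Sum>j = - int N..int N. kk i j * of_real (w j * h * delta_minus1 (i - j)) * x j)"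
    and r: "\<And>i. i \<in> {- int N..int N} \<Longrightarrow> cmod (r i) \<le> \<rho>"
    and small: "exp (K * C * (1 + pi)) * (2 * K * C * (1 + pi) * sqrt h) \<le> 1 / 2"
    and i: "i \<in> {- int N..int N}"
  shows "cmod (x i) \<le> 2 * exp (K * C * (1 + pi)) * \<rho>"
proof -
  let ?J = "{- int N..int N}"
  define X where "X = Max ((\<lambda>i. cmod (x i)) ` ?J)"
  have X: "cmod (x i) \<le> X" if "i \<in> ?J" for i unfolding X_def using that by (intro Max_ge) auto
  have "X \<in> (\<lambda>i. cmod (x i)) ` ?J" unfolding X_def by (intro Max_in) auto
  then obtain m where m: "m \<in> ?J" "X = cmod (x m)" by blast
  have X0: "0 \<le> X" using m by simp
  have \<rho>0: "0 \<le> \<rho>" using r[OF i] norm_ge_zero order_trans by blast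
  have p0: "0 \<le> K * (w j * h)" for j using K w h by simp
  define \<eta> where "\<eta> = 2 * K * C * (1 + pi) * sqrt h"
  \<comment> \<open>Row sums of the part of the matrix not captured by the triangular comparison.
    Cauchy-Schwarz pairs h / (1 + (jh)^2), whose squares sum to O(h), with 1 / (1 + |i - j|), whose
    squares have a bounded sum.\<close>
  have \<eta>: "(\<Sum>j\<in>?J. K * (w j * h) * (2 / (1 + \<bar>of_int (i - j)\<bar>))) \<le> \<eta>" for i
  proof -
    have "(\<Sum>j\<in>?J. K * (w j * h) * (2 / (1 + \<bar>of_int (i - j)\<bar>))) \<le> (\<Sum>j\<in>?J. 2 * K * C * ((h / (1 + (of_int j * h)\<^sup>2)) * (1 / (1 + \<bar>of_int (i - j)\<bar>))))"
    proof (rule sum_mono)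
      fix j
      have "K * (w j * h) * (2 / (1 + \<bar>of_int (i - j)\<bar>)) \<le> K * (C / (1 + (of_int j * h)\<^sup>2) * h) * (2 / (1 + \<bar>of_int (i - j)\<bar>))"
        using K h w by (intro mult_right_mono mult_left_mono) auto
      then show "K * (w j * h) * (2 / (1 + \<bar>of_int (i - j)\<bar>)) \<le> 2 * K * C * ((h / (1 + (of_int j * h)\<^sup>2)) * (1 / (1 + \<bar>of_int (i - j)\<bar>)))"
        by (simp add: mult_ac)
    qed
    also have "\<dots> = 2 * K * C * (\<Sum>j\<in>?J. (h / (1 + (of_int j * h)\<^sup>2)) * (1 / (1 + \<bar>of_int (i - j)\<bar>)))"
      by (rule sum_distrib_left[symmetric])
    also have "\<dots> \<le> 2 * K * C * ((1 + pi) * sqrt h)"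
    proof (rule mult_left_mono)
      show "0 \<le> 2 * K * C" using K C by simp
      have "(\<Sum>j\<in>?J. (h / (1 + (of_int j * h)\<^sup>2)) * (1 / (1 + \<bar>of_int (i - j)\<bar>)))\<^sup>2 \<le>
         (\<Sum>j\<in>?J. (h / (1 + (of_int j * h)\<^sup>2))\<^sup>2) * (\<Sum>j\<in>?J. (1 / (1 + \<bar>of_int (i - j)\<bar>))\<^sup>2)"
        by (rule Cauchy_Schwarz_ineq_sum)
      also have "\<dots> \<le> (h * (1 + pi)) * (1 + pi)"
      proof (intro mult_mono)
        have "(\<Sum>j\<in>?J. (h / (1 + (of_int j * h)\<^sup>2))\<^sup>2) \<le> (\<Sum>j\<in>?J. h * (h / (1 + (of_int j * h)\<^sup>2)))"
        proof (rule sum_mono)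
          fix j
          have q: "0 < 1 + (real_of_int j * h)\<^sup>2" by (simp add: add_pos_nonneg)
          have "h / (1 + (of_int j * h)\<^sup>2) \<le> h / 1" using h q by (intro divide_left_mono) simp_all
          then show "(h / (1 + (of_int j * h)\<^sup>2))\<^sup>2 \<le> h * (h / (1 + (of_int j * h)\<^sup>2))"
            unfolding power2_eq_square[of "h / _"] using h q by (intro mult_right_mono) simp_all
        qed
        also have "\<dots> = h * (\<Sum>j\<in>?J. (h / (1 + (of_int j * h)\<^sup>2)))" by (rule sum_distrib_left[symmetric])
        also have "\<dots> \<le> h * (h + pi)" using h by (intro mult_left_mono sum_inverse_square_le) auto
        also have "\<dots> \<le> h * (1 + pi)" using h by (intro mult_left_mono) auto
        finally show "(\<Sum>j\<in>?J. (h / (1 + (of_int j * h)\<^sup>2))\<^sup>2) \<le> h * (1 + pi)" .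
        have "(\<Sum>j\<in>?J. (1 / (1 + \<bar>of_int (i - j)\<bar>))\<^sup>2) \<le> (\<Sum>j\<in>?J. 1 / (1 + (real_of_int (i - j))\<^sup>2))"
        proof (rule sum_mono)
          fix j
          have "1 + t\<^sup>2 \<le> (1 + \<bar>t\<bar>)\<^sup>2" for t :: real by (simp add: power2_sum)
          then show "(1 / (1 + \<bar>of_int (i - j)\<bar>))\<^sup>2 \<le> 1 / (1 + (real_of_int (i - j))\<^sup>2)"
            unfolding power_divide one_power2 by (intro divide_left_mono) (auto simp: add_pos_nonneg simp del: of_int_diff)
        qed
        also have "\<dots> = (\<Sum>l\<in>(\<lambda>j. i - j) ` ?J. 1 / (1 + (real_of_int l * 1)\<^sup>2))"
          by (subst sum.reindex) (auto simp: inj_on_def)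
        also have "\<dots> \<le> 1 + pi" by (rule sum_inverse_square_le) auto
        finally show "(\<Sum>j\<in>?J. (1 / (1 + \<bar>of_int (i - j)\<bar>))\<^sup>2) \<le> 1 + pi" .
        show "0 \<le> h * (1 + pi)" using h by simp
        show "0 \<le> (\<Sum>j\<in>?J. (1 / (1 + \<bar>real_of_int (i - j)\<bar>))\<^sup>2)" by (intro sum_nonneg zero_le_power2)
      qed
      also have "\<dots> = ((1 + pi) * sqrt h)\<^sup>2" using h by (simp add: power_mult_distrib power2_eq_square)
      finally show "(\<Sum>j\<in>?J. (h / (1 + (of_int j * h)\<^sup>2)) * (1 / (1 + \<bar>of_int (i - j)\<bar>))) \<le> (1 + pi) * sqrt h"
        by (rule power2_le_imp_le) (use h in simp)
    qed
    finally show ?thesis unfolding \<eta>_def by (simp only: mult.assoc)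
  qed
  \<comment> \<open>The step function keeps only the terms j < i, in the form required by the
    Gronwall inequality; the deviation of the weights is charged to the global maximum
    \<open>X\<close>.\<close>
  have step: "cmod (x i) \<le> (\<rho> + \<eta> * X) + (\<Sum>j\<in>?J. (if j < i then K * (w j * h) * cmod (x j) else 0))" if i: "i \<in> ?J" for i
  proof -
    have "cmod (x i) \<le> cmod (r i) + (\<Sum>j\<in>?J. cmod (kk i j * of_real (w j * h * delta_minus1 (i - j)) * x j))"
    proof -
      have "cmod (x i) = cmod (r i + (\<Sum>j\<in>?J. kk i j * of_real (w j * h * delta_minus1 (i - j)) * x j))" using eq[OF i] by (rule arg_cong)
      also have "\<dots> \<le> cmod (r i) + cmod (\<Sum>j\<in>?J. kk i j * of_real (w j * h * delta_minus1 (i - j)) * x j)" by (rule norm_triangle_ineq)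
      also have "\<dots> \<le> cmod (r i) + (\<Sum>j\<in>?J. cmod (kk i j * of_real (w j * h * delta_minus1 (i - j)) * x j))" by (intro add_left_mono norm_sum)
      finally show ?thesis .
    qed
    also have "\<dots> \<le> \<rho> + (\<Sum>j\<in>?J. K * (w j * h) * (2 / (1 + \<bar>of_int (i - j)\<bar>)) * X + (if j < i then K * (w j * h) * cmod (x j) else 0))"
    proof (intro add_mono r i sum_mono)
      fix j assume j: "j \<in> ?J"
      define c :: real where "c = (if j < i then 1 else 0)"
      define t where "t = 2 / (1 + \<bar>real_of_int (i - j)\<bar>)"
      have c_eq: "(if 0 < i - j then 1 else 0) = c" by (simp add: c_def)
      have c0: "\<bar>c\<bar> = c" by (simp add: c_def)
      have t0: "0 \<le> t" by (simp add: t_def)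
      have "\<bar>delta_minus1 (i - j) - c\<bar> \<le> t" using delta_minus1_bound[of "i - j"] unfolding c_eq t_def .
      then have "\<bar>delta_minus1 (i - j)\<bar> \<le> t + c" using abs_triangle_ineq2[of "delta_minus1 (i - j)" c] c0 by linarith
      then have "K * (w j * h) * \<bar>delta_minus1 (i - j)\<bar> * cmod (x j) \<le> K * (w j * h) * (t + c) * cmod (x j)"
        by (intro mult_right_mono mult_left_mono p0) auto
      also have "\<dots> = K * (w j * h) * t * cmod (x j) + c * (K * (w j * h) * cmod (x j))"
      proof -
        have "s * (t + c) * z = s * t * z + c * (s * z)" for s z :: real by (simp add: algebra_simps)
        then show ?thesis .
      qed
      also have "K * (w j * h) * t * cmod (x j) \<le> K * (w j * h) * t * X"
        by (intro mult_left_mono X j mult_nonneg_nonneg p0 t0)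
      also have "c * (K * (w j * h) * cmod (x j)) = (if j < i then K * (w j * h) * cmod (x j) else 0)" by (simp add: c_def)
      finally have 1: "K * (w j * h) * \<bar>delta_minus1 (i - j)\<bar> * cmod (x j) \<le> K * (w j * h) * t * X + (if j < i then K * (w j * h) * cmod (x j) else 0)" by simp
      have "cmod (kk i j * of_real (w j * h * delta_minus1 (i - j)) * x j) = cmod (kk i j) * (w j * h * \<bar>delta_minus1 (i - j)\<bar> * cmod (x j))"
        using w(1)[of j] h by (simp add: norm_mult abs_mult)
      also have "\<dots> \<le> K * (w j * h * \<bar>delta_minus1 (i - j)\<bar> * cmod (x j))"
        using w(1)[of j] h by (intro mult_right_mono K mult_nonneg_nonneg) auto
      also have "\<dots> = K * (w j * h) * \<bar>delta_minus1 (i - j)\<bar> * cmod (x j)" by (simp only: mult.assoc)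
      also note 1
      finally show "cmod (kk i j * of_real (w j * h * delta_minus1 (i - j)) * x j) \<le> K * (w j * h) * (2 / (1 + \<bar>of_int (i - j)\<bar>)) * X + (if j < i then K * (w j * h) * cmod (x j) else 0)"
        unfolding t_def .
    qed
    also have "\<dots> = \<rho> + ((\<Sum>j\<in>?J. K * (w j * h) * (2 / (1 + \<bar>of_int (i - j)\<bar>))) * X + (\<Sum>j\<in>?J. (if j < i then K * (w j * h) * cmod (x j) else 0)))"
      by (simp only: sum.distrib sum_distrib_right)
    also have "\<dots> \<le> \<rho> + (\<eta> * X + (\<Sum>j\<in>?J. (if j < i then K * (w j * h) * cmod (x j) else 0)))"
      by (intro add_left_mono add_right_mono mult_right_mono \<eta> X0)
    finally show ?thesis by (simp only: add.assoc)
  qed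
  define y where "y p = cmod (x (int p - int N))" for p
  define q where "q p = K * (w (int p - int N) * h)" for p
  have \<eta>0: "0 \<le> \<eta>" using K C h by (simp add: \<eta>_def)
  have R0: "0 \<le> \<rho> + \<eta> * X" using \<rho>0 \<eta>0 X0 by simp
  have yb: "y p \<le> (\<rho> + \<eta> * X) * exp (\<Sum>l<p. q l)" if p: "p \<le> 2 * N" for p
  proof (rule discrete_gronwall[OF _ R0 _ p])
    show "0 \<le> q j" for j unfolding q_def by (rule p0)
    fix s assume s: "s \<le> 2 * N"
    then have "int s - int N \<in> ?J" by auto
    from step[OF this] have "y s \<le> (\<rho> + \<eta> * X) + (\<Sum>l = 0..<2 * N + 1. if l < s then q l * y l else 0)"
      unfolding sum_int_nat y_def q_def by simp
    also have "(\<Sum>l = 0..<2 * N + 1. if l < s then q l * y l else 0) = (\<Sum>l<s. q l * y l)"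
      using s by (intro sum.mono_neutral_cong_right) auto
    finally show "y s \<le> (\<rho> + \<eta> * X) + (\<Sum>l<s. q l * y l)" .
  qed
  have qs: "(\<Sum>l<p. q l) \<le> K * C * (1 + pi)" if p: "p \<le> 2 * N" for p
  proof -
    have "(\<Sum>l<p. q l) \<le> (\<Sum>l = 0..<2 * N + 1. q l)" using p p0 by (intro sum_mono2) (auto simp: q_def)
    also have "\<dots> = (\<Sum>j\<in>?J. K * (w j * h))" unfolding sum_int_nat q_def ..
    also have "\<dots> \<le> (\<Sum>j\<in>?J. K * C * (h / (1 + (of_int j * h)\<^sup>2)))"
    proof (rule sum_mono)
      fix j
      have "K * (w j * h) \<le> K * (C / (1 + (of_int j * h)\<^sup>2) * h)" using K h w by (intro mult_left_mono mult_right_mono) auto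
      then show "K * (w j * h) \<le> K * C * (h / (1 + (of_int j * h)\<^sup>2))" by simp
    qed
    also have "\<dots> = K * C * (\<Sum>j\<in>?J. (h / (1 + (of_int j * h)\<^sup>2)))" by (rule sum_distrib_left[symmetric])
    also have "\<dots> \<le> K * C * (h + pi)" using K C h by (intro mult_left_mono sum_inverse_square_le) auto
    also have "\<dots> \<le> K * C * (1 + pi)" using K C h by (intro mult_left_mono) auto
    finally show ?thesis .
  qed
  have "y p \<le> (\<rho> + \<eta> * X) * exp (K * C * (1 + pi))" if p: "p \<le> 2 * N" for p
  proof (rule order_trans[OF yb[OF p]])
    show "(\<rho> + \<eta> * X) * exp (\<Sum>l<p. q l) \<le> (\<rho> + \<eta> * X) * exp (K * C * (1 + pi))"
      by (intro mult_left_mono R0) (simp only: exp_le_cancel_iff qs[OF p])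
  qed
  from this[of "nat (m + int N)"] have "X \<le> (\<rho> + \<eta> * X) * exp (K * C * (1 + pi))"
  proof -
    assume 1: "nat (m + int N) \<le> 2 * N \<Longrightarrow> y (nat (m + int N)) \<le> (\<rho> + \<eta> * X) * exp (K * C * (1 + pi))"
    have "nat (m + int N) \<le> 2 * N" "int (nat (m + int N)) - int N = m" using m(1) by auto
    then show ?thesis using 1 m(2) unfolding y_def by (simp only:)
  qed
  also have "\<dots> = exp (K * C * (1 + pi)) * \<rho> + (exp (K * C * (1 + pi)) * \<eta>) * X" by (simp only: ring_distribs mult_ac)
  \<comment> \<open>\<open>X\<close> occurs on both sides; the smallness of sqrt h lets half of it
    be absorbed on the left, which explains the factor 2 in the conclusion.\<close>
  also have "(exp (K * C * (1 + pi)) * \<eta>) * X \<le> 1 / 2 * X" using small X0 unfolding \<eta>_def by (intro mult_right_mono)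
  finally have "X \<le> 2 * exp (K * C * (1 + pi)) * \<rho>" by simp
  then show ?thesis using X[OF i] by linarith
qed

section \<open>Values at the end points and asymptotics of the mesh\<close>

lemma sinc_basis_tendsto:
  assumes "0 < h"
  shows "((\<lambda>x. sinc_basis j h x) \<longlongrightarrow> 0) at_bot" "((\<lambda>x. sinc_basis j h x) \<longlongrightarrow> 0) at_top"
proof -
  define m where "m = real_of_int j"
  have b: "norm (sinc_basis j h x) \<le> h / (pi * \<bar>x - m * h\<bar>)" if "x \<noteq> m * h" for x
  proof -
    have ne: "pi * (x - m * h) / h \<noteq> 0" using that assms by auto
    have "norm (sinc_basis j h x) = \<bar>sin (pi * (x - m * h) / h)\<bar> / \<bar>pi * (x - m * h) / h\<bar>"
      unfolding sinc_basis_def m_def[symmetric] using ne by (simp only: if_False real_norm_def abs_divide)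
    also have "\<dots> \<le> 1 / \<bar>pi * (x - m * h) / h\<bar>" by (intro divide_right_mono) auto
    also have "\<dots> = h / (pi * \<bar>x - m * h\<bar>)" using assms by (simp add: abs_mult)
    finally show ?thesis .
  qed
  show "((\<lambda>x. sinc_basis j h x) \<longlongrightarrow> 0) at_bot"
  proof (rule Lim_null_comparison)
    show "\<forall>\<^sub>F x in at_bot. norm (sinc_basis j h x) \<le> h / (pi * \<bar>x - m * h\<bar>)"
      using eventually_gt_at_bot[of "m * h"] by (rule eventually_mono) (rule b, simp)
    show "((\<lambda>x. h / (pi * \<bar>x - m * h\<bar>)) \<longlongrightarrow> 0) at_bot" using assms by real_asymp
  qed
  show "((\<lambda>x. sinc_basis j h x) \<longlongrightarrow> 0) at_top"
  proof (rule Lim_null_comparison)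
    show "\<forall>\<^sub>F x in at_top. norm (sinc_basis j h x) \<le> h / (pi * \<bar>x - m * h\<bar>)"
      using eventually_gt_at_top[of "m * h"] by (rule eventually_mono) (rule b, simp)
    show "((\<lambda>x. h / (pi * \<bar>x - m * h\<bar>)) \<longlongrightarrow> 0) at_top" using assms by real_asymp
  qed
qed

lemma de_phi_at_ends:
  assumes "a < b"
  shows "filterlim (de_phi a b) at_bot (at a within {a<..<b})" "filterlim (de_phi a b) at_top (at b within {a<..<b})"
proof -
  note p = de_psi_real_properties[OF assms]
  have le: "de_phi a b s \<le> Z \<longleftrightarrow> s \<le> de_psi a b Z" "Z \<le> de_phi a b s \<longleftrightarrow> de_psi a b Z \<le> s" if "s \<in> {a<..<b}" for s Z
    using strict_mono_less_eq[OF p(4), of "de_phi a b s" Z] strict_mono_less_eq[OF p(4), of Z "de_phi a b s"] that de_psi_de_phi[OF assms, of s] by auto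
  have in_set: "\<forall>\<^sub>F s in at c within {a<..<b}. s \<in> {a<..<b}" for c by (simp add: eventually_at_filter)
  show "filterlim (de_phi a b) at_bot (at a within {a<..<b})" unfolding filterlim_at_bot
  proof
    fix Z
    have "\<forall>\<^sub>F s in at a within {a<..<b}. s < de_psi a b Z" using p(1) by (intro order_tendstoD(2)[OF tendsto_ident_at])
    then show "\<forall>\<^sub>F s in at a within {a<..<b}. de_phi a b s \<le> Z" using in_set by eventually_elim (simp add: le)
  qed
  show "filterlim (de_phi a b) at_top (at b within {a<..<b})" unfolding filterlim_at_top
  proof
    fix Z
    have "\<forall>\<^sub>F s in at b within {a<..<b}. de_psi a b Z < s" using p(2) by (intro order_tendstoD(1)[OF tendsto_ident_at])
    then show "\<forall>\<^sub>F s in at b within {a<..<b}. Z \<le> de_phi a b s" using in_set by eventually_elim (simp add: le)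
  qed
qed

text \<open>The transformed variable runs to -infinity and +infinity at the two ends, and sinc
  vanishes there; hence the approximation takes the values u_{-N} and u_N at a and b.\<close>

lemma sinc_basis_phi_ends:
  assumes "a < b" "0 < h"
  shows "sinc_basis_phi a b j h a = 0" "sinc_basis_phi a b j h b = 0"
proof -
  have nt: "at a within {a<..<b} \<noteq> bot" "at b within {a<..<b} \<noteq> bot"
    using assms(1) by (simp_all add: at_within_eq_bot_iff closure_greaterThanLessThan)
  show "sinc_basis_phi a b j h a = 0" "sinc_basis_phi a b j h b = 0"
    unfolding sinc_basis_phi_def
    using tendsto_Lim[OF nt(1) filterlim_compose[OF sinc_basis_tendsto(1)[OF assms(2)] de_phi_at_ends(1)[OF assms(1)]]]
      tendsto_Lim[OF nt(2) filterlim_compose[OF sinc_basis_tendsto(2)[OF assms(2)] de_phi_at_ends(2)[OF assms(1)]]] by simp_all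
qed

text \<open>All requirements on the size of N in one place. With T = pi d / h the target is
  \<open>X N\<close> = exp(-T), and 1 / sinh T \<le> 4 exp(-T) once T \<ge> 1. The truncation factor
  beats \<open>X N\<close> because T is of order N / log N.\<close>

lemma eventually_mesh:
  fixes d \<alpha> \<sigma> \<epsilon> :: real
  assumes d: "0 < d" and \<alpha>: "0 < \<alpha>" and \<sigma>: "0 < \<sigma>" and \<epsilon>: "0 < \<epsilon>"
  defines "h \<equiv> mesh \<alpha> d" and "X \<equiv> \<lambda>N. exp (- (pi * d * real N / ln (2 * d * real N / \<alpha>)))"
  shows "\<forall>\<^sub>F N in sequentially. 1 \<le> N \<and> 0 < h N \<and> h N \<le> 1 \<and> 1 / h N \<le> real N \<and> sqrt (h N) \<le> \<epsilon> \<and>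
     1 / sinh (pi * d / h N) \<le> 4 * X N \<and> (real N)\<^sup>2 * exp (- \<sigma> * real N) \<le> X N \<and>
     h N * sqrt ((2 * real N + 1) * (1 + pi)) \<le> 1 \<and> exp (real N * h N) = 2 * d * real N / \<alpha>"
proof -

  have 1: "\<forall>\<^sub>F N in sequentially. 1 \<le> ln (2 * d * real N / \<alpha>)" using d \<alpha> by real_asymp
  have 2: "\<forall>\<^sub>F N in sequentially. ln (2 * d * real N / \<alpha>) / real N \<le> 1" using d \<alpha> by real_asymp
  have "(\<lambda>N. sqrt (ln (2 * d * real N / \<alpha>) / real N)) \<longlonglongrightarrow> 0" using d \<alpha> by real_asymp
  then have 3: "\<forall>\<^sub>F N in sequentially. sqrt (ln (2 * d * real N / \<alpha>) / real N) < \<epsilon>" using \<epsilon> by (rule order_tendstoD)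
  have "filterlim (\<lambda>N. pi * d * real N / ln (2 * d * real N / \<alpha>)) at_top sequentially" using d \<alpha> by real_asymp
  then have 4: "\<forall>\<^sub>F N in sequentially. 1 \<le> pi * d * real N / ln (2 * d * real N / \<alpha>)" by (simp add: filterlim_at_top)
  have "filterlim (\<lambda>N. ln (2 * d * real N / \<alpha>)) at_top sequentially" using d \<alpha> by real_asymp
  \<comment> \<open>This makes T \<le> (\<sigma> / 2) N, so half of the exponent \<sigma> N already
    reaches the target and the other half absorbs the factor N^2.\<close>
  then have 5: "\<forall>\<^sub>F N in sequentially. 2 * pi * d / \<sigma> \<le> ln (2 * d * real N / \<alpha>)" by (simp add: filterlim_at_top)
  have "(\<lambda>N. (real N)\<^sup>2 * exp (- (\<sigma> / 2) * real N)) \<longlonglongrightarrow> 0" using \<sigma> by real_asymp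
  then have 7: "\<forall>\<^sub>F N in sequentially. (real N)\<^sup>2 * exp (- (\<sigma> / 2) * real N) < 1" by (rule order_tendstoD) simp
  have "(\<lambda>N. ln (2 * d * real N / \<alpha>) / real N * sqrt (2 * real N + 1)) \<longlonglongrightarrow> 0" using d \<alpha> by real_asymp
  then have "(\<lambda>N. ln (2 * d * real N / \<alpha>) / real N * sqrt (2 * real N + 1) * sqrt (1 + pi)) \<longlonglongrightarrow> 0"
    by (rule tendsto_mult_left_zero)
  then have "(\<lambda>N. ln (2 * d * real N / \<alpha>) / real N * sqrt ((2 * real N + 1) * (1 + pi))) \<longlonglongrightarrow> 0"
    by (simp only: real_sqrt_mult mult.assoc)
  then have 6: "\<forall>\<^sub>F N in sequentially. ln (2 * d * real N / \<alpha>) / real N * sqrt ((2 * real N + 1) * (1 + pi)) < 1" by (rule order_tendstoD) simp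
  show ?thesis using 1 2 3 4 5 7 6 eventually_ge_at_top[of 1]
  proof eventually_elim
    fix N :: nat
    define l where "l = ln (2 * d * real N / \<alpha>)"
    assume 1: "1 \<le> ln (2 * d * real N / \<alpha>)" and 2: "ln (2 * d * real N / \<alpha>) / real N \<le> 1" and 3: "sqrt (ln (2 * d * real N / \<alpha>) / real N) < \<epsilon>"
      and 4: "1 \<le> pi * d * real N / ln (2 * d * real N / \<alpha>)" and 5: "2 * pi * d / \<sigma> \<le> ln (2 * d * real N / \<alpha>)"
      and 7: "(real N)\<^sup>2 * exp (- (\<sigma> / 2) * real N) < 1"
      and 6: "ln (2 * d * real N / \<alpha>) / real N * sqrt ((2 * real N + 1) * (1 + pi)) < 1" and N: "1 \<le> N"
    have hl: "h N = l / real N" by (simp add: h_def mesh_def l_def)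
    have l: "1 \<le> l" using 1 by (simp add: l_def)
    have ht: "pi * d / h N = pi * d * real N / l" using N l by (simp add: hl)
    define T where "T = pi * d * real N / l"
    have T: "1 \<le> T" using 4 by (simp add: T_def l_def)
    have XT: "X N = exp (- T)" by (simp add: X_def T_def l_def)
    have "1 / h N \<le> real N"
    proof -
      have "1 / h N = real N / l" by (simp add: hl)
      also have "\<dots> \<le> real N / 1" using l by (intro divide_left_mono) auto
      finally show ?thesis by simp
    qed
    moreover have "1 / sinh T \<le> 4 * exp (- T)"
    proof -
      have "2 \<le> exp T" using exp_ge_add_one_self[of T] T by linarith
      then have "exp (- T) \<le> 1 / 2" by (simp add: exp_minus inverse_eq_divide divide_le_eq)
      then have "exp T / 4 \<le> sinh T" using \<open>2 \<le> exp T\<close> by (simp add: sinh_def)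
      moreover have "0 < exp T / 4" by simp
      ultimately have "1 / sinh T \<le> 1 / (exp T / 4)" by (rule frac_le[OF zero_le_one order_refl, rotated])
      also have "1 / (exp T / 4) = 4 * exp (- T)" unfolding exp_minus inverse_eq_divide by simp
      finally show ?thesis .
    qed
    moreover have "exp (real N * h N) = 2 * d * real N / \<alpha>"
    proof -
      have "real N * h N = l" using N by (simp add: hl)
      moreover have "0 < 2 * d * real N / \<alpha>" using d \<alpha> N by simp
      ultimately show ?thesis by (simp add: l_def)
    qed
    moreover have "(real N)\<^sup>2 * exp (- \<sigma> * real N) \<le> X N"
    proof -
      have "pi * d \<le> (\<sigma> / 2) * l" using 5 \<sigma> unfolding l_def[symmetric] by (simp add: divide_le_eq mult_ac)
      then have "pi * d * real N \<le> (\<sigma> / 2) * l * real N" by (rule mult_right_mono) simp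
      then have "T \<le> (\<sigma> / 2) * real N" unfolding T_def using l by (subst pos_divide_le_eq) (simp_all add: mult_ac)
      then have "exp (- (\<sigma> / 2) * real N) \<le> X N" unfolding XT by simp
      moreover have "(real N)\<^sup>2 * exp (- \<sigma> * real N) = ((real N)\<^sup>2 * exp (- (\<sigma> / 2) * real N)) * exp (- (\<sigma> / 2) * real N)"
        by (simp add: mult.assoc flip: exp_add)
      moreover have "((real N)\<^sup>2 * exp (- (\<sigma> / 2) * real N)) * exp (- (\<sigma> / 2) * real N) \<le> 1 * exp (- (\<sigma> / 2) * real N)"
        using 7 by (intro mult_right_mono) auto
      ultimately show ?thesis by linarith
    qed
    moreover have "0 < h N" using l N by (simp add: hl)
    ultimately show "1 \<le> N \<and> 0 < h N \<and> h N \<le> 1 \<and> 1 / h N \<le> real N \<and> sqrt (h N) \<le> \<epsilon> \<and>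
     1 / sinh (pi * d / h N) \<le> 4 * X N \<and> (real N)\<^sup>2 * exp (- \<sigma> * real N) \<le> X N \<and>
     h N * sqrt ((2 * real N + 1) * (1 + pi)) \<le> 1 \<and> exp (real N * h N) = 2 * d * real N / \<alpha>"
      using N 2 3 6 unfolding ht T_def[symmetric] XT unfolding hl l_def by auto
  qed
qed

section \<open>Convergence\<close>

text \<open>A trivial kernel is what the stability estimate provides; unique solvability gives the
  definite description in \<open>collocation_solution\<close> its meaning.\<close>

lemma invertible_mat_of_trivial_kernel:
  fixes A :: "complex mat"
  assumes A: "A \<in> carrier_mat n n" and ker: "\<And>v. v \<in> carrier_vec n \<Longrightarrow> A *\<^sub>v v = 0\<^sub>v n \<Longrightarrow> v = 0\<^sub>v n"
  shows "invertible_mat A" "b \<in> carrier_vec n \<Longrightarrow> \<exists>!c. c \<in> carrier_vec n \<and> A *\<^sub>v c = b"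
proof -
  have "Determinant.det A \<noteq> 0" using det_0_iff_vec_prod_zero_field[OF A] ker by blast
  then have "A \<in> Units (ring_mat TYPE(complex) n ())" by (rule det_non_zero_imp_unit[OF A])
  then obtain B where B: "B \<in> carrier_mat n n" "B * A = 1\<^sub>m n" "A * B = 1\<^sub>m n"
    unfolding Units_def ring_mat_simps by blast
  show "invertible_mat A" unfolding invertible_mat_def inverts_mat_def
    using A B by auto
  assume b: "b \<in> carrier_vec n"
  show "\<exists>!c. c \<in> carrier_vec n \<and> A *\<^sub>v c = b"
  proof (intro ex1I[of _ "B *\<^sub>v b"] conjI)
    show "B *\<^sub>v b \<in> carrier_vec n" using B b by simp
    show "A *\<^sub>v (B *\<^sub>v b) = b"
      unfolding assoc_mult_mat_vec[OF A B(1) b, symmetric] B(3) by (rule one_mult_mat_vec[OF b])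
    fix c assume c: "c \<in> carrier_vec n \<and> A *\<^sub>v c = b"
    then have c1: "c \<in> carrier_vec n" and c2: "b = A *\<^sub>v c" by auto
    show "c = B *\<^sub>v b"
      unfolding c2 assoc_mult_mat_vec[OF B(1) A c1, symmetric] B(2) by (rule one_mult_mat_vec[OF c1, symmetric])
  qed
qed

context volterra_problem
begin

lemma collocation_row:
  fixes c :: "complex Matrix.vec"
  assumes c: "c \<in> carrier_vec (2 * N + 1)" and i: "i \<in> {- int N..int N}"
  shows "vec_index ((1\<^sub>m (2 * N + 1) - V_DE a b k h N) *\<^sub>v c) (nat (i + int N)) =
    vec_index c (nat (i + int N)) - (\<Sum>j = - int N..int N. k (Inner (of_real (of_int i * h))) (Inner (of_real (of_int j * h)))
      * of_real (de_dpsi a b (of_int j * h) * h * delta_minus1 (i - j)) * vec_index c (nat (j + int N)))"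
proof -
  define p where "p = nat (i + int N)"
  have p: "p < 2 * N + 1" "int p - int N = i" using i by (auto simp: p_def)
  have V: "V_DE a b k h N \<in> carrier_mat (2 * N + 1) (2 * N + 1)" by (simp add: V_DE_def)
  have "(1\<^sub>m (2 * N + 1) - V_DE a b k h N) *\<^sub>v c = 1\<^sub>m (2 * N + 1) *\<^sub>v c - V_DE a b k h N *\<^sub>v c"
    by (rule minus_mult_distrib_mat_vec[OF one_carrier_mat V c])
  then have "vec_index ((1\<^sub>m (2 * N + 1) - V_DE a b k h N) *\<^sub>v c) p = vec_index c p - vec_index (V_DE a b k h N *\<^sub>v c) p"
    using p c V by simp
  also have "vec_index (V_DE a b k h N *\<^sub>v c) p = (\<Sum>q = 0..<2 * N + 1. V_DE a b k h N $$ (p, q) * vec_index c q)"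
    using p(1) V c by (simp add: scalar_prod_def)
  also have "\<dots> = (\<Sum>q = 0..<2 * N + 1. k (Inner (of_real (of_int i * h))) (Inner (of_real (of_int (int q - int N) * h)))
      * of_real (de_dpsi a b (of_int (int q - int N) * h) * h * delta_minus1 (i - (int q - int N))) * vec_index c (nat ((int q - int N) + int N)))"
  proof (rule sum.cong[OF refl])
    fix q assume "q \<in> {0..<2 * N + 1}"
    then have "V_DE a b k h N $$ (p, q) = k (Inner (of_real (of_int i * h))) (Inner (of_real (of_int (int q - int N) * h)))
      * of_real (de_dpsi a b (of_int (int q - int N) * h) * h * delta_minus1 (i - (int q - int N)))"
      unfolding V_DE_def using p(1) by (simp add: Let_def p(2)[symmetric] node_def interval_point_simps[OF ab] deriv_de_psi del: of_int_diff)
    then show "V_DE a b k h N $$ (p, q) * vec_index c q = k (Inner (of_real (of_int i * h))) (Inner (of_real (of_int (int q - int N) * h)))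
      * of_real (de_dpsi a b (of_int (int q - int N) * h) * h * delta_minus1 (i - (int q - int N))) * vec_index c (nat ((int q - int N) + int N))"
      by simp
  qed
  finally show ?thesis unfolding p_def sum_int_nat .
qed

lemma omega_bounds:
  assumes "t \<in> {a..b}"
  shows "0 \<le> omega_a a b t" "omega_a a b t \<le> 1" "0 \<le> omega_b a b t" "omega_b a b t \<le> 1"
  using assms ab by (auto simp: omega_a_def omega_b_def divide_le_eq)

text \<open>The collocation values and the nodal values of the exact solution satisfy the same linear system up to the
  quadrature error, so stability turns the factor \<open>h\<close> gained in the quadrature error into a nodal error that survives
  multiplication by the norm of the interpolation operator.\<close>

lemma collocation_error:
  obtains N0 C where "0 < N0" "\<And>N. N0 \<le> N \<Longrightarrow> invertible_mat (1\<^sub>m (2 * N + 1) - V_DE a b k (mesh \<alpha> d N) N)"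
    "\<And>N t. N0 \<le> N \<Longrightarrow> t \<in> {a..b} \<Longrightarrow> cmod (u t - v_DE a b g k (mesh \<alpha> d N) N t) \<le> C * exp (- (pi * d * real N / ln (2 * d * real N / \<alpha>)))"
proof -
  obtain U \<mu> B where U: "U holomorphic_on strip d" and \<mu>: "0 < \<mu>" and B: "0 < B"
    and UB: "\<And>z. z \<in> strip d \<Longrightarrow> cmod (U z) \<le> B"
    and Ur: "\<And>x. U (of_real x) = u (de_psi a b x)"
    and Ua: "\<And>z. z \<in> strip d \<Longrightarrow> Re z \<le> 0 \<Longrightarrow> cmod (U z - u a) \<le> B * exp (- \<mu> * cosh (Re z))"
    and Ub: "\<And>z. z \<in> strip d \<Longrightarrow> 0 \<le> Re z \<Longrightarrow> cmod (U z - u b) \<le> B * exp (- \<mu> * cosh (Re z))"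
    using solution_extension by metis
  obtain K where K: "0 < K" "\<And>z w. z \<in> strip d \<Longrightarrow> w \<in> strip d \<Longrightarrow> cmod (k (Inner z) (Inner w)) \<le> K"
    using k_bounded by blast
  obtain \<kappa> A where \<kappa>: "0 < \<kappa>" and A: "0 < A"
    and pa: "\<And>z. z \<in> strip d \<Longrightarrow> Re z \<le> 0 \<Longrightarrow> cmod (de_psi a b z - of_real a) \<le> A * exp (- \<kappa> * cosh (Re z))"
    and pb: "\<And>z. z \<in> strip d \<Longrightarrow> 0 \<le> Re z \<Longrightarrow> cmod (of_real b - de_psi a b z) \<le> A * exp (- \<kappa> * cosh (Re z))"
    and dp: "\<And>z. z \<in> strip d \<Longrightarrow> cmod (de_dpsi a b z) \<le> A * exp (- \<kappa> * cosh (Re z))"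
    and hp: "\<And>z. z \<in> strip d \<Longrightarrow> (de_psi a b has_field_derivative de_dpsi a b z) (at z)"
    using de_psi_strip_bounds[OF ab d] by metis
  note p = de_psi_real_properties[OF ab]
  note ip = interval_point_simps[OF ab]
  have in_ab: "de_psi a b s \<in> {a..b}" for s using p(1,2)[of s] by simp
  have rs: "complex_of_real x \<in> strip d" for x using d by (simp add: strip_def)
  have psi_hol: "de_psi a b holomorphic_on strip d" unfolding holomorphic_on_open[OF open_strip] using hp by blast
  have dpsi_hol: "de_dpsi a b holomorphic_on strip d"
    using holomorphic_deriv[OF psi_hol open_strip] by (rule holomorphic_transform) (use hp DERIV_imp_deriv in blast)
  have k_hol: "(\<lambda>w. k (Inner z) (Inner w)) holomorphic_on strip d" if "z \<in> strip d" for z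
    using k_hol2 strip_surface[OF that] unfolding H_infty_def by (blast intro: analytic_imp_holomorphic)

  define Cw where "Cw = A * (2 / \<kappa>)"
  have Cw: "0 \<le> Cw" using A \<kappa> by (simp add: Cw_def)
  have w0: "0 \<le> de_dpsi a b (x::real)" for x using p(3)[of x] by simp
  have w1: "de_dpsi a b x \<le> Cw / (1 + x\<^sup>2)" for x :: real
  proof -
    have "de_dpsi a b x \<le> cmod (de_dpsi a b (of_real x))" unfolding of_real_de_dpsi[symmetric] norm_of_real by simp
    also have "\<dots> \<le> A * exp (- \<kappa> * cosh x)" using dp[OF rs, of x] by simp
    also have "\<dots> \<le> A * ((2 / \<kappa>) / (1 + x\<^sup>2))" using A by (intro mult_left_mono exp_cosh_le \<kappa>) auto
    finally show ?thesis by (simp add: Cw_def)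
  qed
  define \<Gamma> where "\<Gamma> = exp (K * Cw * (1 + pi))"
  have \<Gamma>: "0 < \<Gamma>" by (simp add: \<Gamma>_def)
  \<comment> \<open>Chosen so that \<Gamma> (2 K Cw (1 + pi) + 1) \<epsilon>0 = 1 / 2, which yields
    the smallness condition of the stability lemma when sqrt h \<le> \<epsilon>0; the summand 1
    keeps the denominator positive.\<close>
  define \<epsilon>0 where "\<epsilon>0 = 1 / (2 * \<Gamma> * (2 * K * Cw * (1 + pi) + 1))"
  have pos: "0 < 2 * K * Cw * (1 + pi) + 1" using K Cw by (intro add_nonneg_pos) auto
  have \<epsilon>0: "0 < \<epsilon>0" using \<Gamma> pos by (simp add: \<epsilon>0_def)
  have small: "\<Gamma> * (2 * K * Cw * (1 + pi) * s) \<le> 1 / 2" if "s \<le> \<epsilon>0" "0 \<le> s" for s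
  proof -
    have "\<Gamma> * (2 * K * Cw * (1 + pi) * s) \<le> \<Gamma> * ((2 * K * Cw * (1 + pi) + 1) * \<epsilon>0)"
      using \<Gamma> pos that by (intro mult_left_mono mult_mono) auto
    also have "\<dots> = 1 / 2" using \<Gamma> pos by (simp add: \<epsilon>0_def)
    finally show ?thesis .
  qed

  have stab: "cmod (x i) \<le> 2 * \<Gamma> * \<rho>"
    if h: "0 < h" "h \<le> 1" "sqrt h \<le> \<epsilon>0"
      and eq: "\<And>i. i \<in> {- int N..int N} \<Longrightarrow> x i = r i + (\<Sum>j = - int N..int N. k (Inner (of_real (of_int i * h))) (Inner (of_real (of_int j * h)))
      * of_real (de_dpsi a b (of_int j * h) * h * delta_minus1 (i - j)) * x j)"
      and r: "\<And>i. i \<in> {- int N..int N} \<Longrightarrow> cmod (r i) \<le> \<rho>" and i: "i \<in> {- int N..int N}"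
    for h N x r \<rho> i
    unfolding \<Gamma>_def
    by (rule collocation_stability[OF h(1,2) less_imp_le[OF K(1)] K(2)[OF rs rs] w0 w1 Cw eq r _ i])
       (use small[OF h(3)] h in \<open>auto simp: \<Gamma>_def\<close>)

  have solve: "invertible_mat (1\<^sub>m (2 * N + 1) - V_DE a b k h N) \<and>
      collocation_solution a b g k h N \<in> carrier_vec (2 * N + 1) \<and>
      (1\<^sub>m (2 * N + 1) - V_DE a b k h N) *\<^sub>v collocation_solution a b g k h N = collocation_rhs a b g h N"
    if h: "0 < h" "h \<le> 1" "sqrt h \<le> \<epsilon>0" for h N
  proof -
    let ?A = "1\<^sub>m (2 * N + 1) - V_DE a b k h N"
    have cA: "?A \<in> carrier_mat (2 * N + 1) (2 * N + 1)" by (simp add: V_DE_def minus_carrier_mat)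
    \<comment> \<open>A vector in the kernel solves the system with right-hand side 0, so stability
      bounds all its entries by 0.\<close>
    have ker: "v = 0\<^sub>v (2 * N + 1)" if v: "v \<in> carrier_vec (2 * N + 1)" "?A *\<^sub>v v = 0\<^sub>v (2 * N + 1)" for v
    proof -
      define x where "x i = vec_index v (nat (i + int N))" for i
      have eq: "x i = 0 + (\<Sum>j = - int N..int N. k (Inner (of_real (of_int i * h))) (Inner (of_real (of_int j * h)))
        * of_real (de_dpsi a b (of_int j * h) * h * delta_minus1 (i - j)) * x j)" if i: "i \<in> {- int N..int N}" for i
      proof -
        have "nat (i + int N) < 2 * N + 1" using i by auto
        then have "vec_index (?A *\<^sub>v v) (nat (i + int N)) = 0" using v(2) by simp
        then show ?thesis unfolding collocation_row[OF v(1) i] x_def[symmetric] by simp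
      qed
      have "x i = 0" if i: "i \<in> {- int N..int N}" for i
      proof -
        have "cmod (x i) \<le> 2 * \<Gamma> * 0" by (rule stab[where r = "\<lambda>_. 0", OF h eq _ i]) simp_all
        then show ?thesis by simp
      qed
      from this[of "int _ - int N"] have "vec_index v q = 0" if "q < 2 * N + 1" for q
        using that unfolding x_def by simp
      then show ?thesis using v(1) by (intro eq_vecI) auto
    qed
    have rhs: "collocation_rhs a b g h N \<in> carrier_vec (2 * N + 1)" by (simp add: collocation_rhs_def)
    have "invertible_mat ?A" by (rule invertible_mat_of_trivial_kernel(1)[OF cA ker])
    moreover have "collocation_solution a b g k h N \<in> carrier_vec (2 * N + 1) \<and> ?A *\<^sub>v collocation_solution a b g k h N = collocation_rhs a b g h N"
      unfolding collocation_solution_def by (rule theI'[OF invertible_mat_of_trivial_kernel(2)[OF cA ker rhs]])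
    ultimately show ?thesis by blast
  qed

  define Q where "Q h N = K * A * B * (2 * h * (2 + pi) / (\<kappa> * pi * d * sinh (pi * d / h)) + 12 / \<kappa> * (1 + pi) * exp (- (\<kappa> / 2) * cosh (real N * h)))" for h N
  have nodal: "cmod (u (de_psi a b (of_int i * h)) - vec_index (collocation_solution a b g k h N) (nat (i + int N))) \<le> 2 * \<Gamma> * Q h N"
    if h: "0 < h" "h \<le> 1" "sqrt h \<le> \<epsilon>0" and i: "i \<in> {- int N..int N}" for h N i
  proof -
    define c where "c i = vec_index (collocation_solution a b g k h N) (nat (i + int N))" for i
    let ?m = "\<lambda>i j. k (Inner (of_real (of_int i * h))) (Inner (of_real (of_int j * h))) * of_real (de_dpsi a b (of_int j * h) * h * delta_minus1 (i - j))"
    define un where "un j = u (de_psi a b (of_int j * h))" for j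
    \<comment> \<open>The residual of the exact nodal values in the collocation system; the integral
      equation identifies it with the quadrature error of k psi' u.\<close>
    define r where "r i = un i - (\<Sum>j = - int N..int N. ?m i j * un j) - g (Inner (of_real (of_int i * h)))" for i
    have ceq: "c i - (\<Sum>j = - int N..int N. ?m i j * c j) = g (Inner (of_real (of_int i * h)))" if i: "i \<in> {- int N..int N}" for i
    proof -
      have q: "nat (i + int N) < 2 * N + 1" "int (nat (i + int N)) - int N = i" using i by auto
      have "c i - (\<Sum>j = - int N..int N. ?m i j * c j) = vec_index (collocation_rhs a b g h N) (nat (i + int N))"
        using collocation_row[OF _ i, of "collocation_solution a b g k h N" h] solve[OF h, of N] unfolding c_def by simp
      also have "\<dots> = g (Inner (of_real (of_int i * h)))"
        unfolding collocation_rhs_def using q by (simp add: node_def ip del: of_int_diff)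
      finally show ?thesis .
    qed
    have eq: "un i - c i = r i + (\<Sum>j = - int N..int N. ?m i j * (un j - c j))" if i: "i \<in> {- int N..int N}" for i
      unfolding r_def right_diff_distrib sum_subtractf ceq[OF i, symmetric] by simp
    have rb: "cmod (r i) \<le> Q h N" if i: "i \<in> {- int N..int N}" for i
    proof -
      define z where "z = complex_of_real (of_int i * h)"
      have zs: "z \<in> strip d" unfolding z_def by (rule rs)
      define H where "H w = k (Inner z) (Inner w) * de_dpsi a b w * U w" for w
      have H: "H holomorphic_on strip d" unfolding H_def[abs_def]
        by (intro holomorphic_on_mult k_hol[OF zs] dpsi_hol U)
      have HB: "cmod (H w) \<le> K * A * B * exp (- \<kappa> * cosh (Re w))" if w: "w \<in> strip d" for w
      proof -
        have "cmod (H w) \<le> K * (A * exp (- \<kappa> * cosh (Re w))) * B"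
          unfolding H_def norm_mult using K A B by (intro mult_mono K(2) zs w dp UB) auto
        then show ?thesis by (simp only: mult_ac)
      qed
      define f where "f s = k (interval_point a b (de_psi a b (of_int i * h))) (interval_point a b s) * u s" for s
      have fc: "continuous_on {a..b} f" unfolding f_def by (rule k_section_cont[OF in_ab])
      define P where "P s = integral {a..de_psi a b s} f" for s
      have P1: "(P has_vector_derivative H (of_real s)) (at s)" for s
      proof -
        have "de_dpsi a b s *\<^sub>R f (de_psi a b s) = H (of_real s)"
          unfolding f_def H_def ip z_def[symmetric] Ur scaleR_conv_of_real of_real_de_dpsi by (simp only: mult_ac)
        then show ?thesis using integral_de_psi_substitution(1)[OF ab fc, of s] unfolding P_def[abs_def] by simp
      qed
      have P2: "(P \<longlongrightarrow> 0) at_bot" unfolding P_def[abs_def] by (rule integral_de_psi_substitution(2)[OF ab fc])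
      have iN: "\<bar>i\<bar> \<le> int N" using i by auto
      have KAB: "0 \<le> K * A * B" using K A B by simp
      have "cmod (P (of_int i * h) - h * (\<Sum>j = - int N..int N. H (of_real (of_int j * h)) * of_real (delta_minus1 (i - j)))) \<le> Q h N"
        unfolding Q_def by (rule sinc_quadrature_error[OF H \<kappa> KAB HB d(1) h(1,2) P1 P2 iN])
      moreover have "r i = P (of_int i * h) - h * (\<Sum>j = - int N..int N. H (of_real (of_int j * h)) * of_real (delta_minus1 (i - j)))"
      proof -
        have "(\<Sum>j = - int N..int N. ?m i j * un j) = h * (\<Sum>j = - int N..int N. H (of_real (of_int j * h)) * of_real (delta_minus1 (i - j)))"
        proof -
          have gen: "kk * of_real (w * h * dl) * uu = of_real h * (kk * of_real w * uu * of_real dl)" for kk uu :: complex and w dl :: real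
            by (simp add: mult_ac)
          show ?thesis unfolding sum_distrib_left H_def un_def Ur z_def of_real_de_dpsi[symmetric] gen ..
        qed
        moreover have "un i - g (Inner z) = P (of_int i * h)"
        proof -
          have "u (de_psi a b (of_int i * h)) - integral {a..de_psi a b (of_int i * h)} f = g (interval_point a b (de_psi a b (of_int i * h)))"
            using u_eq[rule_format, OF in_ab[of "of_int i * h"]] unfolding f_def .
          then have "u (de_psi a b (of_int i * h)) - integral {a..de_psi a b (of_int i * h)} f = g (Inner z)" unfolding ip z_def .
          then show ?thesis unfolding P_def un_def by (metis add_diff_cancel_left' diff_add_cancel)
        qed
        ultimately show ?thesis unfolding r_def z_def by (simp add: algebra_simps)
      qed
      ultimately show ?thesis by simp
    qed
    show ?thesis using stab[OF h eq rb i] unfolding un_def c_def .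
  qed

  define \<nu> where "\<nu> = min \<mu> \<kappa>"
  have \<nu>: "0 < \<nu>" "\<nu> \<le> \<mu>" "\<nu> \<le> \<kappa>" using \<mu> \<kappa> by (simp_all add: \<nu>_def)
  have ex\<nu>: "exp (- r * cosh x) \<le> exp (- \<nu> * cosh x)" if "\<nu> \<le> r" for r x :: real
    using that cosh_real_pos[of x] by (simp add: mult_right_mono)
  \<comment> \<open>On the interval this is u minus the linear interpolant of its end values. It
    decays at both ends, as Sinc interpolation requires; \<open>v_DE\<close> has the same structure
    with computed values in place of exact ones.\<close>
  define F where "F z = U z - u a * ((of_real b - de_psi a b z) / of_real (b - a)) - u b * ((de_psi a b z - of_real a) / of_real (b - a))" for z
  have F: "F holomorphic_on strip d" unfolding F_def[abs_def] using ab by (intro holomorphic_intros U psi_hol) auto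
  define B' where "B' = B + (cmod (u a) + cmod (u b)) * (A / (b - a))"
  have B': "0 \<le> B'" using A B ab unfolding B'_def by (intro add_nonneg_nonneg mult_nonneg_nonneg) auto
  have FB: "cmod (F z) \<le> B' * exp (- \<nu> * cosh (Re z))" if z: "z \<in> strip d" for z
  proof -
    let ?E = "exp (- \<nu> * cosh (Re z))"
    have BE: "B * exp (- \<mu> * cosh (Re z)) \<le> B * ?E" "A * exp (- \<kappa> * cosh (Re z)) \<le> A * ?E"
      using B A by (intro mult_left_mono ex\<nu> \<nu>; simp)+
    have ba: "complex_of_real (b - a) \<noteq> 0" using ab by simp
    have one: "(of_real b - de_psi a b z) / of_real (b - a) = 1 - (de_psi a b z - of_real a) / of_real (b - a)"
      using ba by (simp add: diff_divide_distrib[symmetric] field_simps)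
    \<comment> \<open>Common to both halves of the strip: \<open>X - x\<close> is the deviation of U
      from the nearer end value, \<open>x - y\<close> the difference of the end values, and
      \<open>q\<close> the coefficient of the farther one, which is small there.\<close>
    have gen: "cmod ((X - x) + (x - y) * q) \<le> B' * ?E"
      if "cmod (X - x) \<le> B * exp (- \<mu> * cosh (Re z))" "cmod (x - y) \<le> cmod (u a) + cmod (u b)" "cmod q \<le> A / (b - a) * ?E" for X x y q
    proof -
      have "cmod ((X - x) + (x - y) * q) \<le> cmod (X - x) + cmod (x - y) * cmod q" by (metis norm_triangle_ineq norm_mult)
      also have "\<dots> \<le> B * ?E + (cmod (u a) + cmod (u b)) * (A / (b - a) * ?E)"
        using that BE(1) by (intro add_mono mult_mono) auto
      finally show ?thesis unfolding B'_def distrib_right by (simp only: mult.assoc)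
    qed
    show ?thesis
    proof (cases "Re z \<le> 0")
      case True
      define q where "q = (de_psi a b z - of_real a) / of_real (b - a)"
      have "cmod q \<le> A * ?E / (b - a)"
        using order_trans[OF pa[OF z True] BE(2)] ab unfolding q_def norm_divide norm_of_real by (simp add: divide_right_mono)
      moreover have "F z = (U z - u a) + (u a - u b) * q" unfolding F_def one q_def[symmetric] by (simp add: algebra_simps)
      ultimately show ?thesis using gen[OF Ua[OF z True], of "u b" q] norm_triangle_ineq4[of "u a" "u b"] by simp
    next
      case False
      define q where "q = (of_real b - de_psi a b z) / of_real (b - a)"
      have "cmod q \<le> A * ?E / (b - a)"
        using order_trans[OF pb[OF z] BE(2)] False ab unfolding q_def norm_divide norm_of_real by (simp add: divide_right_mono)
      moreover have "F z = (U z - u b) + (u b - u a) * q"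
      proof -
        have q1: "(de_psi a b z - of_real a) / of_real (b - a) = 1 - q" unfolding q_def one by simp
        have "U z - u a * q - u b * (1 - q) = (U z - u b) + (u b - u a) * q" by (simp add: algebra_simps)
        then show ?thesis unfolding F_def q1 q_def[symmetric] .
      qed
      ultimately show ?thesis using gen[OF Ub[OF z], of "u a" q] False norm_triangle_ineq4[of "u b" "u a"] by simp
    qed
  qed
  have Fr: "F (of_real x) = u (de_psi a b x) - u a * of_real (omega_a a b (de_psi a b x)) - u b * of_real (omega_b a b (de_psi a b x))" for x
    unfolding F_def Ur omega_a_def omega_b_def of_real_divide of_real_diff of_real_de_psi ..

  define I where "I h N = B' * (2 / (\<nu> * d * sinh (pi * d / h)) + (4 * d / pi + 4 / \<nu> * (1 + pi)) / h * exp (- (\<nu> / 2) * cosh (real N * h)))" for h N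
  \<comment> \<open>Error of the end values: u(a) and u(b) are replaced by u_{-N} and u_N, at the
    cost of the deviation of u at the outermost node and of the nodal error.\<close>
  define T where "T h N = B * exp (- \<mu> * cosh (real N * h)) + 2 * \<Gamma> * Q h N" for h N
  define \<Lambda> where "\<Lambda> N = sqrt ((2 * real N + 1) * (1 + pi))" for N
  have \<Lambda>1: "1 \<le> \<Lambda> N" for N
  proof -
    have "1 * 1 \<le> (2 * real N + 1) * (1 + pi)" by (intro mult_mono) auto
    then show ?thesis unfolding \<Lambda>_def by simp
  qed
  have total: "cmod (u t - v_DE a b g k h N t) \<le> I h N + 5 * T h N * \<Lambda> N"
    if h: "0 < h" "h \<le> 1" "sqrt h \<le> \<epsilon>0" and t: "t \<in> {a..b}" for h N t
  proof -
    define c where "c j = vec_index (collocation_solution a b g k h N) (nat (j + int N))" for j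
    define un where "un j = u (de_psi a b (of_int j * h))" for j
    have e: "cmod (un j - c j) \<le> 2 * \<Gamma> * Q h N" if "j \<in> {- int N..int N}" for j
      using nodal[OF h that] unfolding un_def c_def .
    have Q0: "0 \<le> Q h N" unfolding Q_def using K A B \<kappa> d h by (intro mult_nonneg_nonneg add_nonneg_nonneg divide_nonneg_nonneg) auto
    have T0: "0 \<le> T h N" "2 * \<Gamma> * Q h N \<le> T h N" unfolding T_def using B \<Gamma> Q0 by auto
    have I0: "0 \<le> I h N" unfolding I_def using B' \<nu> d h by (intro mult_nonneg_nonneg add_nonneg_nonneg divide_nonneg_nonneg) auto
    let ?dp = "u a - c (- int N)" and ?dq = "u b - c (int N)"
    have ends: "cmod ?dp \<le> T h N" "cmod ?dq \<le> T h N"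
    proof -
      have "cmod (un (- int N) - u a) \<le> B * exp (- \<mu> * cosh (real N * h))"
        using Ua[OF rs, of "of_int (- int N) * h"] h unfolding Ur un_def by simp
      moreover have "cmod (un (int N) - u b) \<le> B * exp (- \<mu> * cosh (real N * h))"
        using Ub[OF rs, of "of_int (int N) * h"] h unfolding Ur un_def by simp
      ultimately show "cmod ?dp \<le> T h N" "cmod ?dq \<le> T h N"
        using e[of "- int N"] e[of "int N"] norm_triangle_ineq4[of "un (- int N) - c (- int N)" "un (- int N) - u a"]
          norm_triangle_ineq4[of "un (int N) - c (int N)" "un (int N) - u b"] unfolding T_def by simp_all
    qed
    have v: "v_DE a b g k h N t = c (- int N) * of_real (omega_a a b t) + c (int N) * of_real (omega_b a b t)
         + (\<Sum>j = - int N..int N. (c j - c (- int N) * of_real (omega_a a b (de_psi a b (of_int j * h))) - c (int N) * of_real (omega_b a b (de_psi a b (of_int j * h))))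
                * of_real (sinc_basis_phi a b j h t))"
      unfolding v_DE_def Let_def c_def node_def ..
    have big: "T h N \<le> I h N + 5 * T h N * \<Lambda> N"
    proof -
      have "T h N * 1 \<le> T h N * (5 * \<Lambda> N)" using \<Lambda>1[of N] T0 by (intro mult_left_mono) auto
      then show ?thesis using I0 by (simp add: mult_ac)
    qed
    \<comment> \<open>At the ends all basis functions vanish and \<open>v_DE\<close> reduces to a
      computed end value, so only \<open>T\<close> matters there.\<close>
    consider "t = a" | "t = b" | "t \<in> {a<..<b}" using t by force
    then show ?thesis
    proof cases
      case 1
      have "v_DE a b g k h N t = c (- int N)"
        unfolding v using 1 ab sinc_basis_phi_ends[OF ab h(1)] by (simp add: omega_a_def omega_b_def)
      then show ?thesis using ends(1) big 1 by simp
    next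
      case 2
      have "v_DE a b g k h N t = c (int N)"
        unfolding v using 2 ab sinc_basis_phi_ends[OF ab h(1)] by (simp add: omega_a_def omega_b_def)
      then show ?thesis using ends(2) big 2 by simp
    next
      case 3
      define x where "x = de_phi a b t"
      have tx: "de_psi a b x = t" unfolding x_def using 3 de_psi_de_phi[OF ab] by simp
      let ?S = "\<lambda>j. complex_of_real (sinc_basis j h x)"
      let ?oa = "\<lambda>j. complex_of_real (omega_a a b (de_psi a b (of_int j * h)))" and ?ob = "\<lambda>j. complex_of_real (omega_b a b (de_psi a b (of_int j * h)))"
      have S: "complex_of_real (sinc_basis_phi a b j h t) = ?S j" for j unfolding sinc_basis_phi_def x_def using 3 by simp
      have Fint: "cmod (F (of_real x) - (\<Sum>j = - int N..int N. F (of_real (of_int j * h)) * ?S j)) \<le> I h N"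
        unfolding I_def by (rule sinc_interpolation_error[OF F \<nu>(1) B' FB d(1) h(1,2)])
      \<comment> \<open>Error of a Sinc coefficient: the nodal error and two end corrections, each
        at most \<open>T h N\<close>. Together with the two end terms outside the sum this gives 3 +
        2 = 5.\<close>
      define E where "E j = (un j - c j) - ?dp * ?oa j - ?dq * ?ob j" for j
      have "u t - v_DE a b g k h N t = (F (of_real x) - (\<Sum>j = - int N..int N. F (of_real (of_int j * h)) * ?S j))
         + ?dp * of_real (omega_a a b t) + ?dq * of_real (omega_b a b t) + (\<Sum>j = - int N..int N. E j * ?S j)"
      proof -
        have "(\<Sum>j = - int N..int N. F (of_real (of_int j * h)) * ?S j) = (\<Sum>j = - int N..int N. E j * ?S j) +
           (\<Sum>j = - int N..int N. (c j - c (- int N) * ?oa j - c (int N) * ?ob j) * ?S j)"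
          unfolding sum.distrib[symmetric]
          by (rule sum.cong[OF refl]) (simp add: Fr E_def un_def algebra_simps del: of_real_mult)
        then show ?thesis unfolding v S Fr tx by (simp add: algebra_simps)
      qed
      also have "cmod \<dots> \<le> I h N + T h N * 1 + T h N * 1 + (\<Sum>j = - int N..int N. 3 * T h N * \<bar>sinc_basis j h x\<bar>)"
      proof (intro order_trans[OF norm_triangle_ineq] add_mono Fint)
        show "cmod (?dp * of_real (omega_a a b t)) \<le> T h N * 1" "cmod (?dq * of_real (omega_b a b t)) \<le> T h N * 1"
          unfolding norm_mult norm_of_real using omega_bounds[OF t] ends T0 by (intro mult_mono; simp)+
        have "cmod (E j) \<le> 3 * T h N" if j: "j \<in> {- int N..int N}" for j
        proof -
          have "cmod (?dp * ?oa j) \<le> T h N * 1" "cmod (?dq * ?ob j) \<le> T h N * 1"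
            unfolding norm_mult norm_of_real using omega_bounds[OF in_ab] ends T0 by (intro mult_mono; simp)+
          then show ?thesis unfolding E_def
            using e[OF j] T0(2) norm_triangle_ineq4[of "(un j - c j) - ?dp * ?oa j" "?dq * ?ob j"] norm_triangle_ineq4[of "un j - c j" "?dp * ?oa j"] by linarith
        qed
        then show "cmod (\<Sum>j = - int N..int N. E j * ?S j) \<le> (\<Sum>j = - int N..int N. 3 * T h N * \<bar>sinc_basis j h x\<bar>)"
          by (intro sum_norm_le) (simp only: norm_mult norm_of_real, intro mult_right_mono, auto)
      qed
      also have "(\<Sum>j = - int N..int N. 3 * T h N * \<bar>sinc_basis j h x\<bar>) = 3 * T h N * (\<Sum>j = - int N..int N. \<bar>sinc_basis j h x\<bar>)"
        by (rule sum_distrib_left[symmetric])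
      also have "I h N + T h N * 1 + T h N * 1 + 3 * T h N * (\<Sum>j = - int N..int N. \<bar>sinc_basis j h x\<bar>) \<le> I h N + T h N * \<Lambda> N + T h N * \<Lambda> N + 3 * T h N * \<Lambda> N"
        unfolding \<Lambda>_def using T0 \<Lambda>1[of N, unfolded \<Lambda>_def] by (intro add_mono mult_left_mono sum_abs_sinc_basis_le h order_refl) auto
      finally show ?thesis by (simp add: algebra_simps)
    qed
  qed

  \<comment> \<open>Because cosh(N h) \<ge> exp(N h) / 2 = d N / \<alpha>, the truncation factor
    exp(-(\<nu> / 2) cosh(N h)) is at most exp(-s N).\<close>
  define s where "s = \<nu> / 2 * (d / \<alpha>)"
  have s: "0 < s" using \<nu> d \<alpha> by (simp add: s_def)
  define X where "X N = exp (- (pi * d * real N / ln (2 * d * real N / \<alpha>)))" for N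
  obtain N1 where N1: "\<And>N. N1 \<le> N \<Longrightarrow> 1 \<le> N \<and> 0 < mesh \<alpha> d N \<and> mesh \<alpha> d N \<le> 1 \<and> 1 / mesh \<alpha> d N \<le> real N \<and> sqrt (mesh \<alpha> d N) \<le> \<epsilon>0 \<and>
     1 / sinh (pi * d / mesh \<alpha> d N) \<le> 4 * X N \<and> (real N)\<^sup>2 * exp (- s * real N) \<le> X N \<and>
     mesh \<alpha> d N * \<Lambda> N \<le> 1 \<and> exp (real N * mesh \<alpha> d N) = 2 * d * real N / \<alpha>"
    using eventually_mesh[OF d(1) \<alpha>(1) s \<epsilon>0] unfolding X_def \<Lambda>_def eventually_sequentially by blast
  \<comment> \<open>The factors 8 are 2 times the 4 in 1 / sinh(pi d / h) \<le> 4
    \<open>X N\<close>; the other factors 4 in \<open>C2\<close> come from \<Lambda> N \<le> 4 N.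
    The factor h of the quadrature error is paired with \<Lambda>, as h \<Lambda> \<le> 1.\<close>
  define C1 where "C1 = B' * (8 / (\<nu> * d) + (4 * d / pi + 4 / \<nu> * (1 + pi)))"
  define C2 where "C2 = B * 4 + 2 * \<Gamma> * (K * A * B * (8 * (2 + pi) / (\<kappa> * pi * d) + 12 / \<kappa> * (1 + pi) * 4))"
  have final: "cmod (u t - v_DE a b g k (mesh \<alpha> d N) N t) \<le> (C1 + 5 * C2) * X N" if N: "N1 \<le> N" and t: "t \<in> {a..b}" for N t
  proof -
    define h where "h = mesh \<alpha> d N"
    note m = N1[OF N, folded h_def]
    have h: "0 < h" "h \<le> 1" "sqrt h \<le> \<epsilon>0" using m by blast+
    have N0: "1 \<le> real N" using m by simp
    have sh: "0 < sinh (pi * d / h)" using sinh_pos_quot[OF d(1) h(1)] .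
    have ch: "exp (- (r * cosh (real N * h))) \<le> exp (- s * real N)" if "\<nu> / 2 \<le> r" for r
    proof -
      have "exp t / 2 \<le> cosh t" for t :: real by (simp add: cosh_def)
      from this[of "real N * h"] have "d * real N / \<alpha> \<le> cosh (real N * h)" using m by simp
      then have "\<nu> / 2 * (d * real N / \<alpha>) \<le> r * cosh (real N * h)" using that \<nu> d \<alpha> by (intro mult_mono) auto
      then show ?thesis by (simp add: s_def)
    qed
    have e1: "real N * exp (- s * real N) \<le> X N"
    proof -
      have "real N * exp (- s * real N) \<le> (real N)\<^sup>2 * exp (- s * real N)" using N0 by (intro mult_right_mono) (auto simp: power2_eq_square)
      then show ?thesis using m by linarith
    qed
    have \<Lambda>4: "\<Lambda> N \<le> 4 * real N"
    proof -
      have "(2 * real N + 1) * (1 + pi) \<le> (3 * real N) * 5" using N0 pi_less_4 by (intro mult_mono) auto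
      also have "\<dots> \<le> (4 * real N)\<^sup>2" using N0 by (simp add: power2_eq_square)
      finally show ?thesis unfolding \<Lambda>_def by (intro real_le_lsqrt) auto
    qed
    have \<Lambda>e: "exp (- (r * cosh (real N * h))) * \<Lambda> N \<le> 4 * X N" if "\<nu> / 2 \<le> r" for r
    proof -
      have "exp (- (r * cosh (real N * h))) * \<Lambda> N \<le> exp (- s * real N) * (4 * real N)"
        using \<Lambda>1[of N] by (intro mult_mono ch that \<Lambda>4) auto
      then show ?thesis using e1 by (simp add: mult_ac)
    qed
    have "I h N = B' * (2 / (\<nu> * d) * (1 / sinh (pi * d / h)) + (4 * d / pi + 4 / \<nu> * (1 + pi)) * (1 / h * exp (- (\<nu> / 2 * cosh (real N * h)))))"
      unfolding I_def by simp
    also have "\<dots> \<le> B' * (2 / (\<nu> * d) * (4 * X N) + (4 * d / pi + 4 / \<nu> * (1 + pi)) * X N)"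
    proof (intro mult_left_mono add_mono B')
      show "1 / sinh (pi * d / h) \<le> 4 * X N" using m by blast
      have "1 / h * exp (- (\<nu> / 2 * cosh (real N * h))) \<le> real N * exp (- s * real N)" using m h by (intro mult_mono ch) auto
      then show "1 / h * exp (- (\<nu> / 2 * cosh (real N * h))) \<le> X N" using e1 by linarith
    qed (use \<nu> d in auto)
    also have "\<dots> = C1 * X N" unfolding C1_def by (simp add: algebra_simps)
    finally have Ib: "I h N \<le> C1 * X N" .
    have "T h N * \<Lambda> N = B * (exp (- (\<mu> * cosh (real N * h))) * \<Lambda> N) + 2 * \<Gamma> * (K * A * B * (2 * (2 + pi) / (\<kappa> * pi * d) * (h * \<Lambda> N * (1 / sinh (pi * d / h))) + 12 / \<kappa> * (1 + pi) * (exp (- (\<kappa> / 2 * cosh (real N * h))) * \<Lambda> N)))"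
      unfolding T_def Q_def by (simp add: algebra_simps)
    also have "\<dots> \<le> B * (4 * X N) + 2 * \<Gamma> * (K * A * B * (2 * (2 + pi) / (\<kappa> * pi * d) * (1 * (4 * X N)) + 12 / \<kappa> * (1 + pi) * (4 * X N)))"
    proof (intro add_mono mult_left_mono \<Lambda>e)
      show "h * \<Lambda> N * (1 / sinh (pi * d / h)) \<le> 1 * (4 * X N)" using m sh by (intro mult_mono) auto
    qed (use \<nu> B \<Gamma> K A \<kappa> d in auto)
    also have "\<dots> = C2 * X N" unfolding C2_def by (simp add: algebra_simps)
    finally have Tb: "T h N * \<Lambda> N \<le> C2 * X N" .
    have "cmod (u t - v_DE a b g k h N t) \<le> I h N + 5 * (T h N * \<Lambda> N)" using total[OF h t, of N] by (simp only: mult.assoc)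
    also have "\<dots> \<le> C1 * X N + 5 * (C2 * X N)" using Ib Tb by simp
    finally show ?thesis unfolding h_def by (simp add: algebra_simps)
  qed
  show ?thesis
  \<comment> \<open>The shift by 1 makes the threshold positive.\<close>
  proof (rule that[of "N1 + 1" "C1 + 5 * C2"])
    show "invertible_mat (1\<^sub>m (2 * N + 1) - V_DE a b k (mesh \<alpha> d N) N)" if "N1 + 1 \<le> N" for N
      using solve[of "mesh \<alpha> d N" N] N1[of N] that by simp
    show "cmod (u t - v_DE a b g k (mesh \<alpha> d N) N t) \<le> (C1 + 5 * C2) * exp (- (pi * d * real N / ln (2 * d * real N / \<alpha>)))"
      if "N1 + 1 \<le> N" "t \<in> {a..b}" for N t using final[of N t] that unfolding X_def by simp
  qed simp
qed

end

theorem theorem5p1: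
  fixes a b \<alpha> d :: real
    and g :: "surface_point \<Rightarrow> complex"
    and k :: "surface_point \<Rightarrow> surface_point \<Rightarrow> complex"
    and u :: "real \<Rightarrow> complex"
  assumes "a < b" and "0 < \<alpha>" and "\<alpha> \<le> 1" and "0 < d" and "d < pi / 2"
    and "cont_interval a b g"
    and "continuous_on ({a..b} \<times> {a..b})
           (\<lambda>(t, s). k (interval_point a b t) (interval_point a b s))"
    and "H_infty d g"
    and "\<forall>z\<in>de_surface d. H_infty d (\<lambda>w. k z w)"
    and "\<forall>w\<in>de_surface d. H_infty d (\<lambda>z. k z w)"
    and "\<forall>t\<in>{a..b}. cont_interval a b (\<lambda>w. k (interval_point a b t) w)"
    and "\<forall>s\<in>{a..b}. cont_interval a b (\<lambda>z. k z (interval_point a b s))"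
    and "M_space a b \<alpha> d g"
    and "M_space_uniform a b \<alpha> d k"
    and "continuous_on {a..b} u"
    and "\<forall>t\<in>{a..b}. u t
           - integral {a..t} (\<lambda>s. k (interval_point a b t) (interval_point a b s) * u s)
           = g (interval_point a b t)"
  shows "\<exists>N0>0.
           (\<forall>N\<ge>N0. invertible_mat (1\<^sub>m (2 * N + 1) - V_DE a b k (mesh \<alpha> d N) N)) \<and>
           (\<exists>C. \<forall>N\<ge>N0.
              uniform_norm a b (\<lambda>t. u t - v_DE a b g k (mesh \<alpha> d N) N t)
                \<le> C * exp (- (pi * d * real N / ln (2 * d * real N / \<alpha>))))"
proof -
  interpret volterra_problem a b \<alpha> d g k u
    by unfold_locales (use assms in auto)
  obtain N0 C where N0: "0 < N0" "\<And>N. N0 \<le> N \<Longrightarrow> invertible_mat (1\<^sub>m (2 * N + 1) - V_DE a b k (mesh \<alpha> d N) N)"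
    and C: "\<And>N t. N0 \<le> N \<Longrightarrow> t \<in> {a..b} \<Longrightarrow> cmod (u t - v_DE a b g k (mesh \<alpha> d N) N t) \<le> C * exp (- (pi * d * real N / ln (2 * d * real N / \<alpha>)))"
    using collocation_error by metis
  have "uniform_norm a b (\<lambda>t. u t - v_DE a b g k (mesh \<alpha> d N) N t) \<le> C * exp (- (pi * d * real N / ln (2 * d * real N / \<alpha>)))"
    if "N0 \<le> N" for N
    unfolding uniform_norm_def by (rule cSUP_least) (use assms(1) C[OF that] in auto)
  then show ?thesis using N0 by blast
qed

end
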